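(* Let $n=n_0+n_1+n_2$, let $B$ be a matrix such that $BT$ is invertible, let $A_0,A_1,A_2$ be matrix-valued functions on $[a,b]$ of sizes $n\times n$, $n\times(n_1+n_2)$ and $n\times n_2$ respectively, and let $X,T,\mathcal{T},\mathcal{A}$ be as in the context. The PDE defined by $\{A_i,X\}$ is exponentially stable in $X$ with constants $K,\gamma>0$ if and only if the PIE defined by $\{\mathcal{T},\mathcal{A}\}$ is exponentially stable with constants $K,\gamma>0$.
   Context: $L_2^m=L_2([a,b];\mathbb{R}^m)$ with its standard inner product; $H_k^m$ is the Sobolev space of $\mathbb{R}^m$-valued functions on $[a,b]$ whose derivatives up to order $k$ are in $L_2$, with norm $\|\cdot\|_{H_k}$. For $\mathbf{x}=(x_0,x_1,x_2)\in L_2^{n_0}\times H_1^{n_1}\times H_2^{n_2}$, $\|\mathbf{x}\|_{L_2^{n_0}\times H_1^{n_1}\times H_2^{n_2}}=\|x_0\|_{L_2}+\|x_1\|_{H_1}+\|x_2\|_{H_2}$. A subscript $s$ denotes $\partial_s$. Exponential stability of the PDE in $X$: the PDE defined by $\{A_i,X\}$ is exponentially stable in $X$ (with constants $K,\gamma>0$) if for any $\mathbf{x}_0\in X$, any solution $\mathbf{x}$ of the PDE defined by $\{A_i,X\}$ with initial condition $\mathbf{x}_0$ satisfies $$\|\mathbf{x}(t)\|_{L_2^{n_0}\times H_1^{n_1}\times H_2^{n_2}}\le K\|\mathbf{x}_0\|_{L_2^{n_0}\times H_1^{n_1}\times H_2^{n_2}}e^{-\gamma t}.$$ Exponential stability of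 the PIE: the PIE defined by $\{\mathcal{T},\mathcal{A}\}$ is exponentially stable (with constants $K,\gamma>0$) if for $\hat{\mathbf{x}}(0)\in L_2^n$, any solution $\hat{\mathbf{x}}$ satisfies $\|\hat{\mathbf{x}}(t)\|_{L_2}\le K\|\hat{\mathbf{x}}(0)\|_{L_2}e^{-\gamma t}$. 3-PI operators: for bounded matrix-valued functions $N_0:[a,b]\to\mathbb{R}^{n\times n}$ and $N_1,N_2:[a,b]^2\to\mathbb{R}^{n\times n}$, $$(\mathcal{P}_{\{N_0,N_1,N_2\}}\mathbf{x})(s)=N_0(s)\mathbf{x}(s)+\int_a^s N_1(s,\theta)\mathbf{x}(\theta)\,d\theta+\int_s^b N_2(s,\theta)\mathbf{x}(\theta)\,d\theta .$$ The matrix $T\in\mathbb{R}^{(2n_1+4n_2)\times(n_1+2n_2)}$ is $$T=\begin{bmatrix} I_{n_1}&0&0\\ I_{n_1}&0&0\\ 0&I_{n_2}&0\\ 0&I_{n_2}&(b-a)I_{n_2}\\ 0&0&I_{n_2}\\ 0&0&I_{n_2}\end{bmatrix}.$$ Invertibility of $BT$ means in particular $B\in\mathbb{R}^{(n_1+2n_2)\times(2n_1+4n_2)}$. The space $X$ is the set of $\mathbf{x}=(x_0,x_1,x_2)\in L_2^{n_0}\times H_1^{n_1}\times H_2^{n_2}$ such that $$B\begin{bmatrix} x_1(a)\\ x_1(b)\\ x_2(a)\\ x_2(b)\\ x_{2s}(a)\\ x_{2s}(b)\end{bmatrix}=0.$$ Define (columns of $Q$ and of $G_0,\dots,G_5$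 partitioned as $n_0,n_1,n_2$; rows of $K(s),G_0,G_1,G_2$ partitioned as $n_0,n_1,n_2$; columns of $K(s)$ and $V$ partitioned as $n_1,n_2,n_2$; rows of $V,G_3,G_4,G_5$ partitioned as $n_1,n_2$; the matrix function $K(s)$ is unrelated to the constant $K$) $$Q(s,\theta)=\begin{bmatrix} 0&0&0\\ 0&I_{n_1}&0\\ 0&0&0\\ 0&0&(b-\theta)I_{n_2}\\ 0&0&0\\ 0&0&I_{n_2}\end{bmatrix},\quad K(s)=\begin{bmatrix} 0&0&0\\ I_{n_1}&0&0\\ 0&I_{n_2}&(s-a)I_{n_2}\end{bmatrix},\quad V=\begin{bmatrix} 0&0&0\\ 0&0&I_{n_2}\end{bmatrix},$$ $$G_0(s)=\begin{bmatrix} I_{n_0}&0&0\\ 0&0&0\\ 0&0&0\end{bmatrix},\quad G_2(s,\theta)=-K(s)(BT)^{-1}BQ(s,\theta),\quad G_1(s,\theta)=\begin{bmatrix} 0&0&0\\ 0&I_{n_1}&0\\ 0&0&(s-\theta)I_{n_2}\end{bmatrix}+G_2(s,\theta),$$ $$G_3(s)=\begin{bmatrix} 0&I_{n_1}&0\\ 0&0&0\end{bmatrix},\quad G_5(s,\theta)=-V(BT)^{-1}BQ(s,\theta),\quad G_4(s,\theta)=\begin{bmatrix} 0&0&0\\ 0&0&I_{n_2}\end{bmatrix}+G_5(s,\theta).$$ Then $\mathcal{T}:=\mathcal{P}_{\{G_0,G_1,G_2\}}$ and $\mathcal{A}:=\mathcal{P}_{\{H_0,H_1,H_2\}}$ with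 $H_0(s)=A_0(s)G_0(s)+A_1(s)G_3(s)+A_{20}(s)$, $A_{20}(s)=\begin{bmatrix} 0&0&A_2(s)\end{bmatrix}$, $H_1(s,\theta)=A_0(s)G_1(s,\theta)+A_1(s)G_4(s,\theta)$, $H_2(s,\theta)=A_0(s)G_2(s,\theta)+A_1(s)G_5(s,\theta)$. PDE solution: given $\mathbf{x}_0\in X$, $\mathbf{x}$ satisfies (is a solution of) the PDE defined by $\{A_i,X\}$ if $\mathbf{x}$ is Fréchet differentiable, $\mathbf{x}(0)=\mathbf{x}_0$, $\mathbf{x}(t)=(x_0(t),x_1(t),x_2(t))\in X$, and for all $t\ge0$ $$\dot{\mathbf{x}}(t,s)=A_0(s)\mathbf{x}(t,s)+A_1(s)\begin{bmatrix} \partial_sx_1(t,s)\\ \partial_sx_2(t,s)\end{bmatrix}+A_2(s)\,\partial_s^2x_2(t,s).$$ PIE solution: given $\hat{\mathbf{x}}_0\in L_2^n$, $\hat{\mathbf{x}}:\mathbb{R}^+\to L_2^n$ satisfies (is a solution of) the PIE defined by $\{\mathcal{T},\mathcal{A}\}$ if $\hat{\mathbf{x}}(0)=\hat{\mathbf{x}}_0$, $\hat{\mathbf{x}}$ is Fréchet differentiable for all $t\ge0$, and $\mathcal{T}\dot{\hat{\mathbf{x}}}(t)=\mathcal{A}\hat{\mathbf{x}}(t)$ for all $t\ge0$.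
   Formalization: The decay rate γ is the same on both sides, but the constant K may differ between the PDE and the PIE: for each γ>0, some K>0 works for the PDE iff some K>0 works for the PIE; with the same K the equivalence is false, since the two norms are only equivalent. *)

theory Defs
  imports "HOL-Analysis.Analysis" "Jordan_Normal_Form.Matrix"
begin

hide_type (open) Finite_Cartesian_Product.vec
hide_const (open) Finite_Cartesian_Product.vec Finite_Cartesian_Product.mat
no_notation Finite_Cartesian_Product.vec_nth (infixl \<open>$\<close> 90)
no_notation inner (infix \<open>\<bullet>\<close> 70)

text \<open>
  The dimensions n0, n1, n2 are natural numbers and any of them may be 0, so vectors and
  matrices are those with explicit dimensions from Jordan_Normal_Form.  Elements of function
  spaces on [a,b] are represented by functions \<^typ>\<open>real \<Rightarrow> real vec\<close>; equality
  of elements is equality almost everywhere on [a,b], and values outside [a,b] are irrelevant.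
\<close>

subsection \<open>Function spaces\<close>

definition L2 :: "real \<Rightarrow> real \<Rightarrow> nat \<Rightarrow> (real \<Rightarrow> real vec) set" where
  "L2 a b m = {f. (\<forall>s\<in>{a..b}. f s \<in> carrier_vec m) \<and>
     (\<forall>i<m. (\<lambda>s. f s $ i) \<in> borel_measurable (lebesgue_on {a..b}) \<and>
            integrable (lebesgue_on {a..b}) (\<lambda>s. (f s $ i)\<^sup>2))}"

definition L2_norm :: "real \<Rightarrow> real \<Rightarrow> (real \<Rightarrow> real vec) \<Rightarrow> real" where
  "L2_norm a b f = sqrt (LINT s|lebesgue_on {a..b}. f s \<bullet> f s)"

definition eq_ae :: "real \<Rightarrow> real \<Rightarrow> (real \<Rightarrow> real vec) \<Rightarrow> (real \<Rightarrow> real vec) \<Rightarrow> bool" where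
  "eq_ae a b f g \<longleftrightarrow> (AE s in lebesgue_on {a..b}. f s = g s)"

text \<open>
  Weak derivatives are tested against continuously differentiable functions with compact
  support in the open interval (a,b).
\<close>

definition test_fun :: "real \<Rightarrow> real \<Rightarrow> (real \<Rightarrow> real) \<Rightarrow> (real \<Rightarrow> real) \<Rightarrow> bool" where
  "test_fun a b \<phi> \<phi>' \<longleftrightarrow>
     (\<forall>s. (\<phi> has_real_derivative \<phi>' s) (at s)) \<and> continuous_on UNIV \<phi>' \<and>
     (\<exists>c d. a < c \<and> d < b \<and> (\<forall>s. s \<notin> {c..d} \<longrightarrow> \<phi> s = 0))"

definition is_weak_deriv ::
  "real \<Rightarrow> real \<Rightarrow> nat \<Rightarrow> (real \<Rightarrow> real vec) \<Rightarrow> (real \<Rightarrow> real vec) \<Rightarrow> bool" where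
  "is_weak_deriv a b m f g \<longleftrightarrow>
     (\<forall>\<phi> \<phi>'. test_fun a b \<phi> \<phi>' \<longrightarrow> (\<forall>i<m.
        (LINT s|lebesgue_on {a..b}. f s $ i * \<phi>' s) =
        - (LINT s|lebesgue_on {a..b}. g s $ i * \<phi> s)))"

fun sobolev :: "real \<Rightarrow> real \<Rightarrow> nat \<Rightarrow> nat \<Rightarrow> (real \<Rightarrow> real vec) set" where
  "sobolev a b 0 m = L2 a b m"
| "sobolev a b (Suc k) m = {f \<in> L2 a b m. \<exists>g \<in> sobolev a b k m. is_weak_deriv a b m f g}"

text \<open>The weak derivative in L2, which is unique up to equality almost everywhere.\<close>

definition wderiv :: "real \<Rightarrow> real \<Rightarrow> nat \<Rightarrow> (real \<Rightarrow> real vec) \<Rightarrow> real \<Rightarrow> real vec" where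
  "wderiv a b m f = (SOME g. g \<in> L2 a b m \<and> is_weak_deriv a b m f g)"

definition sobolev_norm :: "real \<Rightarrow> real \<Rightarrow> nat \<Rightarrow> nat \<Rightarrow> (real \<Rightarrow> real vec) \<Rightarrow> real" where
  "sobolev_norm a b k m f = sqrt (\<Sum>i\<le>k. (L2_norm a b ((wderiv a b m ^^ i) f))\<^sup>2)"

text \<open>
  The value at a point p of [a,b] of an element of H1 is the value of its continuous
  representative; it does not depend on the chosen representative f.
\<close>

definition point_val :: "real \<Rightarrow> real \<Rightarrow> nat \<Rightarrow> (real \<Rightarrow> real vec) \<Rightarrow> real \<Rightarrow> real vec" where
  "point_val a b m f p = vec m (\<lambda>i. THE v. \<exists>g. continuous_on {a..b} g \<and>
     (AE s in lebesgue_on {a..b}. f s $ i = g s) \<and> v = g p)"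

type_synonym state = "(real \<Rightarrow> real vec) \<times> (real \<Rightarrow> real vec) \<times> (real \<Rightarrow> real vec)"

definition state_space :: "real \<Rightarrow> real \<Rightarrow> nat \<Rightarrow> nat \<Rightarrow> nat \<Rightarrow> state set" where
  "state_space a b n0 n1 n2 = L2 a b n0 \<times> sobolev a b 1 n1 \<times> sobolev a b 2 n2"

fun state_norm :: "real \<Rightarrow> real \<Rightarrow> nat \<Rightarrow> nat \<Rightarrow> nat \<Rightarrow> state \<Rightarrow> real" where
  "state_norm a b n0 n1 n2 (x0, x1, x2) =
     L2_norm a b x0 + sobolev_norm a b 1 n1 x1 + sobolev_norm a b 2 n2 x2"

fun state_eq_ae :: "real \<Rightarrow> real \<Rightarrow> state \<Rightarrow> state \<Rightarrow> bool" where
  "state_eq_ae a b (x0, x1, x2) (y0, y1, y2) \<longleftrightarrow>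
     eq_ae a b x0 y0 \<and> eq_ae a b x1 y1 \<and> eq_ae a b x2 y2"

subsection \<open>Block matrices\<close>

definition append_cols :: "real mat \<Rightarrow> real mat \<Rightarrow> real mat" (infixr \<open>@\<^sub>c\<close> 68) where
  "A @\<^sub>c B = four_block_mat A B (0\<^sub>m 0 (dim_col A)) (0\<^sub>m 0 (dim_col B))"

definition mat_inv :: "real mat \<Rightarrow> real mat" where
  "mat_inv M = (THE N. inverts_mat M N \<and> inverts_mat N M)"

text \<open>
  With c = (x1(a), x2(a), x2_s(a)) and y = (x0, x1_s, x2_ss), Taylor's formula gives the vector
  of boundary values (x1(a), x1(b), x2(a), x2(b), x2_s(a), x2_s(b)) as T c plus the integral of
  Q y, so the boundary condition determines c from y when B T is invertible.  Then T_op y = x,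
  where K, G0, G1, G2 reconstruct x and V, G3, G4, G5 reconstruct (x1_s, x2_s).
\<close>

definition T_mat :: "real \<Rightarrow> real \<Rightarrow> nat \<Rightarrow> nat \<Rightarrow> real mat" where
  "T_mat a b n1 n2 =
     (1\<^sub>m n1    @\<^sub>c 0\<^sub>m n1 n2 @\<^sub>c 0\<^sub>m n1 n2) @\<^sub>r
     (1\<^sub>m n1    @\<^sub>c 0\<^sub>m n1 n2 @\<^sub>c 0\<^sub>m n1 n2) @\<^sub>r
     (0\<^sub>m n2 n1 @\<^sub>c 1\<^sub>m n2    @\<^sub>c 0\<^sub>m n2 n2) @\<^sub>r
     (0\<^sub>m n2 n1 @\<^sub>c 1\<^sub>m n2    @\<^sub>c (b - a) \<cdot>\<^sub>m 1\<^sub>m n2) @\<^sub>r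
     (0\<^sub>m n2 n1 @\<^sub>c 0\<^sub>m n2 n2 @\<^sub>c 1\<^sub>m n2) @\<^sub>r
     (0\<^sub>m n2 n1 @\<^sub>c 0\<^sub>m n2 n2 @\<^sub>c 1\<^sub>m n2)"

definition Q_mat :: "real \<Rightarrow> nat \<Rightarrow> nat \<Rightarrow> nat \<Rightarrow> real \<Rightarrow> real mat" where
  "Q_mat b n0 n1 n2 \<theta> =
     (0\<^sub>m n1 n0 @\<^sub>c 0\<^sub>m n1 n1 @\<^sub>c 0\<^sub>m n1 n2) @\<^sub>r
     (0\<^sub>m n1 n0 @\<^sub>c 1\<^sub>m n1    @\<^sub>c 0\<^sub>m n1 n2) @\<^sub>r
     (0\<^sub>m n2 n0 @\<^sub>c 0\<^sub>m n2 n1 @\<^sub>c 0\<^sub>m n2 n2) @\<^sub>r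
     (0\<^sub>m n2 n0 @\<^sub>c 0\<^sub>m n2 n1 @\<^sub>c (b - \<theta>) \<cdot>\<^sub>m 1\<^sub>m n2) @\<^sub>r
     (0\<^sub>m n2 n0 @\<^sub>c 0\<^sub>m n2 n1 @\<^sub>c 0\<^sub>m n2 n2) @\<^sub>r
     (0\<^sub>m n2 n0 @\<^sub>c 0\<^sub>m n2 n1 @\<^sub>c 1\<^sub>m n2)"

definition K_mat :: "real \<Rightarrow> nat \<Rightarrow> nat \<Rightarrow> nat \<Rightarrow> real \<Rightarrow> real mat" where
  "K_mat a n0 n1 n2 s =
     (0\<^sub>m n0 n1 @\<^sub>c 0\<^sub>m n0 n2 @\<^sub>c 0\<^sub>m n0 n2) @\<^sub>r
     (1\<^sub>m n1    @\<^sub>c 0\<^sub>m n1 n2 @\<^sub>c 0\<^sub>m n1 n2) @\<^sub>r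
     (0\<^sub>m n2 n1 @\<^sub>c 1\<^sub>m n2    @\<^sub>c (s - a) \<cdot>\<^sub>m 1\<^sub>m n2)"

definition V_mat :: "nat \<Rightarrow> nat \<Rightarrow> real mat" where
  "V_mat n1 n2 =
     (0\<^sub>m n1 n1 @\<^sub>c 0\<^sub>m n1 n2 @\<^sub>c 0\<^sub>m n1 n2) @\<^sub>r
     (0\<^sub>m n2 n1 @\<^sub>c 0\<^sub>m n2 n2 @\<^sub>c 1\<^sub>m n2)"

definition G0 :: "nat \<Rightarrow> nat \<Rightarrow> nat \<Rightarrow> real \<Rightarrow> real mat" where
  "G0 n0 n1 n2 s =
     (1\<^sub>m n0    @\<^sub>c 0\<^sub>m n0 n1 @\<^sub>c 0\<^sub>m n0 n2) @\<^sub>r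
     (0\<^sub>m n1 n0 @\<^sub>c 0\<^sub>m n1 n1 @\<^sub>c 0\<^sub>m n1 n2) @\<^sub>r
     (0\<^sub>m n2 n0 @\<^sub>c 0\<^sub>m n2 n1 @\<^sub>c 0\<^sub>m n2 n2)"

definition G2 ::
  "real \<Rightarrow> real \<Rightarrow> nat \<Rightarrow> nat \<Rightarrow> nat \<Rightarrow> real mat \<Rightarrow> real \<Rightarrow> real \<Rightarrow> real mat" where
  "G2 a b n0 n1 n2 B s \<theta> =
     - (K_mat a n0 n1 n2 s * mat_inv (B * T_mat a b n1 n2) * B * Q_mat b n0 n1 n2 \<theta>)"

definition G1 ::
  "real \<Rightarrow> real \<Rightarrow> nat \<Rightarrow> nat \<Rightarrow> nat \<Rightarrow> real mat \<Rightarrow> real \<Rightarrow> real \<Rightarrow> real mat" where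
  "G1 a b n0 n1 n2 B s \<theta> =
     ((0\<^sub>m n0 n0 @\<^sub>c 0\<^sub>m n0 n1 @\<^sub>c 0\<^sub>m n0 n2) @\<^sub>r
      (0\<^sub>m n1 n0 @\<^sub>c 1\<^sub>m n1    @\<^sub>c 0\<^sub>m n1 n2) @\<^sub>r
      (0\<^sub>m n2 n0 @\<^sub>c 0\<^sub>m n2 n1 @\<^sub>c (s - \<theta>) \<cdot>\<^sub>m 1\<^sub>m n2))
     + G2 a b n0 n1 n2 B s \<theta>"

definition G3 :: "nat \<Rightarrow> nat \<Rightarrow> nat \<Rightarrow> real \<Rightarrow> real mat" where
  "G3 n0 n1 n2 s =
     (0\<^sub>m n1 n0 @\<^sub>c 1\<^sub>m n1    @\<^sub>c 0\<^sub>m n1 n2) @\<^sub>r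
     (0\<^sub>m n2 n0 @\<^sub>c 0\<^sub>m n2 n1 @\<^sub>c 0\<^sub>m n2 n2)"

definition G5 ::
  "real \<Rightarrow> real \<Rightarrow> nat \<Rightarrow> nat \<Rightarrow> nat \<Rightarrow> real mat \<Rightarrow> real \<Rightarrow> real \<Rightarrow> real mat" where
  "G5 a b n0 n1 n2 B s \<theta> =
     - (V_mat n1 n2 * mat_inv (B * T_mat a b n1 n2) * B * Q_mat b n0 n1 n2 \<theta>)"

definition G4 ::
  "real \<Rightarrow> real \<Rightarrow> nat \<Rightarrow> nat \<Rightarrow> nat \<Rightarrow> real mat \<Rightarrow> real \<Rightarrow> real \<Rightarrow> real mat" where
  "G4 a b n0 n1 n2 B s \<theta> =
     ((0\<^sub>m n1 n0 @\<^sub>c 0\<^sub>m n1 n1 @\<^sub>c 0\<^sub>m n1 n2) @\<^sub>r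
      (0\<^sub>m n2 n0 @\<^sub>c 0\<^sub>m n2 n1 @\<^sub>c 1\<^sub>m n2))
     + G5 a b n0 n1 n2 B s \<theta>"

definition H0 :: "nat \<Rightarrow> nat \<Rightarrow> nat \<Rightarrow> (real \<Rightarrow> real mat) \<Rightarrow> (real \<Rightarrow> real mat) \<Rightarrow>
    (real \<Rightarrow> real mat) \<Rightarrow> real \<Rightarrow> real mat" where
  "H0 n0 n1 n2 A0 A1 A2 s =
     A0 s * G0 n0 n1 n2 s + A1 s * G3 n0 n1 n2 s +
     (0\<^sub>m (n0 + n1 + n2) n0 @\<^sub>c 0\<^sub>m (n0 + n1 + n2) n1 @\<^sub>c A2 s)"

definition H1 :: "real \<Rightarrow> real \<Rightarrow> nat \<Rightarrow> nat \<Rightarrow> nat \<Rightarrow> real mat \<Rightarrow> (real \<Rightarrow> real mat) \<Rightarrow>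
    (real \<Rightarrow> real mat) \<Rightarrow> real \<Rightarrow> real \<Rightarrow> real mat" where
  "H1 a b n0 n1 n2 B A0 A1 s \<theta> =
     A0 s * G1 a b n0 n1 n2 B s \<theta> + A1 s * G4 a b n0 n1 n2 B s \<theta>"

definition H2 :: "real \<Rightarrow> real \<Rightarrow> nat \<Rightarrow> nat \<Rightarrow> nat \<Rightarrow> real mat \<Rightarrow> (real \<Rightarrow> real mat) \<Rightarrow>
    (real \<Rightarrow> real mat) \<Rightarrow> real \<Rightarrow> real \<Rightarrow> real mat" where
  "H2 a b n0 n1 n2 B A0 A1 s \<theta> =
     A0 s * G2 a b n0 n1 n2 B s \<theta> + A1 s * G5 a b n0 n1 n2 B s \<theta>"

subsection \<open>3-PI operators\<close>

definition PI_op :: "real \<Rightarrow> real \<Rightarrow> nat \<Rightarrow> (real \<Rightarrow> real mat) \<Rightarrow> (real \<Rightarrow> real \<Rightarrow> real mat) \<Rightarrow>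
    (real \<Rightarrow> real \<Rightarrow> real mat) \<Rightarrow> (real \<Rightarrow> real vec) \<Rightarrow> real \<Rightarrow> real vec" where
  "PI_op a b n N0 N1 N2 x s =
     N0 s *\<^sub>v x s
     + vec n (\<lambda>i. LINT \<theta>|lebesgue_on {a..s}. (N1 s \<theta> *\<^sub>v x \<theta>) $ i)
     + vec n (\<lambda>i. LINT \<theta>|lebesgue_on {s..b}. (N2 s \<theta> *\<^sub>v x \<theta>) $ i)"

definition T_op :: "real \<Rightarrow> real \<Rightarrow> nat \<Rightarrow> nat \<Rightarrow> nat \<Rightarrow> real mat \<Rightarrow>
    (real \<Rightarrow> real vec) \<Rightarrow> real \<Rightarrow> real vec" where
  "T_op a b n0 n1 n2 B =
     PI_op a b (n0 + n1 + n2) (G0 n0 n1 n2) (G1 a b n0 n1 n2 B) (G2 a b n0 n1 n2 B)"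

definition A_op :: "real \<Rightarrow> real \<Rightarrow> nat \<Rightarrow> nat \<Rightarrow> nat \<Rightarrow> real mat \<Rightarrow> (real \<Rightarrow> real mat) \<Rightarrow>
    (real \<Rightarrow> real mat) \<Rightarrow> (real \<Rightarrow> real mat) \<Rightarrow> (real \<Rightarrow> real vec) \<Rightarrow> real \<Rightarrow> real vec" where
  "A_op a b n0 n1 n2 B A0 A1 A2 =
     PI_op a b (n0 + n1 + n2) (H0 n0 n1 n2 A0 A1 A2)
       (H1 a b n0 n1 n2 B A0 A1) (H2 a b n0 n1 n2 B A0 A1)"

subsection \<open>Solutions and exponential stability\<close>

definition X_space :: "real \<Rightarrow> real \<Rightarrow> nat \<Rightarrow> nat \<Rightarrow> nat \<Rightarrow> real mat \<Rightarrow> state set" where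
  "X_space a b n0 n1 n2 B = {(x0, x1, x2). (x0, x1, x2) \<in> state_space a b n0 n1 n2 \<and>
     B *\<^sub>v (point_val a b n1 x1 a @\<^sub>v point_val a b n1 x1 b @\<^sub>v
           point_val a b n2 x2 a @\<^sub>v point_val a b n2 x2 b @\<^sub>v
           point_val a b n2 (wderiv a b n2 x2) a @\<^sub>v point_val a b n2 (wderiv a b n2 x2) b)
     = 0\<^sub>v (n1 + 2 * n2)}"

text \<open>
  Frechet differentiability of a curve at time \<open>t\<close> (one-sided at 0) with derivative \<open>d\<close> means
  that the norm of the remainder below is \<open>o(\<bar>\<tau> - t\<bar>)\<close>, in the norm of the space in
  question: L2 for the PIE, and L2 x H1 x H2 (whose norm the subspace X carries) for the PDE.
\<close>

definition remainder :: "(real \<Rightarrow> real \<Rightarrow> real vec) \<Rightarrow> (real \<Rightarrow> real vec) \<Rightarrow> real \<Rightarrow> real \<Rightarrow>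
    real \<Rightarrow> real vec" where
  "remainder x d t \<tau> = (\<lambda>s. x \<tau> s - x t s - (\<tau> - t) \<cdot>\<^sub>v d s)"

fun state_remainder :: "(real \<Rightarrow> state) \<Rightarrow> state \<Rightarrow> real \<Rightarrow> real \<Rightarrow> state" where
  "state_remainder x (d0, d1, d2) t \<tau> =
     (remainder (\<lambda>r. fst (x r)) d0 t \<tau>,
      remainder (\<lambda>r. fst (snd (x r))) d1 t \<tau>,
      remainder (\<lambda>r. snd (snd (x r))) d2 t \<tau>)"

definition L2_has_deriv :: "real \<Rightarrow> real \<Rightarrow> nat \<Rightarrow> (real \<Rightarrow> real \<Rightarrow> real vec) \<Rightarrow>
    (real \<Rightarrow> real vec) \<Rightarrow> real \<Rightarrow> bool" where
  "L2_has_deriv a b n x d t \<longleftrightarrow> d \<in> L2 a b n \<and>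
     ((\<lambda>\<tau>. L2_norm a b (remainder x d t \<tau>) / \<bar>\<tau> - t\<bar>) \<longlongrightarrow> 0) (at t within {0..})"

definition state_has_deriv :: "real \<Rightarrow> real \<Rightarrow> nat \<Rightarrow> nat \<Rightarrow> nat \<Rightarrow> (real \<Rightarrow> state) \<Rightarrow>
    state \<Rightarrow> real \<Rightarrow> bool" where
  "state_has_deriv a b n0 n1 n2 x d t \<longleftrightarrow> d \<in> state_space a b n0 n1 n2 \<and>
     ((\<lambda>\<tau>. state_norm a b n0 n1 n2 (state_remainder x d t \<tau>) / \<bar>\<tau> - t\<bar>) \<longlongrightarrow> 0)
       (at t within {0..})"

fun state_vec :: "state \<Rightarrow> real \<Rightarrow> real vec" where
  "state_vec (x0, x1, x2) s = x0 s @\<^sub>v x1 s @\<^sub>v x2 s"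

fun pde_rhs :: "real \<Rightarrow> real \<Rightarrow> nat \<Rightarrow> nat \<Rightarrow> (real \<Rightarrow> real mat) \<Rightarrow> (real \<Rightarrow> real mat) \<Rightarrow>
    (real \<Rightarrow> real mat) \<Rightarrow> state \<Rightarrow> real \<Rightarrow> real vec" where
  "pde_rhs a b n1 n2 A0 A1 A2 (x0, x1, x2) s =
     A0 s *\<^sub>v (x0 s @\<^sub>v x1 s @\<^sub>v x2 s)
     + A1 s *\<^sub>v (wderiv a b n1 x1 s @\<^sub>v wderiv a b n2 x2 s)
     + A2 s *\<^sub>v wderiv a b n2 (wderiv a b n2 x2) s"

definition pde_solution :: "real \<Rightarrow> real \<Rightarrow> nat \<Rightarrow> nat \<Rightarrow> nat \<Rightarrow> real mat \<Rightarrow>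
    (real \<Rightarrow> real mat) \<Rightarrow> (real \<Rightarrow> real mat) \<Rightarrow> (real \<Rightarrow> real mat) \<Rightarrow>
    state \<Rightarrow> (real \<Rightarrow> state) \<Rightarrow> bool" where
  "pde_solution a b n0 n1 n2 B A0 A1 A2 x_init x \<longleftrightarrow>
     state_eq_ae a b (x 0) x_init \<and>
     (\<forall>t\<ge>0. x t \<in> X_space a b n0 n1 n2 B \<and>
        (\<exists>d. state_has_deriv a b n0 n1 n2 x d t \<and>
             eq_ae a b (state_vec d) (pde_rhs a b n1 n2 A0 A1 A2 (x t))))"

definition pie_solution :: "real \<Rightarrow> real \<Rightarrow> nat \<Rightarrow> nat \<Rightarrow> nat \<Rightarrow> real mat \<Rightarrow>
    (real \<Rightarrow> real mat) \<Rightarrow> (real \<Rightarrow> real mat) \<Rightarrow> (real \<Rightarrow> real mat) \<Rightarrow>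
    (real \<Rightarrow> real vec) \<Rightarrow> (real \<Rightarrow> real \<Rightarrow> real vec) \<Rightarrow> bool" where
  "pie_solution a b n0 n1 n2 B A0 A1 A2 x_init x \<longleftrightarrow>
     eq_ae a b (x 0) x_init \<and>
     (\<forall>t\<ge>0. x t \<in> L2 a b (n0 + n1 + n2) \<and>
        (\<exists>d. L2_has_deriv a b (n0 + n1 + n2) x d t \<and>
             eq_ae a b (T_op a b n0 n1 n2 B d) (A_op a b n0 n1 n2 B A0 A1 A2 (x t))))"

text \<open>
  K and \<open>\<gamma>\<close> are the constants of the exponential bound.  The PDE norm and the L2 norm
  of the PIE state are equivalent but not equal, so the admissible values of K differ in general
  between the two notions, while the decay rate \<open>\<gamma>\<close> can be compared directly.
\<close>

definition pde_exp_stable :: "real \<Rightarrow> real \<Rightarrow> nat \<Rightarrow> nat \<Rightarrow> nat \<Rightarrow> real mat \<Rightarrow>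
    (real \<Rightarrow> real mat) \<Rightarrow> (real \<Rightarrow> real mat) \<Rightarrow> (real \<Rightarrow> real mat) \<Rightarrow>
    real \<Rightarrow> real \<Rightarrow> bool" where
  "pde_exp_stable a b n0 n1 n2 B A0 A1 A2 K \<gamma> \<longleftrightarrow>
     (\<forall>x_init \<in> X_space a b n0 n1 n2 B. \<forall>x.
        pde_solution a b n0 n1 n2 B A0 A1 A2 x_init x \<longrightarrow>
        (\<forall>t\<ge>0. state_norm a b n0 n1 n2 (x t) \<le>
                K * state_norm a b n0 n1 n2 x_init * exp (- \<gamma> * t)))"

definition pie_exp_stable :: "real \<Rightarrow> real \<Rightarrow> nat \<Rightarrow> nat \<Rightarrow> nat \<Rightarrow> real mat \<Rightarrow>
    (real \<Rightarrow> real mat) \<Rightarrow> (real \<Rightarrow> real mat) \<Rightarrow> (real \<Rightarrow> real mat) \<Rightarrow>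
    real \<Rightarrow> real \<Rightarrow> bool" where
  "pie_exp_stable a b n0 n1 n2 B A0 A1 A2 K \<gamma> \<longleftrightarrow>
     (\<forall>x_init \<in> L2 a b (n0 + n1 + n2). \<forall>x.
        pie_solution a b n0 n1 n2 B A0 A1 A2 x_init x \<longrightarrow>
        (\<forall>t\<ge>0. L2_norm a b (x t) \<le> K * L2_norm a b x_init * exp (- \<gamma> * t)))"

end

theory Submission
  imports Defs
begin

text \<open>
  A state x = (x0, x1, x2) of X is determined by y = (x0, x1_s, x2_ss): in one dimension a function
  with an integrable weak derivative is a constant plus the primitive of that derivative
  (du Bois-Reymond), and invertibility of B T lets the boundary condition determine the constants
  from y.  Thus T_op, viewed as a map from L2 onto X, has the inverse x \<open>\<mapsto>\<close> (x0, x1_s, x2_ss), and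
  both maps are linear and bounded.  They carry solutions of the PIE to solutions of the PDE and back,
  since A_op y is the right-hand side of the PDE evaluated at T_op y, so an exponential estimate
  transfers in either direction with the same rate.
\<close>

section \<open>Weak derivatives on an interval\<close>

text \<open>Three obstacles shape the argument. Functions matter only up to null sets and
  \<open>wderiv\<close> is a choice among representatives, so the two maps are inverse to each other
  only almost everywhere, and norms, boundary values and derivatives all have to be shown
  insensitive to the representative. The derivative of a solution curve in X is a priori just an
  element of the ambient Sobolev space, whereas reconstruction from its own derivatives gives it
  back only if it satisfies the boundary conditions; continuity of the reconstruction and uniqueness
  of L2-derivatives close this gap. Any dimension may be 0, so constants obtained by counting
  components carry an extra 1 that keeps them positive. Since test functions are merely continuously
  differentiable, the du Bois-Reymond lemma gets by without mollifiers: a continuous function with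
  compact support and zero integral is already the derivative of a test function. Only the existence
  of constants matters, so crude inequalities replace sharp operator norms, and vector-valued
  statements are reduced to their scalar components.\<close>

definition sq_int :: "real \<Rightarrow> real \<Rightarrow> (real \<Rightarrow> real) set" where
  "sq_int a b = {f \<in> borel_measurable (lebesgue_on {a..b}).
     integrable (lebesgue_on {a..b}) (\<lambda>s. (f s)\<^sup>2)}"

definition l2 :: "real \<Rightarrow> real \<Rightarrow> (real \<Rightarrow> real) \<Rightarrow> real" where
  "l2 a b f = sqrt (LINT s|lebesgue_on {a..b}. (f s)\<^sup>2)"

definition weak_deriv :: "real \<Rightarrow> real \<Rightarrow> (real \<Rightarrow> real) \<Rightarrow> (real \<Rightarrow> real) \<Rightarrow> bool" where
  "weak_deriv a b f g \<longleftrightarrow> (\<forall>\<phi> \<phi>'. test_fun a b \<phi> \<phi>' \<longrightarrow>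
     (LINT s|lebesgue_on {a..b}. f s * \<phi>' s) = - (LINT s|lebesgue_on {a..b}. g s * \<phi> s))"

definition primitive :: "real \<Rightarrow> (real \<Rightarrow> real) \<Rightarrow> real \<Rightarrow> real" where
  "primitive a g s = (LINT \<theta>|lebesgue_on {a..s}. g \<theta>)"

section \<open>Integrability and test functions on a compact interval\<close>

lemma finite_measure_interval: "finite_measure (lebesgue_on {a..b::real})"
  by (simp add: finite_measure_lebesgue_on)

lemma continuous_measurable_interval [measurable_dest]:
  fixes f :: "real \<Rightarrow> real"
  shows "continuous_on {a..b} f \<Longrightarrow> f \<in> borel_measurable (lebesgue_on {a..b})"
  by (rule continuous_imp_measurable_on_sets_lebesgue) auto

lemma continuous_bounded_interval:
  fixes f :: "real \<Rightarrow> real"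
  assumes "continuous_on {a..b} f"
  obtains C where "\<And>s. s \<in> {a..b} \<Longrightarrow> \<bar>f s\<bar> \<le> C"
proof -
  have "bounded (f ` {a..b})"
    using assms by (intro compact_imp_bounded compact_continuous_image) auto
  then obtain C where "\<forall>s\<in>{a..b}. \<bar>f s\<bar> \<le> C" by (auto simp: bounded_iff)
  thus ?thesis using that by blast
qed

lemma indicator_measurable_lebesgue_on:
  "A \<in> sets borel \<Longrightarrow> (indicator A :: real \<Rightarrow> real) \<in> borel_measurable (lebesgue_on S)"
  by (intro measurable_restrict_space1 borel_measurable_indicator) simp

lemma integrable_bounded_mult:
  fixes h g :: "real \<Rightarrow> real"
  assumes "h \<in> borel_measurable (lebesgue_on {a..b})" "integrable (lebesgue_on {a..b}) g"
    and "\<And>s. s \<in> {a..b} \<Longrightarrow> \<bar>h s\<bar> \<le> C"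
  shows "integrable (lebesgue_on {a..b}) (\<lambda>s. h s * g s)"
proof (rule Bochner_Integration.integrable_bound)
  show "integrable (lebesgue_on {a..b}) (\<lambda>s. C * g s)" using assms(2) by simp
  show "AE s in lebesgue_on {a..b}. norm (h s * g s) \<le> norm (C * g s)"
    using assms(3) by (intro AE_I2) (fastforce simp: abs_mult intro: mult_right_mono)
qed (use assms in measurable)

lemma integrable_continuous_mult:
  fixes h g :: "real \<Rightarrow> real"
  assumes "continuous_on {a..b} h" "integrable (lebesgue_on {a..b}) g"
  shows "integrable (lebesgue_on {a..b}) (\<lambda>s. h s * g s)"
  using continuous_bounded_interval[OF assms(1)] continuous_measurable_interval[OF assms(1)]
    integrable_bounded_mult[OF _ assms(2)] by metis

lemma integrable_continuous_interval:
  fixes h :: "real \<Rightarrow> real"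
  assumes "continuous_on {a..b} h"
  shows "integrable (lebesgue_on {a..b}) h"
proof -
  interpret finite_measure "lebesgue_on {a..b}" by (rule finite_measure_interval)
  show ?thesis using integrable_continuous_mult[OF assms, of "\<lambda>_. 1"] by simp
qed

lemma test_fun_continuous:
  assumes "test_fun a b \<phi> \<phi>'"
  shows "continuous_on S \<phi>" "continuous_on S \<phi>'"
  using assms unfolding test_fun_def
  by (meson continuous_on_subset DERIV_continuous_on has_field_derivative_at_within top_greatest)+

lemma test_fun_endpoints:
  assumes "test_fun a b \<phi> \<phi>'"
  shows "\<phi> a = 0" "\<phi> b = 0"
  using assms unfolding test_fun_def by force+

lemma test_fun_integral:
  assumes "test_fun a b \<phi> \<phi>'" "c \<le> d"
  shows "(LINT s|lebesgue_on {c..d}. \<phi>' s) = \<phi> d - \<phi> c"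
proof -
  have "(\<phi>' has_integral (\<phi> d - \<phi> c)) {c..d}"
    using assms unfolding test_fun_def
    by (intro fundamental_theorem_of_calculus)
       (auto simp: has_real_derivative_iff_has_vector_derivative[symmetric]
             intro: has_field_derivative_at_within)
  thus ?thesis
    using integrable_continuous_interval[OF test_fun_continuous(2)[OF assms(1)]]
    by (simp add: lebesgue_integral_eq_integral integral_unique)
qed

section \<open>Integrals over subintervals and integration by parts through Fubini\<close>

lemma integral_lower_interval:
  fixes g :: "real \<Rightarrow> real"
  assumes "s \<in> {a..b}"
  shows "(LINT \<theta>|lebesgue_on {a..s}. g \<theta>) =
         (LINT \<theta>|lebesgue_on {a..b}. indicator {..s} \<theta> * g \<theta>)"
  using assms by (simp add: integral_restrict_space)
    (auto intro!: Bochner_Integration.integral_cong simp: indicator_def)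

lemma integral_upper_interval:
  fixes g :: "real \<Rightarrow> real"
  assumes "s \<in> {a..b}"
  shows "(LINT \<theta>|lebesgue_on {s..b}. g \<theta>) =
         (LINT \<theta>|lebesgue_on {a..b}. indicator {s..} \<theta> * g \<theta>)"
  using assms by (simp add: integral_restrict_space)
    (auto intro!: Bochner_Integration.integral_cong simp: indicator_def)

text \<open>Both sides integrate u(r) g(\<theta>) over the triangle \<theta> \<le> r. With u the
  derivative of a test function this serves as integration by parts; with u = 1 it yields the
  formula for repeated integration.\<close>

lemma Fubini_triangle:
  fixes u g :: "real \<Rightarrow> real"
  assumes [measurable]: "integrable (lebesgue_on {a..b}) u" "integrable (lebesgue_on {a..b}) g"
  shows "(LINT r|lebesgue_on {a..b}. u r * primitive a g r) =
         (LINT \<theta>|lebesgue_on {a..b}. g \<theta> * (LINT r|lebesgue_on {\<theta>..b}. u r))"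
proof -
  let ?M = "lebesgue_on {a..b}"
  interpret finite_measure ?M by (rule finite_measure_interval)
  interpret pair_sigma_finite ?M ?M ..
  \<comment> \<open>Measurability of the identity makes the comparison \<theta> \<le> r measurable
    on the product space.\<close>
  have [measurable]: "(\<lambda>s::real. s) \<in> borel_measurable ?M"
    by (intro continuous_measurable_interval continuous_intros)
  have ug: "integrable (?M \<Otimes>\<^sub>M ?M) (\<lambda>(r, \<theta>). u r * g \<theta>)"
  proof (rule Fubini_integrable)
    show "integrable ?M (\<lambda>r. LINT \<theta>|?M. norm (case (r, \<theta>) of (r, \<theta>) \<Rightarrow> u r * g \<theta>))"
      using assms by (simp add: abs_mult)
  qed (use assms in auto)
  have "integrable (?M \<Otimes>\<^sub>M ?M) (\<lambda>(r, \<theta>). u r * ((if \<theta> \<le> r then 1 else 0) * g \<theta>))"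
    by (rule Bochner_Integration.integrable_bound[OF ug]) auto
  from Fubini_integral[OF this]
  have "(LINT r|?M. u r * (LINT \<theta>|?M. (if \<theta> \<le> r then 1 else 0) * g \<theta>)) =
        (LINT \<theta>|?M. LINT r|?M. u r * ((if \<theta> \<le> r then 1 else 0) * g \<theta>))"
    by simp
  also have "\<dots> = (LINT \<theta>|?M. LINT r|?M. g \<theta> * ((if \<theta> \<le> r then 1 else 0) * u r))"
    by (simp only: mult.commute mult.left_commute)
  finally have "(LINT r|?M. u r * (LINT \<theta>|?M. (if \<theta> \<le> r then 1 else 0) * g \<theta>)) =
        (LINT \<theta>|?M. g \<theta> * (LINT r|?M. (if \<theta> \<le> r then 1 else 0) * u r))"
    by (simp only: integral_mult_right_zero)
  moreover have "(LINT \<theta>|?M. (if \<theta> \<le> r then 1 else 0) * g \<theta>) = primitive a g r" if "r \<in> {a..b}" for r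
    unfolding primitive_def integral_lower_interval[OF that]
    by (intro Bochner_Integration.integral_cong) (auto simp: indicator_def)
  moreover have "(LINT r|?M. (if \<theta> \<le> r then 1 else 0) * u r) = (LINT r|lebesgue_on {\<theta>..b}. u r)"
    if "\<theta> \<in> {a..b}" for \<theta>
    unfolding integral_upper_interval[OF that]
    by (intro Bochner_Integration.integral_cong) (auto simp: indicator_def)
  ultimately show ?thesis
    by (subst (asm) (1 2) Bochner_Integration.integral_cong[OF refl]) (auto simp: space_restrict_space)
qed

lemma primitive_continuous:
  "integrable (lebesgue_on {a..b}) g \<Longrightarrow> continuous_on {a..b} (primitive a g)"
  using indefinite_integral_continuous_real[of a b g] unfolding primitive_def .

text \<open>Exchanging the order of integration leaves g(\<theta>) times the integral of \<phi>'
  over [\<theta>, b], which is -\<phi>(\<theta>) because \<phi>(b) = 0. The constant c drops out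
  since \<phi>' has integral 0. Pointwise differentiability of the primitive never enters.\<close>

lemma weak_deriv_primitive:
  assumes g: "integrable (lebesgue_on {a..b}) g"
    and f: "AE s in lebesgue_on {a..b}. f s = c + primitive a g s"
    and [measurable]: "f \<in> borel_measurable (lebesgue_on {a..b})"
    and "a < b"
  shows "weak_deriv a b f g"
  unfolding weak_deriv_def
proof (intro allI impI)
  fix \<phi> \<phi>' assume t: "test_fun a b \<phi> \<phi>'"
  let ?M = "lebesgue_on {a..b}"
  note cont = test_fun_continuous[OF t]
  have [measurable]: "\<phi>' \<in> borel_measurable ?M" "primitive a g \<in> borel_measurable ?M"
    using cont primitive_continuous[OF g] by (auto intro: continuous_measurable_interval)
  have i1: "integrable ?M \<phi>'" by (intro integrable_continuous_interval cont)
  have i2: "integrable ?M (\<lambda>s. primitive a g s * \<phi>' s)"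
    using primitive_continuous[OF g] i1 by (rule integrable_continuous_mult)
  have "(LINT s|?M. f s * \<phi>' s) = (LINT s|?M. c * \<phi>' s + \<phi>' s * primitive a g s)"
    using f by (intro integral_cong_AE) (auto simp: algebra_simps)
  also have "\<dots> = c * (LINT s|?M. \<phi>' s) + (LINT s|?M. \<phi>' s * primitive a g s)"
    using i1 i2 by (simp add: mult.commute)
  also have "(LINT s|?M. \<phi>' s) = 0"
    using test_fun_integral[OF t] \<open>a < b\<close> test_fun_endpoints[OF t] by simp
  also have "(LINT s|?M. \<phi>' s * primitive a g s) =
      (LINT \<theta>|?M. g \<theta> * (LINT r|lebesgue_on {\<theta>..b}. \<phi>' r))"
    using i1 g by (rule Fubini_triangle)
  also have "\<dots> = (LINT \<theta>|?M. - (g \<theta> * \<phi> \<theta>))"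
    by (intro Bochner_Integration.integral_cong) (auto simp: test_fun_integral[OF t] test_fun_endpoints[OF t])
  finally show "(LINT s|?M. f s * \<phi>' s) = - (LINT s|?M. g s * \<phi> s)" by simp
qed

section \<open>The du Bois-Reymond lemma\<close>

lemma interval_averages_zero:
  fixes h :: "real \<Rightarrow> real"
  assumes h: "integrable (lebesgue_on {a..b}) h"
    and z: "\<And>c d. a < c \<Longrightarrow> c < d \<Longrightarrow> d < b \<Longrightarrow> (LINT s|lebesgue_on {c..d}. h s) = 0"
  shows "AE s in lebesgue_on {a..b}. h s = 0"
proof -
  define h0 where "h0 = (\<lambda>s. if s \<in> {a..b} then h s else 0)"
  have "h absolutely_integrable_on {a..b}"
    using h by (simp add: set_integrable_def integrable_restrict_space)
  hence "h0 absolutely_integrable_on UNIV"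
    unfolding h0_def absolutely_integrable_restrict_UNIV .
  hence "h0 absolutely_integrable_on cbox c d" for c d
    by (rule absolutely_integrable_on_subcbox) auto
  hence "h0 integrable_on cbox c d" for c d
    by (simp add: absolutely_integrable_on_def)
  \<comment> \<open>Lebesgue differentiation: outside a null set, \<open>h0\<close> is the limit of
    its averages over [x, x + k] as k decreases to 0. All short averages at an interior point vanish
    by assumption.\<close>
  then obtain N where N: "negligible N"
    and lim: "\<And>x e. \<lbrakk>x \<notin> N; 0 < e\<rbrakk> \<Longrightarrow> \<exists>d>0. \<forall>k. 0 < k \<and> k < d \<longrightarrow>
       norm (integral (cbox x (x + k *\<^sub>R One)) h0 /\<^sub>R k ^ DIM(real) - h0 x) < e"
    by (rule integrable_ccontinuous_explicit[where f=h0]) blast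
  have zero: "h s = 0" if s: "s \<notin> N \<union> {a, b}" "s \<in> {a..b}" for s
  proof (rule ccontr)
    assume "h s \<noteq> 0"
    hence "\<bar>h0 s\<bar> > 0" using s by (simp add: h0_def)
    from lim[OF _ this, of s] s obtain d where d: "d > 0"
      "\<And>k. 0 < k \<Longrightarrow> k < d \<Longrightarrow> \<bar>integral {s..s + k} h0 / k - h0 s\<bar> < \<bar>h0 s\<bar>"
      by (auto simp: divide_inverse mult.commute)
    \<comment> \<open>Halving both bounds keeps \<open>k\<close> below \<open>d\<close> and
      \<open>s + k\<close> strictly below \<open>b\<close>, where the assumption on averages
      applies.\<close>
    define k where "k = min (d / 2) ((b - s) / 2)"
    have k: "0 < k" "k < d" "a < s" "s + k < b" using s d by (auto simp: k_def min_def field_simps)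
    have "integral {s..s + k} h0 = integral {s..s + k} h"
      using k by (intro integral_cong) (auto simp: h0_def)
    also have "\<dots> = (LINT r|lebesgue_on {s..s + k}. h r)"
      using k integrable_subinterval[OF h, of s "s + k"] by (simp add: lebesgue_integral_eq_integral)
    also have "\<dots> = 0" using k by (intro z) auto
    finally show False using d(2)[of k] k by simp
  qed
  have "N \<union> {a, b} \<in> null_sets lebesgue"
    using N by (simp add: negligible_iff_null_sets[symmetric])
  thus ?thesis
    using zero by (auto simp: AE_restrict_space_iff intro: AE_I'[of "N \<union> {a, b}"])
qed

text \<open>A truncated parabola: for c \<le> d it is a continuous cut-off supported in [c, d] that
  tends to the indicator of the open interval as n grows. Continuity suffices because bumps are used
  only as derivatives of test functions.\<close>

definition bump :: "real \<Rightarrow> real \<Rightarrow> nat \<Rightarrow> real \<Rightarrow> real" where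
  "bump c d n x = max 0 (min 1 (real n * ((x - c) * (d - x))))"

lemma bump_continuous: "continuous_on S (bump c d n)"
  unfolding bump_def by (intro continuous_intros)

lemma bump_bounds: "0 \<le> bump c d n x" "bump c d n x \<le> 1"
  by (auto simp: bump_def)

lemma bump_outside:
  assumes "x \<notin> {c<..<d}" "c \<le> d"
  shows "bump c d n x = 0"
proof -
  have "(x - c) * (d - x) \<le> 0" using assms by (auto simp: mult_le_0_iff)
  hence "real n * ((x - c) * (d - x)) \<le> 0" by (simp add: mult_nonneg_nonpos)
  thus ?thesis by (simp add: bump_def)
qed

lemma bump_tendsto:
  assumes "c \<le> d"
  shows "(\<lambda>n. bump c d n x) \<longlonglongrightarrow> indicator {c<..<d} x"
proof (cases "x \<in> {c<..<d}")
  case True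
  define p where "p = (x - c) * (d - x)"
  have p: "p > 0" using True by (simp add: p_def)
  obtain m :: nat where m: "1 / p < real m" using reals_Archimedean2 by blast
  have "bump c d n x = 1" if "n \<ge> m" for n
  proof -
    have "1 / p < real n" using m that by linarith
    hence "1 \<le> real n * p" using p by (simp add: field_simps)
    thus ?thesis by (simp add: bump_def p_def)
  qed
  hence "\<forall>\<^sub>F n in sequentially. bump c d n x = 1" by (auto simp: eventually_sequentially)
  thus ?thesis using True by (simp add: tendsto_eventually)
qed (use assms in \<open>simp add: bump_outside\<close>)

lemma bump_integral_pos:
  assumes "c < d"
  shows "integral {c..d} (bump c d 1) > 0"
proof -
  have "integral (cbox c d) (bump c d 1) = 0 \<longleftrightarrow> (\<forall>x\<in>cbox c d. bump c d 1 x = 0)"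
    using assms by (intro integral_cbox_eq_0_iff bump_continuous) (auto simp: bump_bounds)
  moreover have "bump c d 1 ((c + d) / 2) > 0"
  proof -
    have "((c + d) / 2 - c) * (d - (c + d) / 2) > 0" using assms by (intro mult_pos_pos) (auto simp: field_simps)
    thus ?thesis unfolding bump_def by simp
  qed
  hence "\<not> (\<forall>x\<in>cbox c d. bump c d 1 x = 0)"
    using assms by (auto intro!: bexI[of _ "(c + d) / 2"])
  moreover have "integral (cbox c d) (bump c d 1) \<ge> 0"
    by (intro integral_nonneg integrable_continuous bump_continuous bump_bounds)
  ultimately show ?thesis by (simp add: less_le)
qed

text \<open>The antiderivative that vanishes at c is 0 to the left of the support, and to the right
  of it equals the total integral, which is 0 as well.\<close>

lemma test_fun_antiderivative:
  assumes cont: "continuous_on UNIV \<rho>" and ab: "a < c" "c \<le> d" "d < b"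
    and out: "\<And>x. x \<notin> {c..d} \<Longrightarrow> \<rho> x = 0" and zero: "integral {c..d} \<rho> = 0"
  shows "\<exists>\<phi>. test_fun a b \<phi> \<rho>"
proof -
  have "\<exists>F. \<forall>x::real. -\<infinity> < ereal x \<longrightarrow> ereal x < \<infinity> \<longrightarrow> (F has_vector_derivative \<rho> x) (at x)"
    using cont by (intro einterval_antiderivative) (auto simp: continuous_on_eq_continuous_at)
  then obtain F where F: "\<And>x. (F has_real_derivative \<rho> x) (at x)"
    by (auto simp: has_real_derivative_iff_has_vector_derivative)
  define \<phi> where "\<phi> x = F x - F c" for x
  have \<phi>: "(\<phi> has_real_derivative \<rho> x) (at x)" for x
    unfolding \<phi>_def using F[of x] by (auto intro!: derivative_eq_intros)
  have ftc: "F y - F x = integral {x..y} \<rho>" if "x \<le> y" for x y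
  proof -
    have "(\<rho> has_integral F y - F x) {x..y}"
      using that F by (intro fundamental_theorem_of_calculus)
        (auto simp: has_real_derivative_iff_has_vector_derivative[symmetric]
              intro: has_field_derivative_at_within)
    thus ?thesis by (simp add: integral_unique)
  qed
  \<comment> \<open>Disjointness is required of the open interval only: [x, c] and [d, x] meet the
    support in an endpoint, where \<rho> need not vanish, but one point does not change the
    integral.\<close>
  have endpoint: "integral {x..y} \<rho> = 0" if "{x<..<y} \<inter> {c..d} = {}" for x y
  proof -
    have "\<rho> z = 0" if "z \<in> {x<..<y}" for z using out[of z] that \<open>{x<..<y} \<inter> {c..d} = {}\<close> by blast
    hence "integral (box x y) \<rho> = 0" using integral_cong[of "{x<..<y}" \<rho> "\<lambda>_. 0"] by simp
    thus ?thesis by (simp add: integral_open_interval_real)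
  qed
  have "\<phi> x = 0" if "x \<notin> {c..d}" for x
  proof (cases "x < c")
    case True
    hence "{x<..<c} \<inter> {c..d} = {}" by auto
    thus ?thesis using True ftc[of x c] endpoint[of x c] by (simp add: \<phi>_def)
  next
    case False
    hence "d < x" using that by auto
    moreover have "{d<..<x} \<inter> {c..d} = {}" by auto
    ultimately show ?thesis using ftc[of d x] endpoint[of d x] ftc[of c d] zero ab by (simp add: \<phi>_def)
  qed
  hence "test_fun a b \<phi> \<rho>" using \<phi> cont ab unfolding test_fun_def by auto
  thus ?thesis by blast
qed

text \<open>A bump minus the multiple of a fixed bump \<psi> with the same integral is the
  derivative of a test function, hence orthogonal to h. For a suitable k this makes h - k orthogonal
  to every bump, and in the limit all interval averages of h - k vanish.\<close>

theorem du_Bois_Reymond: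
  assumes h: "integrable (lebesgue_on {a..b}) h" and "a < b"
    and z: "\<And>\<phi> \<phi>'. test_fun a b \<phi> \<phi>' \<Longrightarrow> (LINT s|lebesgue_on {a..b}. h s * \<phi>' s) = 0"
  shows "\<exists>k. AE s in lebesgue_on {a..b}. h s = k"
proof -
  let ?M = "lebesgue_on {a..b}"
  interpret finite_measure ?M by (rule finite_measure_interval)
  define p where "p = (2 * a + b) / 3"
  define q where "q = (a + 2 * b) / 3"
  have pq: "a < p" "p < q" "q < b" using \<open>a < b\<close> by (auto simp: p_def q_def)
  define \<psi> where "\<psi> = bump p q 1"
  have hb: "integrable ?M (\<lambda>s. h s * bump c d n s)" for c d n
    using integrable_continuous_mult[OF bump_continuous h] by (simp add: mult.commute)
  have bi: "integrable ?M (bump c d n)" for c d n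
    by (intro integrable_continuous_interval bump_continuous)
  \<comment> \<open>The integral of a bump is the same over every interval between its support and
    [a, b]; this lets two bumps with different supports be compared over a common interval.\<close>
  have int_eq: "integral {a..b} (bump c d n) = integral {c'..d'} (bump c d n)"
    if "a \<le> c'" "c' \<le> c" "c \<le> d" "d \<le> d'" "d' \<le> b" for c d c' d' n
  proof -
    have zero: "bump c d n x = 0" if "x \<notin> {c'..d'}" for x
      using that \<open>c' \<le> c\<close> \<open>c \<le> d\<close> \<open>d \<le> d'\<close> by (intro bump_outside) auto
    have "{x \<in> {a..b} - {c'..d'}. bump c d n x \<noteq> 0} = {}"
      using zero by blast
    moreover have "{c'..d'} - {a..b} = {}" using that by auto
    hence "{x \<in> {c'..d'} - {a..b}. bump c d n x \<noteq> 0} = {}" by blast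
    ultimately show ?thesis by (intro integral_spike_set) (simp_all only: negligible_empty)
  qed
  have "integral {a..b} \<psi> > 0"
    using bump_integral_pos[of p q] int_eq[of p p q q 1] pq by (simp add: \<psi>_def)
  \<comment> \<open>The only candidate: the mean of h with weight \<psi>, which makes h - k
    orthogonal to \<psi>.\<close>
  define k where "k = (LINT s|?M. h s * \<psi> s) / integral {a..b} \<psi>"
  have kb: "(LINT s|?M. (h s - k) * bump c d n s) = 0" if cd: "a < c" "c < d" "d < b" for c d n
  proof -
    \<comment> \<open>This factor gives \<open>r * \<psi>\<close> the integral of the bump, so that
      \<rho> has integral 0. The interval [c', d'] below is the hull of the two supports.\<close>
    define r where "r = integral {a..b} (bump c d n) / integral {a..b} \<psi>"
    define \<rho> where "\<rho> x = bump c d n x - r * \<psi> x" for x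
    define c' where "c' = min c p"
    define d' where "d' = max d q"
    have bnd: "a < c'" "c' \<le> c" "c' \<le> p" "d \<le> d'" "q \<le> d'" "d' < b" "c' \<le> d'"
      using cd pq by (auto simp: c'_def d'_def)
    have "integral {c'..d'} \<rho> = integral {c'..d'} (bump c d n) - r * integral {c'..d'} \<psi>"
      unfolding \<rho>_def \<psi>_def
      by (subst integral_diff) (auto intro!: integrable_continuous_real continuous_intros bump_continuous)
    also have "\<dots> = 0"
      using int_eq[of c' c d d' n] int_eq[of c' p q d' 1] bnd cd pq \<open>integral {a..b} \<psi> > 0\<close>
      by (simp add: r_def \<psi>_def)
    finally have "integral {c'..d'} \<rho> = 0" .
    moreover have "continuous_on UNIV \<rho>"
      unfolding \<rho>_def \<psi>_def by (intro continuous_intros bump_continuous)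
    moreover have "\<rho> x = 0" if "x \<notin> {c'..d'}" for x
      using that bnd cd pq by (auto simp: \<rho>_def \<psi>_def bump_outside)
    ultimately obtain \<phi> where "test_fun a b \<phi> \<rho>"
      using test_fun_antiderivative[of \<rho> a c' d' b] bnd by blast
    from z[OF this] have "(LINT s|?M. h s * bump c d n s - r * (h s * \<psi> s)) = 0"
      by (simp add: \<rho>_def algebra_simps)
    hence "(LINT s|?M. h s * bump c d n s) = r * (LINT s|?M. h s * \<psi> s)"
      using hb by (simp add: \<psi>_def)
    also have "\<dots> = k * integral {a..b} (bump c d n)" by (simp add: r_def k_def)
    also have "integral {a..b} (bump c d n) = (LINT s|?M. bump c d n s)"
      using bi by (simp add: lebesgue_integral_eq_integral)
    finally show ?thesis using hb bi by (simp add: left_diff_distrib)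
  qed
  have hk: "integrable ?M (\<lambda>s. h s - k)" using h by simp
  have "(LINT s|lebesgue_on {c..d}. h s - k) = 0" if cd: "a < c" "c < d" "d < b" for c d
  proof -
    have [measurable]: "bump c d n \<in> borel_measurable ?M" for n
      by (intro continuous_measurable_interval bump_continuous)
    \<comment> \<open>Dominated convergence passes from bumps to the indicator of the open interval,
      with |h - k| as the dominating function since bumps lie between 0 and 1.\<close>
    have "(\<lambda>n. LINT s|?M. (h s - k) * bump c d n s) \<longlonglongrightarrow> (LINT s|?M. (h s - k) * indicator {c<..<d} s)"
    proof (rule integral_dominated_convergence)
      show "integrable ?M (\<lambda>s. \<bar>h s - k\<bar>)" using hk by simp
      show "AE s in ?M. (\<lambda>n. (h s - k) * bump c d n s) \<longlonglongrightarrow> (h s - k) * indicator {c<..<d} s"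
        using cd by (intro AE_I2 tendsto_intros bump_tendsto) auto
      show "AE s in ?M. norm ((h s - k) * bump c d n s) \<le> \<bar>h s - k\<bar>" for n
        by (intro AE_I2) (simp add: abs_mult mult_left_le bump_bounds)
      show "(\<lambda>s. (h s - k) * indicator {c<..<d} s) \<in> borel_measurable ?M"
        using h by (auto intro!: borel_measurable_times indicator_measurable_lebesgue_on)
    qed (use h in measurable)
    hence "(LINT s|?M. (h s - k) * indicator {c<..<d} s) = 0"
      using LIMSEQ_unique[OF _ tendsto_const] by (simp add: kb[OF cd] LIMSEQ_const_iff)
    moreover have "(LINT s|?M. (h s - k) * indicator {c<..<d} s) = (LINT s|lebesgue_on {c<..<d}. h s - k)"
      using cd by (simp add: integral_restrict_space)
        (auto intro!: Bochner_Integration.integral_cong simp: indicator_def)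
    moreover have "(LINT s|lebesgue_on {c<..<d}. h s - k) = integral {c<..<d} (\<lambda>s. h s - k)"
    proof -
      have "(\<lambda>s. h s - k) absolutely_integrable_on {a..b}"
        using hk by (simp add: set_integrable_def integrable_restrict_space)
      hence "(\<lambda>s. h s - k) absolutely_integrable_on {c<..<d}"
        by (rule set_integrable_subset) (use cd in auto)
      hence "integrable (lebesgue_on {c<..<d}) (\<lambda>s. h s - k)"
        by (rule absolutely_integrable_imp_integrable) auto
      thus ?thesis by (rule lebesgue_integral_eq_integral) auto
    qed
    moreover have "(LINT s|lebesgue_on {c..d}. h s - k) = integral {c..d} (\<lambda>s. h s - k)"
      using integrable_subinterval[OF hk, of c d] cd by (simp add: lebesgue_integral_eq_integral)
    ultimately show ?thesis
      using integral_open_interval_real[of c d "\<lambda>s. h s - k"] by simp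
  qed
  from interval_averages_zero[OF hk this] show ?thesis by auto
qed

section \<open>Primitives and the uniqueness of weak derivatives\<close>

lemma integrable_mult_test_fun:
  assumes "test_fun a b \<phi> \<phi>'" "integrable (lebesgue_on {a..b}) g"
  shows "integrable (lebesgue_on {a..b}) (\<lambda>s. g s * \<phi> s)"
    "integrable (lebesgue_on {a..b}) (\<lambda>s. g s * \<phi>' s)"
  using integrable_continuous_mult[OF test_fun_continuous(1)[OF assms(1)] assms(2)]
    integrable_continuous_mult[OF test_fun_continuous(2)[OF assms(1)] assms(2)]
  by (simp_all add: mult.commute)

text \<open>|f - g| is continuous and nonnegative with integral 0 over a nondegenerate interval, so
  it vanishes identically. This makes the values at the endpoints well defined.\<close>

lemma continuous_AE_eq:
  fixes f g :: "real \<Rightarrow> real"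
  assumes cont: "continuous_on {a..b} f" "continuous_on {a..b} g" and "a < b"
    and ae: "AE s in lebesgue_on {a..b}. f s = g s" and s: "s \<in> {a..b}"
  shows "f s = g s"
proof -
  let ?h = "\<lambda>s. \<bar>f s - g s\<bar>"
  have c: "continuous_on {a..b} ?h" using cont by (intro continuous_intros)
  have "(LINT s|lebesgue_on {a..b}. ?h s) = 0"
    using ae by (intro integral_eq_zero_AE) auto
  hence "integral {a..b} ?h = 0"
    using integrable_continuous_interval[OF c] by (simp add: lebesgue_integral_eq_integral)
  thus ?thesis
    using integral_cbox_eq_0_iff[of a b ?h] c \<open>a < b\<close> s by auto
qed

lemma primitive_start [simp]: "primitive a g a = 0"
proof -
  have "AE s in lebesgue_on {a..a}. g s = 0"
    by (intro AE_I'[of "{a}"]) (auto simp: null_sets_restrict_space)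
  thus ?thesis unfolding primitive_def by (rule integral_eq_zero_AE)
qed

lemma integral_eq_primitive_diff:
  fixes g :: "real \<Rightarrow> real"
  assumes g: "integrable (lebesgue_on {a..b}) g" and "a \<le> c" "c \<le> d" "d \<le> b"
  shows "(LINT s|lebesgue_on {c..d}. g s) = primitive a g d - primitive a g c"
proof -
  have "integral {a..c} g + integral {c..d} g = integral {a..d} g"
    using assms integrable_on_lebesgue_on[OF integrable_subinterval[OF g, of a d]]
    by (intro Henstock_Kurzweil_Integration.integral_combine) auto
  thus ?thesis
    using assms integrable_subinterval[OF g] unfolding primitive_def
    by (simp add: lebesgue_integral_eq_integral)
qed

text \<open>Both sides are continuous, so they agree at every point. At s = a this compares the
  constants; differences of two values give equal integrals of g and g' over every
  subinterval.\<close>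

lemma primitive_eq_imp_AE_eq:
  assumes g: "integrable (lebesgue_on {a..b}) g" "integrable (lebesgue_on {a..b}) g'" and "a < b"
    and ae: "AE s in lebesgue_on {a..b}. c + primitive a g s = c' + primitive a g' s"
  shows "c = c'" "AE s in lebesgue_on {a..b}. g s = g' s"
proof -
  have eq: "c + primitive a g s = c' + primitive a g' s" if "s \<in> {a..b}" for s
    by (rule continuous_AE_eq[OF _ _ \<open>a < b\<close> ae that];
        intro continuous_intros primitive_continuous g)
  show "c = c'" using eq[of a] \<open>a < b\<close> by simp
  have "(LINT s|lebesgue_on {p..q}. g s - g' s) = 0" if "a < p" "p < q" "q < b" for p q
    using that eq[of p] eq[of q] integrable_subinterval[OF g(1), of p q]
      integrable_subinterval[OF g(2), of p q]
      integral_eq_primitive_diff[OF g(1), of p q] integral_eq_primitive_diff[OF g(2), of p q] by simp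
  from interval_averages_zero[OF _ this] g
  show "AE s in lebesgue_on {a..b}. g s = g' s" by auto
qed

text \<open>f and the primitive of g have the same weak derivative, so their difference is
  orthogonal to all derivatives of test functions and is constant by du Bois-Reymond.\<close>

theorem weak_deriv_imp_primitive:
  assumes f: "integrable (lebesgue_on {a..b}) f" and g: "integrable (lebesgue_on {a..b}) g"
    and wd: "weak_deriv a b f g" and "a < b"
  shows "\<exists>c. AE s in lebesgue_on {a..b}. f s = c + primitive a g s"
proof -
  let ?M = "lebesgue_on {a..b}"
  have c: "continuous_on {a..b} (primitive a g)" using g by (rule primitive_continuous)
  have i: "integrable ?M (\<lambda>s. f s - primitive a g s)"
    using f integrable_continuous_interval[OF c] by simp
  have wp: "weak_deriv a b (primitive a g) g"
    using c \<open>a < b\<close> by (intro weak_deriv_primitive[OF g, where c=0] continuous_measurable_interval) auto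
  have "(LINT s|?M. (f s - primitive a g s) * \<phi>' s) = 0" if t: "test_fun a b \<phi> \<phi>'" for \<phi> \<phi>'
  proof -
    have "integrable ?M (\<lambda>s. f s * \<phi>' s)" "integrable ?M (\<lambda>s. primitive a g s * \<phi>' s)"
      by (intro integrable_mult_test_fun[OF t] f integrable_continuous_interval[OF c])+
    moreover have "(LINT s|?M. f s * \<phi>' s) = - (LINT s|?M. g s * \<phi> s)"
      "(LINT s|?M. primitive a g s * \<phi>' s) = - (LINT s|?M. g s * \<phi> s)"
      using wd[unfolded weak_deriv_def, rule_format, OF t] wp[unfolded weak_deriv_def, rule_format, OF t] .
    ultimately show ?thesis
      by (simp only: left_diff_distrib Bochner_Integration.integral_diff diff_self)
  qed
  hence "\<exists>k. AE s in ?M. f s - primitive a g s = k"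
    by (intro du_Bois_Reymond[OF i \<open>a < b\<close>])
  then obtain k where "AE s in ?M. f s - primitive a g s = k" ..
  hence "AE s in ?M. f s = k + primitive a g s" by eventually_elim simp
  thus ?thesis ..
qed

text \<open>Cauchy's formula for repeated integration, that is, the triangle identity on [a, s] with
  u = 1. It accounts for the weights s - \<theta> in \<open>G1\<close> and b - \<theta> in
  \<open>Q_mat\<close>.\<close>

lemma primitive_primitive:
  assumes g: "integrable (lebesgue_on {a..b}) g" and s: "s \<in> {a..b}"
  shows "primitive a (primitive a g) s = (LINT \<theta>|lebesgue_on {a..s}. (s - \<theta>) * g \<theta>)"
proof -
  have g': "integrable (lebesgue_on {a..s}) g" using integrable_subinterval[OF g] s by simp
  have "integrable (lebesgue_on {a..s}) (\<lambda>_. 1::real)"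
    by (intro integrable_continuous_interval continuous_intros)
  from Fubini_triangle[OF this g']
  have "primitive a (primitive a g) s = (LINT \<theta>|lebesgue_on {a..s}. g \<theta> * (LINT r|lebesgue_on {\<theta>..s}. 1))"
    by (simp add: primitive_def)
  also have "\<dots> = (LINT \<theta>|lebesgue_on {a..s}. (s - \<theta>) * g \<theta>)"
    by (intro Bochner_Integration.integral_cong)
       (auto simp: measure_restrict_space lebesgue_integral_const)
  finally show ?thesis .
qed

section \<open>Square-integrable functions and estimates in the L2 norm\<close>

lemma sq_int_measurable [measurable_dest]:
  "f \<in> sq_int a b \<Longrightarrow> f \<in> borel_measurable (lebesgue_on {a..b})"
  by (simp add: sq_int_def)

lemma sq_int_square_integrable:
  "f \<in> sq_int a b \<Longrightarrow> integrable (lebesgue_on {a..b}) (\<lambda>s. (f s)\<^sup>2)"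
  by (simp add: sq_int_def)

lemma sq_int_integrable: "f \<in> sq_int a b \<Longrightarrow> integrable (lebesgue_on {a..b}) f"
  using finite_measure.square_integrable_imp_integrable[OF finite_measure_interval]
  unfolding sq_int_def by blast

lemma sq_int_continuous: "continuous_on {a..b} f \<Longrightarrow> f \<in> sq_int a b"
  unfolding sq_int_def
  by (auto intro!: continuous_measurable_interval integrable_continuous_interval continuous_intros)

lemma sq_int_cmult: "f \<in> sq_int a b \<Longrightarrow> (\<lambda>s. c * f s) \<in> sq_int a b"
  unfolding sq_int_def by (auto simp: power_mult_distrib)

lemma sum_square_le: "(x + y)\<^sup>2 \<le> 2 * x\<^sup>2 + 2 * (y::real)\<^sup>2"
  using zero_le_power2[of "x - y"] by (simp add: power2_eq_square algebra_simps)

lemma sq_int_add: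
  assumes "f \<in> sq_int a b" "g \<in> sq_int a b"
  shows "(\<lambda>s. f s + g s) \<in> sq_int a b"
proof -
  have "integrable (lebesgue_on {a..b}) (\<lambda>s. 2 * (f s)\<^sup>2 + 2 * (g s)\<^sup>2)"
    using assms by (simp add: sq_int_def)
  hence "integrable (lebesgue_on {a..b}) (\<lambda>s. (f s + g s)\<^sup>2)"
    by (rule Bochner_Integration.integrable_bound)
       (use assms in \<open>auto simp: sum_square_le sq_int_def\<close>)
  thus ?thesis using assms by (auto simp: sq_int_def)
qed

lemma sq_int_diff:
  "f \<in> sq_int a b \<Longrightarrow> g \<in> sq_int a b \<Longrightarrow> (\<lambda>s. f s - g s) \<in> sq_int a b"
  using sq_int_add[OF _ sq_int_cmult[of g a b "-1"], of f] by simp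

lemma l2_nonneg [simp]: "0 \<le> l2 a b f"
  by (simp add: l2_def)

lemma l2_square: "(l2 a b f)\<^sup>2 = (LINT s|lebesgue_on {a..b}. (f s)\<^sup>2)"
  by (simp add: l2_def)

lemma l2_cong_AE:
  assumes "f \<in> borel_measurable (lebesgue_on {a..b})" "g \<in> borel_measurable (lebesgue_on {a..b})"
    "AE s in lebesgue_on {a..b}. f s = g s"
  shows "l2 a b f = l2 a b g"
  unfolding l2_def using assms by (auto intro!: arg_cong[where f=sqrt] integral_cong_AE)

lemma l2_cmult: "l2 a b (\<lambda>s. c * f s) = \<bar>c\<bar> * l2 a b f"
  by (simp add: l2_def power_mult_distrib real_sqrt_mult)

text \<open>The factor 2 comes from (x + y)^2 \<le> 2 x^2 + 2 y^2. Limits and boundedness are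
  unaffected by it, so Minkowski's inequality is not invoked.\<close>

lemma l2_add_le:
  assumes "f \<in> sq_int a b" "g \<in> sq_int a b"
  shows "l2 a b (\<lambda>s. f s + g s) \<le> 2 * (l2 a b f + l2 a b g)"
proof -
  have "(l2 a b (\<lambda>s. f s + g s))\<^sup>2 \<le> (LINT s|lebesgue_on {a..b}. 2 * (f s)\<^sup>2 + 2 * (g s)\<^sup>2)"
    unfolding l2_square using assms sq_int_square_integrable[OF sq_int_add[OF assms]]
    by (intro integral_mono) (auto simp: sum_square_le sq_int_def)
  also have "\<dots> = 2 * (l2 a b f)\<^sup>2 + 2 * (l2 a b g)\<^sup>2"
    using assms by (simp add: l2_square sq_int_def)
  also have "\<dots> \<le> (2 * (l2 a b f + l2 a b g))\<^sup>2"
    by (simp add: power2_eq_square algebra_simps)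
  finally show ?thesis by (rule power2_le_imp_le) simp
qed

lemma l2_diff_le:
  assumes "f \<in> sq_int a b" "g \<in> sq_int a b"
  shows "l2 a b (\<lambda>s. f s - g s) \<le> 2 * (l2 a b f + l2 a b g)"
  using l2_add_le[OF assms(1) sq_int_cmult[OF assms(2), of "-1"]] l2_cmult[of a b "-1" g] by simp

lemma l2_eq_0_AE:
  assumes "f \<in> sq_int a b" "l2 a b f = 0"
  shows "AE s in lebesgue_on {a..b}. f s = 0"
  using assms integral_nonneg_eq_0_iff_AE[of "lebesgue_on {a..b}" "\<lambda>s. (f s)\<^sup>2"]
  by (simp add: l2_def sq_int_def)

text \<open>Cauchy-Schwarz against the constant 1. It follows by expanding the nonnegative integral
  of (|f| - m)^2, where m is the mean of |f| over [a, b].\<close>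

lemma L1_le_l2:
  assumes f: "f \<in> sq_int a b" and "a < b"
  shows "(LINT s|lebesgue_on {a..b}. \<bar>f s\<bar>) \<le> sqrt (b - a) * l2 a b f"
proof -
  let ?M = "lebesgue_on {a..b}"
  interpret finite_measure ?M by (rule finite_measure_interval)
  define I where "I = (LINT s|?M. \<bar>f s\<bar>)"
  define m where "m = I / (b - a)"
  have i: "integrable ?M (\<lambda>s. \<bar>f s\<bar>)" "integrable ?M (\<lambda>s. (f s)\<^sup>2)"
    using sq_int_integrable[OF f] sq_int_square_integrable[OF f] by simp_all
  have "0 \<le> (LINT s|?M. (\<bar>f s\<bar> - m)\<^sup>2)" by simp
  also have "\<dots> = (LINT s|?M. (f s)\<^sup>2 - 2 * m * \<bar>f s\<bar> + m\<^sup>2)"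
    by (simp add: power2_diff algebra_simps)
  also have "\<dots> = (l2 a b f)\<^sup>2 - 2 * m * I + m\<^sup>2 * (b - a)"
    using i \<open>a < b\<close> by (simp add: l2_square I_def measure_restrict_space lebesgue_integral_const)
  finally have "0 \<le> (l2 a b f)\<^sup>2 - 2 * m * I + m * (m * (b - a))"
    by (simp add: power2_eq_square mult.assoc)
  moreover have m: "m * (b - a) = I" using \<open>a < b\<close> by (simp add: m_def)
  ultimately have "m * I \<le> (l2 a b f)\<^sup>2" by (simp add: mult.commute)
  hence "(b - a) * (m * I) \<le> (b - a) * (l2 a b f)\<^sup>2"
    using \<open>a < b\<close> by (intro mult_left_mono) auto
  moreover have "(b - a) * (m * I) = I\<^sup>2" using m by (simp add: power2_eq_square mult.commute mult.left_commute)
  ultimately have "I\<^sup>2 \<le> (b - a) * (l2 a b f)\<^sup>2" by simp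
  also have "\<dots> = (sqrt (b - a) * l2 a b f)\<^sup>2"
    using \<open>a < b\<close> by (simp add: power_mult_distrib)
  finally show ?thesis unfolding I_def
    by (rule power2_le_imp_le) (use \<open>a < b\<close> in simp)
qed

lemma integral_mult_le_l2:
  assumes f: "f \<in> sq_int a b" and "a < b"
    and h: "h \<in> borel_measurable (lebesgue_on {a..b})" "\<And>s. s \<in> {a..b} \<Longrightarrow> \<bar>h s\<bar> \<le> D"
  shows "\<bar>LINT s|lebesgue_on {a..b}. h s * f s\<bar> \<le> D * (sqrt (b - a) * l2 a b f)"
proof -
  let ?M = "lebesgue_on {a..b}"
  have "D \<ge> 0" using h(2)[of a] \<open>a < b\<close> by fastforce
  have i: "integrable ?M (\<lambda>s. h s * f s)"
    using integrable_bounded_mult[OF h(1) sq_int_integrable[OF f] h(2)] .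
  have "\<bar>LINT s|?M. h s * f s\<bar> \<le> (LINT s|?M. \<bar>h s * f s\<bar>)" by (rule integral_abs_bound)
  also have "\<dots> \<le> (LINT s|?M. D * \<bar>f s\<bar>)"
    using integrable_abs[OF i] sq_int_integrable[OF f] h(2)
    by (intro integral_mono) (auto simp: abs_mult intro: mult_right_mono)
  also have "\<dots> \<le> D * (sqrt (b - a) * l2 a b f)"
    using L1_le_l2[OF f \<open>a < b\<close>] \<open>D \<ge> 0\<close> by (simp add: mult_left_mono)
  finally show ?thesis .
qed

lemma primitive_le_l2:
  assumes f: "f \<in> sq_int a b" and "a < b" and s: "s \<in> {a..b}"
  shows "\<bar>primitive a f s\<bar> \<le> sqrt (b - a) * l2 a b f"
proof -
  \<comment> \<open>Writing the primitive as an integral over all of [a, b] against an indicator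
    gives a bound uniform in s.\<close>
  have "(indicator {..s} :: real \<Rightarrow> real) \<in> borel_measurable (lebesgue_on {a..b})"
    by (intro indicator_measurable_lebesgue_on) auto
  from integral_mult_le_l2[OF f \<open>a < b\<close> this, of 1]
  show ?thesis unfolding primitive_def integral_lower_interval[OF s] by (simp add: indicator_def)
qed

lemma l2_bounded:
  assumes f: "f \<in> borel_measurable (lebesgue_on {a..b})" and "a < b"
    and D: "\<And>s. s \<in> {a..b} \<Longrightarrow> \<bar>f s\<bar> \<le> D"
  shows "l2 a b f \<le> D * sqrt (b - a)"
proof -
  let ?M = "lebesgue_on {a..b}"
  interpret finite_measure ?M by (rule finite_measure_interval)
  have "D \<ge> 0" using D[of a] \<open>a < b\<close> by fastforce
  have sq: "(f s)\<^sup>2 \<le> D\<^sup>2" if "s \<in> {a..b}" for s using power_mono[OF D[OF that], of 2] by simp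
  have "(l2 a b f)\<^sup>2 \<le> (LINT s|?M. D\<^sup>2)"
    unfolding l2_square
  proof (intro integral_mono)
    show "integrable ?M (\<lambda>s. (f s)\<^sup>2)"
      by (rule Bochner_Integration.integrable_bound[of ?M "\<lambda>_. D\<^sup>2"]) (use f sq in \<open>auto intro!: AE_I2\<close>)
  qed (use sq in auto)
  also have "\<dots> = (D * sqrt (b - a))\<^sup>2"
    using \<open>a < b\<close> by (simp add: measure_restrict_space lebesgue_integral_const power_mult_distrib)
  finally show ?thesis by (rule power2_le_imp_le) (use \<open>D \<ge> 0\<close> \<open>a < b\<close> in simp)
qed

section \<open>Congruence, uniqueness and linearity of scalar weak derivatives\<close>

lemma weak_deriv_cong_AE:
  assumes "weak_deriv a b f g" "AE s in lebesgue_on {a..b}. f s = f' s"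
    "AE s in lebesgue_on {a..b}. g s = g' s"
    and [measurable]: "f \<in> borel_measurable (lebesgue_on {a..b})" "f' \<in> borel_measurable (lebesgue_on {a..b})"
     "g \<in> borel_measurable (lebesgue_on {a..b})" "g' \<in> borel_measurable (lebesgue_on {a..b})"
  shows "weak_deriv a b f' g'"
  unfolding weak_deriv_def
proof (intro allI impI)
  fix \<phi> \<phi>' assume t: "test_fun a b \<phi> \<phi>'"
  have [measurable]: "\<phi> \<in> borel_measurable (lebesgue_on {a..b})" "\<phi>' \<in> borel_measurable (lebesgue_on {a..b})"
    using test_fun_continuous[OF t] by (auto intro: continuous_measurable_interval)
  have "(LINT s|lebesgue_on {a..b}. f' s * \<phi>' s) = (LINT s|lebesgue_on {a..b}. f s * \<phi>' s)"
    "(LINT s|lebesgue_on {a..b}. g' s * \<phi> s) = (LINT s|lebesgue_on {a..b}. g s * \<phi> s)"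
    using assms(2,3) by (auto intro!: integral_cong_AE)
  thus "(LINT s|lebesgue_on {a..b}. f' s * \<phi>' s) = - (LINT s|lebesgue_on {a..b}. g' s * \<phi> s)"
    using assms(1) t by (simp add: weak_deriv_def)
qed

lemma weak_deriv_unique:
  assumes "f \<in> sq_int a b" "g \<in> sq_int a b" "g' \<in> sq_int a b" "weak_deriv a b f g" "weak_deriv a b f g'" "a < b"
  shows "AE s in lebesgue_on {a..b}. g s = g' s"
proof -
  note i = assms(1-3)[THEN sq_int_integrable]
  obtain c where c: "AE s in lebesgue_on {a..b}. f s = c + primitive a g s"
    using weak_deriv_imp_primitive[OF i(1,2) assms(4,6)] ..
  obtain c' where "AE s in lebesgue_on {a..b}. f s = c' + primitive a g' s"
    using weak_deriv_imp_primitive[OF i(1,3) assms(5,6)] ..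
  with c have "AE s in lebesgue_on {a..b}. c + primitive a g s = c' + primitive a g' s"
    by eventually_elim simp
  from primitive_eq_imp_AE_eq(2)[OF i(2,3) \<open>a < b\<close> this] show ?thesis .
qed

lemma weak_deriv_lincomb:
  assumes "f \<in> sq_int a b" "g \<in> sq_int a b" "f' \<in> sq_int a b" "g' \<in> sq_int a b"
    and "weak_deriv a b f g" "weak_deriv a b f' g'"
  shows "weak_deriv a b (\<lambda>s. p * f s + q * f' s) (\<lambda>s. p * g s + q * g' s)"
  unfolding weak_deriv_def
proof (intro allI impI)
  fix \<phi> \<phi>' assume t: "test_fun a b \<phi> \<phi>'"
  note i = assms(1-4)[THEN sq_int_integrable]
  note im = integrable_mult_test_fun[OF t]
  have "(LINT s|lebesgue_on {a..b}. (p * f s + q * f' s) * \<phi>' s) =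
      p * (LINT s|lebesgue_on {a..b}. f s * \<phi>' s) + q * (LINT s|lebesgue_on {a..b}. f' s * \<phi>' s)"
    using im(2)[OF i(1)] im(2)[OF i(3)] by (simp add: distrib_right mult.assoc)
  moreover have "(LINT s|lebesgue_on {a..b}. (p * g s + q * g' s) * \<phi> s) =
      p * (LINT s|lebesgue_on {a..b}. g s * \<phi> s) + q * (LINT s|lebesgue_on {a..b}. g' s * \<phi> s)"
    using im(1)[OF i(2)] im(1)[OF i(4)] by (simp add: distrib_right mult.assoc)
  moreover have "(LINT s|lebesgue_on {a..b}. f s * \<phi>' s) = - (LINT s|lebesgue_on {a..b}. g s * \<phi> s)"
    "(LINT s|lebesgue_on {a..b}. f' s * \<phi>' s) = - (LINT s|lebesgue_on {a..b}. g' s * \<phi> s)"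
    using assms(5,6)[unfolded weak_deriv_def, rule_format, OF t] .
  ultimately show "(LINT s|lebesgue_on {a..b}. (p * f s + q * f' s) * \<phi>' s) =
     - (LINT s|lebesgue_on {a..b}. (p * g s + q * g' s) * \<phi> s)"
    by simp
qed

section \<open>Sobolev spaces of vector-valued functions\<close>

lemma is_weak_deriv_iff:
  "is_weak_deriv a b m f g \<longleftrightarrow> (\<forall>i<m. weak_deriv a b (\<lambda>s. f s $ i) (\<lambda>s. g s $ i))"
  unfolding is_weak_deriv_def weak_deriv_def by blast

lemma sq_int_cong:
  assumes "f \<in> sq_int a b" "\<And>s. s \<in> {a..b} \<Longrightarrow> f s = g s"
  shows "g \<in> sq_int a b"
proof -
  have "g \<in> borel_measurable (lebesgue_on {a..b}) \<longleftrightarrow> f \<in> borel_measurable (lebesgue_on {a..b})"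
    using assms(2) by (intro measurable_cong) simp
  moreover have "integrable (lebesgue_on {a..b}) (\<lambda>s. (g s)\<^sup>2) \<longleftrightarrow> integrable (lebesgue_on {a..b}) (\<lambda>s. (f s)\<^sup>2)"
    using assms(2) by (intro Bochner_Integration.integrable_cong) simp_all
  ultimately show ?thesis using assms(1) by (simp add: sq_int_def)
qed

section \<open>Vector-valued L2 functions and equality almost everywhere\<close>

lemma L2_iff:
  "f \<in> L2 a b m \<longleftrightarrow> (\<forall>s\<in>{a..b}. f s \<in> carrier_vec m) \<and> (\<forall>i<m. (\<lambda>s. f s $ i) \<in> sq_int a b)"
  unfolding L2_def sq_int_def by auto

lemma L2_D:
  assumes "f \<in> L2 a b m"
  shows "s \<in> {a..b} \<Longrightarrow> f s \<in> carrier_vec m" "s \<in> {a..b} \<Longrightarrow> dim_vec (f s) = m"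
    "i < m \<Longrightarrow> (\<lambda>s. f s $ i) \<in> sq_int a b"
  using assms by (auto simp: L2_iff)

lemma L2_vecI:
  assumes "\<And>i. i < m \<Longrightarrow> (\<lambda>s. f s i) \<in> sq_int a b"
  shows "(\<lambda>s. vec m (f s)) \<in> L2 a b m"
  using assms by (simp add: L2_iff)

lemma L2_appendI:
  assumes "f \<in> L2 a b m" "g \<in> L2 a b k"
  shows "(\<lambda>s. f s @\<^sub>v g s) \<in> L2 a b (m + k)"
  unfolding L2_iff
proof (intro conjI ballI allI impI)
  fix i assume i: "i < m + k"
  show "(\<lambda>s. (f s @\<^sub>v g s) $ i) \<in> sq_int a b"
  proof -
    let ?h = "\<lambda>s. if i < m then f s $ i else g s $ (i - m)"
    have "?h \<in> sq_int a b"
      using L2_D(3)[OF assms(1), of i] L2_D(3)[OF assms(2), of "i - m"] i by (cases "i < m") auto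
    moreover have "(f s @\<^sub>v g s) $ i = ?h s" if "s \<in> {a..b}" for s
      using L2_D(2)[OF assms(1) that] L2_D(2)[OF assms(2) that] i by simp
    ultimately show ?thesis by (auto intro: sq_int_cong)
  qed
qed (intro append_carrier_vec L2_D(1)[OF assms(1)] L2_D(1)[OF assms(2)])

lemma eq_ae_refl [simp]: "eq_ae a b f f"
  by (simp add: eq_ae_def)

lemma eq_ae_sym: "eq_ae a b f g \<Longrightarrow> eq_ae a b g f"
  by (simp add: eq_ae_def eq_commute)

lemma eq_ae_trans [trans]:
  assumes "eq_ae a b f g" "eq_ae a b g h"
  shows "eq_ae a b f h"
  using assms unfolding eq_ae_def by eventually_elim simp

lemma eq_aeI: "(\<And>s. s \<in> {a..b} \<Longrightarrow> f s = g s) \<Longrightarrow> eq_ae a b f g"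
  unfolding eq_ae_def by (rule AE_I2) simp

lemma eq_ae_component:
  assumes "eq_ae a b f g"
  shows "AE s in lebesgue_on {a..b}. f s $ i = g s $ i"
  using assms unfolding eq_ae_def by eventually_elim simp

lemma eq_ae_componentsI:
  assumes dim: "\<And>s. s \<in> {a..b} \<Longrightarrow> dim_vec (f s) = m" "\<And>s. s \<in> {a..b} \<Longrightarrow> dim_vec (g s) = m"
    and "\<And>i. i < m \<Longrightarrow> AE s in lebesgue_on {a..b}. f s $ i = g s $ i"
  shows "eq_ae a b f g"
proof -
  \<comment> \<open>The exceptional null sets, one for each of finitely many components, are merged
    into one.\<close>
  have "AE s in lebesgue_on {a..b}. \<forall>i\<in>{..<m}. f s $ i = g s $ i"
    using assms(3) by (intro eventually_ball_finite) auto
  moreover have "AE s in lebesgue_on {a..b}. s \<in> {a..b}" by (rule AE_I2) simp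
  ultimately show ?thesis unfolding eq_ae_def
    by eventually_elim (use dim in \<open>auto intro!: eq_vecI\<close>)
qed

text \<open>The Euclidean norm of the component norms. Through it every estimate of a vector-valued
  function reduces to scalar estimates.\<close>

lemma L2_norm_eq:
  assumes f: "f \<in> L2 a b m"
  shows "L2_norm a b f = L2_set (\<lambda>i. l2 a b (\<lambda>s. f s $ i)) {..<m}"
proof -
  have "(LINT s|lebesgue_on {a..b}. f s \<bullet> f s) = (LINT s|lebesgue_on {a..b}. (\<Sum>i<m. (f s $ i)\<^sup>2))"
    by (intro Bochner_Integration.integral_cong)
      (auto simp: scalar_prod_def power2_eq_square lessThan_atLeast0 L2_D(2)[OF f])
  also have "\<dots> = (\<Sum>i<m. (l2 a b (\<lambda>s. f s $ i))\<^sup>2)"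
    using L2_D(3)[OF f] by (simp add: l2_square sq_int_def)
  finally show ?thesis unfolding L2_norm_def L2_set_def by simp
qed

lemma L2_norm_nonneg [simp]: "f \<in> L2 a b m \<Longrightarrow> 0 \<le> L2_norm a b f"
  by (simp add: L2_norm_eq L2_set_nonneg)

lemma component_le_L2_norm:
  "f \<in> L2 a b m \<Longrightarrow> i < m \<Longrightarrow> l2 a b (\<lambda>s. f s $ i) \<le> L2_norm a b f"
  unfolding L2_norm_eq by (rule member_le_L2_set) auto

lemma L2_norm_le_sum:
  "f \<in> L2 a b m \<Longrightarrow> L2_norm a b f \<le> (\<Sum>i<m. l2 a b (\<lambda>s. f s $ i))"
  unfolding L2_norm_eq by (rule L2_set_le_sum) auto

lemma L2_norm_bound:
  assumes "f \<in> L2 a b m" "\<And>i. i < m \<Longrightarrow> l2 a b (\<lambda>s. f s $ i) \<le> D"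
  shows "L2_norm a b f \<le> real m * D"
  using L2_norm_le_sum[OF assms(1)] sum_bounded_above[of "{..<m}" "\<lambda>i. l2 a b (\<lambda>s. f s $ i)" D] assms(2)
  by simp

lemma L2_norm_cong:
  assumes "f \<in> L2 a b m" "g \<in> L2 a b m" "eq_ae a b f g"
  shows "L2_norm a b f = L2_norm a b g"
  unfolding L2_norm_eq[OF assms(1)] L2_norm_eq[OF assms(2)]
  using assms by (intro L2_set_cong l2_cong_AE eq_ae_component)
    (auto dest: L2_D(3) intro: sq_int_measurable)

section \<open>Chosen weak derivatives, Sobolev norms and boundary values\<close>

lemma sobolev_subset_L2: "sobolev a b k m \<subseteq> L2 a b m"
  by (cases k) auto

lemma wderiv_spec:
  assumes "g \<in> L2 a b m" "is_weak_deriv a b m f g"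
  shows "wderiv a b m f \<in> L2 a b m" "is_weak_deriv a b m f (wderiv a b m f)"
  unfolding wderiv_def using someI_ex[of "\<lambda>g. g \<in> L2 a b m \<and> is_weak_deriv a b m f g"] assms by blast+

lemma sobolev_Suc_wderiv:
  assumes "f \<in> sobolev a b (Suc k) m"
  shows "wderiv a b m f \<in> L2 a b m" "is_weak_deriv a b m f (wderiv a b m f)"
  using assms sobolev_subset_L2[of a b k m] by (auto intro: wderiv_spec)

lemma is_weak_deriv_unique:
  assumes "f \<in> L2 a b m" "g \<in> L2 a b m" "g' \<in> L2 a b m" "is_weak_deriv a b m f g"
    "is_weak_deriv a b m f g'" "a < b"
  shows "eq_ae a b g g'"
proof (rule eq_ae_componentsI)
  fix i assume "i < m"
  thus "AE s in lebesgue_on {a..b}. g s $ i = g' s $ i"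
    using weak_deriv_unique[OF assms(1-3)[THEN L2_D(3)]] assms(4-6) by (simp add: is_weak_deriv_iff)
qed (use assms(2,3) in \<open>auto dest: L2_D(2)\<close>)

lemma is_weak_deriv_cong:
  assumes "f \<in> L2 a b m" "f' \<in> L2 a b m" "g \<in> L2 a b m" "g' \<in> L2 a b m"
    "eq_ae a b f f'" "eq_ae a b g g'" "is_weak_deriv a b m f g"
  shows "is_weak_deriv a b m f' g'"
  unfolding is_weak_deriv_iff
proof (intro allI impI)
  fix i assume "i < m"
  moreover from this have "weak_deriv a b (\<lambda>s. f s $ i) (\<lambda>s. g s $ i)"
    using assms(7) by (simp add: is_weak_deriv_iff)
  ultimately show "weak_deriv a b (\<lambda>s. f' s $ i) (\<lambda>s. g' s $ i)"
    using weak_deriv_cong_AE[OF _ assms(5,6)[THEN eq_ae_component]]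
      assms(1-4)[THEN L2_D(3), THEN sq_int_measurable] by blast
qed

lemma wderiv_eq:
  assumes "f \<in> L2 a b m" "g \<in> L2 a b m" "is_weak_deriv a b m f g" "a < b"
  shows "wderiv a b m f \<in> L2 a b m" "eq_ae a b (wderiv a b m f) g"
  using wderiv_spec(1)[OF assms(2,3)]
    is_weak_deriv_unique[OF assms(1) wderiv_spec(1)[OF assms(2,3)] assms(2) wderiv_spec(2)[OF assms(2,3)] assms(3,4)] .

text \<open>This is equality of functions, not only almost everywhere: f and f' admit exactly the
  same L2 weak derivatives, so the choice operator is applied to one and the same predicate.\<close>

lemma wderiv_cong:
  assumes "f \<in> L2 a b m" "f' \<in> L2 a b m" "eq_ae a b f f'"
  shows "wderiv a b m f = wderiv a b m f'"
proof -
  have "is_weak_deriv a b m f g \<longleftrightarrow> is_weak_deriv a b m f' g" if "g \<in> L2 a b m" for g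
    using is_weak_deriv_cong[OF assms(1,2) that that assms(3) eq_ae_refl]
      is_weak_deriv_cong[OF assms(2,1) that that eq_ae_sym[OF assms(3)] eq_ae_refl] by (rule iffI)
  hence "(\<lambda>g. g \<in> L2 a b m \<and> is_weak_deriv a b m f g) = (\<lambda>g. g \<in> L2 a b m \<and> is_weak_deriv a b m f' g)"
    by (intro ext conj_cong refl)
  thus ?thesis unfolding wderiv_def by (rule arg_cong)
qed

lemma sobolev_1I:
  "f \<in> L2 a b m \<Longrightarrow> g \<in> L2 a b m \<Longrightarrow> is_weak_deriv a b m f g \<Longrightarrow> f \<in> sobolev a b 1 m"
  by auto

lemma sobolev_1D:
  assumes "f \<in> sobolev a b 1 m"
  shows "f \<in> L2 a b m" "wderiv a b m f \<in> L2 a b m" "is_weak_deriv a b m f (wderiv a b m f)"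
  using assms sobolev_Suc_wderiv[of f a b 0 m] by auto

lemma sobolev_2I:
  assumes "f \<in> L2 a b m" "g \<in> L2 a b m" "h \<in> L2 a b m" "is_weak_deriv a b m f g" "is_weak_deriv a b m g h"
  shows "f \<in> sobolev a b 2 m"
  using assms by (auto simp: numeral_2_eq_2)

text \<open>The chosen derivative of f agrees with g only almost everywhere, so it must first be
  checked that h is a weak derivative of that representative too.\<close>

lemma wderiv_wderiv_eq:
  assumes "f \<in> L2 a b m" "g \<in> L2 a b m" "h \<in> L2 a b m" "is_weak_deriv a b m f g" "is_weak_deriv a b m g h" "a < b"
  shows "wderiv a b m (wderiv a b m f) \<in> L2 a b m" "eq_ae a b (wderiv a b m (wderiv a b m f)) h"
    "is_weak_deriv a b m (wderiv a b m f) (wderiv a b m (wderiv a b m f))"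
proof -
  note w = wderiv_eq[OF assms(1,2,4,6)]
  have wd: "is_weak_deriv a b m (wderiv a b m f) h"
    using is_weak_deriv_cong[OF assms(2) w(1) assms(3) assms(3) eq_ae_sym[OF w(2)] _ assms(5)] by simp
  show "wderiv a b m (wderiv a b m f) \<in> L2 a b m" "eq_ae a b (wderiv a b m (wderiv a b m f)) h"
    using wderiv_eq[OF w(1) assms(3) wd \<open>a < b\<close>] .
  show "is_weak_deriv a b m (wderiv a b m f) (wderiv a b m (wderiv a b m f))"
    using wderiv_spec(2)[OF assms(3) wd] .
qed

lemma sobolev_2D:
  assumes "f \<in> sobolev a b 2 m" "a < b"
  shows "f \<in> L2 a b m" "wderiv a b m f \<in> L2 a b m" "wderiv a b m (wderiv a b m f) \<in> L2 a b m"
    "is_weak_deriv a b m f (wderiv a b m f)"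
    "is_weak_deriv a b m (wderiv a b m f) (wderiv a b m (wderiv a b m f))"
proof -
  obtain g h where gh: "f \<in> L2 a b m" "g \<in> L2 a b m" "is_weak_deriv a b m f g" "h \<in> L2 a b m" "is_weak_deriv a b m g h"
    using assms(1) by (auto simp: numeral_2_eq_2)
  show "f \<in> L2 a b m" by fact
  show "wderiv a b m f \<in> L2 a b m" "is_weak_deriv a b m f (wderiv a b m f)"
    using wderiv_spec[OF gh(2,3)] .
  show "wderiv a b m (wderiv a b m f) \<in> L2 a b m"
    "is_weak_deriv a b m (wderiv a b m f) (wderiv a b m (wderiv a b m f))"
    using wderiv_wderiv_eq[OF gh(1,2,4,3,5) \<open>a < b\<close>] by blast+
qed

text \<open>Two continuous representatives coincide on the whole interval, so the definite
  description is satisfied by the value of any of them.\<close>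

lemma point_val_eq:
  assumes "\<And>i. i < m \<Longrightarrow> continuous_on {a..b} (G i)"
    "\<And>i. i < m \<Longrightarrow> AE s in lebesgue_on {a..b}. f s $ i = G i s" "a < b" "p \<in> {a..b}"
  shows "point_val a b m f p = vec m (\<lambda>i. G i p)"
proof -
  have "(THE v. \<exists>g. continuous_on {a..b} g \<and> (AE s in lebesgue_on {a..b}. f s $ i = g s) \<and> v = g p) = G i p"
    if i: "i < m" for i
  proof (rule the_equality)
    show "\<exists>g. continuous_on {a..b} g \<and> (AE s in lebesgue_on {a..b}. f s $ i = g s) \<and> G i p = g p"
      using assms(1,2)[OF i] by blast
    fix v assume "\<exists>g. continuous_on {a..b} g \<and> (AE s in lebesgue_on {a..b}. f s $ i = g s) \<and> v = g p"
    then obtain g where g: "continuous_on {a..b} g" "AE s in lebesgue_on {a..b}. f s $ i = g s" "v = g p"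
      by (elim exE conjE)
    have "AE s in lebesgue_on {a..b}. g s = G i s"
      using g(2) assms(2)[OF i] by eventually_elim simp
    from continuous_AE_eq[OF g(1) assms(1)[OF i] \<open>a < b\<close> this assms(4)] g(3) show "v = G i p" by simp
  qed
  thus ?thesis unfolding point_val_def by (intro eq_vecI) auto
qed

lemma sobolev_norm_cong:
  assumes "f \<in> L2 a b m" "f' \<in> L2 a b m" "eq_ae a b f f'"
  shows "sobolev_norm a b k m f = sobolev_norm a b k m f'"
proof -
  have "L2_norm a b ((wderiv a b m ^^ i) f) = L2_norm a b ((wderiv a b m ^^ i) f')" for i
  proof (cases i)
    case 0 thus ?thesis using L2_norm_cong[OF assms] by simp
  next
    \<comment> \<open>The iterate is unfolded at its innermost derivative, where
      \<open>wderiv_cong\<close> turns almost everywhere equality into identity; the outer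
      derivatives then act on the same function.\<close>
    case (Suc j) thus ?thesis using wderiv_cong[OF assms] by (simp only: funpow_Suc_right comp_apply)
  qed
  thus ?thesis by (simp add: sobolev_norm_def)
qed

section \<open>Block matrices and vector-valued integrals\<close>

lemma dim_append_rows [simp]:
  "dim_row (A @\<^sub>r B) = dim_row A + dim_row B" "dim_col (A @\<^sub>r B) = dim_col A"
  by (simp_all add: append_rows_def)

lemma dim_append_cols [simp]:
  "dim_row (A @\<^sub>c B) = dim_row A" "dim_col (A @\<^sub>c B) = dim_col A + dim_col B"
  by (simp_all add: append_cols_def)

lemma append_rows_mult_vec:
  fixes A B :: "real mat"
  assumes "dim_col A = dim_vec v" "dim_col B = dim_vec v"
  shows "(A @\<^sub>r B) *\<^sub>v v = A *\<^sub>v v @\<^sub>v B *\<^sub>v v"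
  by (rule mat_mult_append[OF carrier_matI carrier_matI carrier_vecI]) (simp_all add: assms)

text \<open>\<open>@\<^sub>c\<close> is a four-block matrix whose lower blocks have no rows, so the
  lower part of the product is the empty vector.\<close>

lemma append_cols_mult_vec:
  assumes "dim_row A = dim_row B" "dim_col A = dim_vec u" "dim_col B = dim_vec w"
  shows "(A @\<^sub>c B) *\<^sub>v (u @\<^sub>v w) = A *\<^sub>v u + B *\<^sub>v w"
proof -
  have "(A @\<^sub>c B) *\<^sub>v (u @\<^sub>v w) =
    (A *\<^sub>v u + B *\<^sub>v w) @\<^sub>v (0\<^sub>m 0 (dim_col A) *\<^sub>v u + 0\<^sub>m 0 (dim_col B) *\<^sub>v w)"
    unfolding append_cols_def
    by (rule four_block_mat_mult_vec[OF carrier_matI carrier_matI carrier_matI carrier_matI carrier_vecI carrier_vecI])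
       (simp_all add: assms)
  thus ?thesis using assms by (auto intro!: eq_vecI)
qed

lemma zero_mult_vec: "dim_vec v = nc \<Longrightarrow> 0\<^sub>m nr nc *\<^sub>v v = (0\<^sub>v nr :: real vec)"
  by (intro eq_vecI) (auto simp: scalar_prod_def)

lemma one_mult_vec: "dim_vec v = n \<Longrightarrow> 1\<^sub>m n *\<^sub>v v = (v :: real vec)"
  by (rule one_mult_mat_vec[OF carrier_vecI])

lemma smult_one_mult_vec:
  assumes "dim_vec v = n"
  shows "(k \<cdot>\<^sub>m 1\<^sub>m n) *\<^sub>v v = k \<cdot>\<^sub>v (v :: real vec)"
proof (rule eq_vecI)
  fix i assume "i < dim_vec (k \<cdot>\<^sub>v v)"
  hence "((k \<cdot>\<^sub>m 1\<^sub>m n) *\<^sub>v v) $ i = k * (1\<^sub>m n *\<^sub>v v) $ i"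
    using assms by (simp add: scalar_prod_def sum_distrib_left mult.assoc)
  thus "((k \<cdot>\<^sub>m 1\<^sub>m n) *\<^sub>v v) $ i = (k \<cdot>\<^sub>v v) $ i"
    using assms \<open>i < dim_vec (k \<cdot>\<^sub>v v)\<close> by (simp only: one_mult_vec index_smult_vec)
qed (use assms in simp)

lemma zero_add_vec: "dim_vec v = n \<Longrightarrow> 0\<^sub>v n + v = (v :: real vec)" "dim_vec v = n \<Longrightarrow> v + 0\<^sub>v n = v"
  by (rule left_zero_vec[OF carrier_vecI] right_zero_vec[OF carrier_vecI]; assumption)+

text \<open>The premises of these rules are equations between dimensions rather than membership in
  carriers, so the simplifier can discharge them while it evaluates a block matrix on a concatenated
  vector.\<close>

lemmas block_mult_vec = append_rows_mult_vec append_cols_mult_vec zero_mult_vec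
  smult_one_mult_vec zero_add_vec one_mult_vec

lemma T_mat_mult:
  assumes "dim_vec u = n1" "dim_vec v = n2" "dim_vec w = n2"
  shows "T_mat a b n1 n2 *\<^sub>v (u @\<^sub>v v @\<^sub>v w) =
    u @\<^sub>v u @\<^sub>v v @\<^sub>v (v + (b - a) \<cdot>\<^sub>v w) @\<^sub>v w @\<^sub>v w"
  using assms by (simp add: T_mat_def block_mult_vec)

lemma T_mat_carrier: "T_mat a b n1 n2 \<in> carrier_mat (2 * n1 + 4 * n2) (n1 + 2 * n2)"
  by (intro carrier_matI) (simp_all add: T_mat_def)

lemma Q_mat_mult:
  assumes "dim_vec u = n0" "dim_vec v = n1" "dim_vec w = n2"
  shows "Q_mat b n0 n1 n2 \<theta> *\<^sub>v (u @\<^sub>v v @\<^sub>v w) =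
    0\<^sub>v n1 @\<^sub>v v @\<^sub>v 0\<^sub>v n2 @\<^sub>v (b - \<theta>) \<cdot>\<^sub>v w @\<^sub>v 0\<^sub>v n2 @\<^sub>v w"
  using assms by (simp add: Q_mat_def block_mult_vec)

lemma Q_mat_carrier: "Q_mat b n0 n1 n2 \<theta> \<in> carrier_mat (2 * n1 + 4 * n2) (n0 + n1 + n2)"
  by (intro carrier_matI) (simp_all add: Q_mat_def)

lemma K_mat_mult:
  assumes "dim_vec u = n1" "dim_vec v = n2" "dim_vec w = n2"
  shows "K_mat a n0 n1 n2 s *\<^sub>v (u @\<^sub>v v @\<^sub>v w) = 0\<^sub>v n0 @\<^sub>v u @\<^sub>v (v + (s - a) \<cdot>\<^sub>v w)"
  using assms by (simp add: K_mat_def block_mult_vec)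

lemma K_mat_carrier: "K_mat a n0 n1 n2 s \<in> carrier_mat (n0 + n1 + n2) (n1 + 2 * n2)"
  by (intro carrier_matI) (simp_all add: K_mat_def)

lemma V_mat_mult:
  assumes "dim_vec u = n1" "dim_vec v = n2" "dim_vec w = n2"
  shows "V_mat n1 n2 *\<^sub>v (u @\<^sub>v v @\<^sub>v w) = 0\<^sub>v n1 @\<^sub>v w"
  using assms by (simp add: V_mat_def block_mult_vec)

lemma V_mat_carrier: "V_mat n1 n2 \<in> carrier_mat (n1 + n2) (n1 + 2 * n2)"
  by (intro carrier_matI) (simp_all add: V_mat_def)

section \<open>Blocks of vectors and componentwise integrals\<close>

definition slice :: "nat \<Rightarrow> nat \<Rightarrow> real vec \<Rightarrow> real vec" where
  "slice k m v = vec m (\<lambda>i. v $ (k + i))"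

lemma dim_slice [simp]: "dim_vec (slice k m v) = m"
  by (simp add: slice_def)

lemma index_slice [simp]: "i < m \<Longrightarrow> slice k m v $ i = v $ (k + i)"
  by (simp add: slice_def)

lemma append_slices:
  "dim_vec v = p + q + r \<Longrightarrow> slice 0 p v @\<^sub>v slice p q v @\<^sub>v slice (p + q) r v = v"
  by (intro eq_vecI) (auto simp: slice_def)

lemma slice_append3:
  assumes "dim_vec u = p" "dim_vec v = q" "dim_vec w = r"
  shows "slice 0 p (u @\<^sub>v v @\<^sub>v w) = u" "slice p q (u @\<^sub>v v @\<^sub>v w) = v"
    "slice (p + q) r (u @\<^sub>v v @\<^sub>v w) = w"
  using assms by (auto intro!: eq_vecI simp: slice_def)

lemma append_vec_cong3:
  assumes "u = u'" "v = v'" "w = w'" shows "u @\<^sub>v v @\<^sub>v w = u' @\<^sub>v v' @\<^sub>v w'"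
  using assms by simp

text \<open>The dimension is part of the notion because the index rules for sums, products and
  concatenations of vectors hold only inside the dimension.\<close>

definition vec_integrable :: "real \<Rightarrow> real \<Rightarrow> nat \<Rightarrow> (real \<Rightarrow> real vec) \<Rightarrow> bool" where
  "vec_integrable c d m f \<longleftrightarrow> (\<forall>\<theta>\<in>{c..d}. dim_vec (f \<theta>) = m) \<and>
     (\<forall>i<m. integrable (lebesgue_on {c..d}) (\<lambda>\<theta>. f \<theta> $ i))"

definition vec_integral :: "real \<Rightarrow> real \<Rightarrow> nat \<Rightarrow> (real \<Rightarrow> real vec) \<Rightarrow> real vec" where
  "vec_integral c d m f = vec m (\<lambda>i. LINT \<theta>|lebesgue_on {c..d}. f \<theta> $ i)"

lemma dim_vec_integral [simp]: "dim_vec (vec_integral c d m f) = m"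
  by (simp add: vec_integral_def)

lemma PI_op_eq:
  "PI_op a b n N0 N1 N2 x s = N0 s *\<^sub>v x s + vec_integral a s n (\<lambda>\<theta>. N1 s \<theta> *\<^sub>v x \<theta>)
     + vec_integral s b n (\<lambda>\<theta>. N2 s \<theta> *\<^sub>v x \<theta>)"
  by (simp add: PI_op_def vec_integral_def)

lemma vec_integral_cong:
  "(\<And>\<theta>. \<theta> \<in> {c..d} \<Longrightarrow> f \<theta> = g \<theta>) \<Longrightarrow> vec_integral c d m f = vec_integral c d m g"
  unfolding vec_integral_def by (auto intro!: Bochner_Integration.integral_cong eq_vecI)

lemma vec_integrable_cong:
  assumes "vec_integrable c d m f" "\<And>\<theta>. \<theta> \<in> {c..d} \<Longrightarrow> f \<theta> = g \<theta>"
  shows "vec_integrable c d m g"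
proof -
  have "integrable (lebesgue_on {c..d}) (\<lambda>\<theta>. g \<theta> $ i) \<longleftrightarrow> integrable (lebesgue_on {c..d}) (\<lambda>\<theta>. f \<theta> $ i)" for i
    using assms(2) by (intro Bochner_Integration.integrable_cong) auto
  thus ?thesis using assms by (auto simp: vec_integrable_def)
qed

lemma vec_integrable_add:
  assumes "vec_integrable c d m f" "vec_integrable c d m g"
  shows "vec_integrable c d m (\<lambda>\<theta>. f \<theta> + g \<theta>)"
proof -
  have "integrable (lebesgue_on {c..d}) (\<lambda>\<theta>. (f \<theta> + g \<theta>) $ i) \<longleftrightarrow>
        integrable (lebesgue_on {c..d}) (\<lambda>\<theta>. f \<theta> $ i + g \<theta> $ i)" if "i < m" for i
    using assms that by (intro Bochner_Integration.integrable_cong) (auto simp: vec_integrable_def)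
  thus ?thesis using assms by (auto simp: vec_integrable_def)
qed

lemma vec_integral_add:
  assumes "vec_integrable c d m f" "vec_integrable c d m g"
  shows "vec_integral c d m (\<lambda>\<theta>. f \<theta> + g \<theta>) = vec_integral c d m f + vec_integral c d m g"
proof (rule eq_vecI)
  fix i assume "i < dim_vec (vec_integral c d m f + vec_integral c d m g)"
  hence i: "i < m" by simp
  have "(LINT \<theta>|lebesgue_on {c..d}. (f \<theta> + g \<theta>) $ i) = (LINT \<theta>|lebesgue_on {c..d}. f \<theta> $ i + g \<theta> $ i)"
    using assms i by (intro Bochner_Integration.integral_cong) (auto simp: vec_integrable_def)
  thus "vec_integral c d m (\<lambda>\<theta>. f \<theta> + g \<theta>) $ i = (vec_integral c d m f + vec_integral c d m g) $ i"
    using assms i by (simp add: vec_integral_def vec_integrable_def)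
qed simp

lemma
  assumes f: "vec_integrable c d m f" and A: "A \<in> carrier_mat k m"
  shows vec_integrable_mult: "vec_integrable c d k (\<lambda>\<theta>. A *\<^sub>v f \<theta>)"
    and vec_integral_mult: "vec_integral c d k (\<lambda>\<theta>. A *\<^sub>v f \<theta>) = A *\<^sub>v vec_integral c d m f"
proof -
  let ?M = "lebesgue_on {c..d}"
  have row: "(A *\<^sub>v f \<theta>) $ j = (\<Sum>i<m. A $$ (j, i) * f \<theta> $ i)" if "j < k" "\<theta> \<in> {c..d}" for j \<theta>
    using f A that by (auto simp: vec_integrable_def scalar_prod_def lessThan_atLeast0)
  have "integrable ?M (\<lambda>\<theta>. \<Sum>i<m. A $$ (j, i) * f \<theta> $ i)" for j
    using f by (auto simp: vec_integrable_def)
  \<comment> \<open>The entry rule for matrix-vector products is disabled so that \<open>row\<close>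
    can match before its left-hand side is unfolded.\<close>
  moreover have "integrable ?M (\<lambda>\<theta>. (A *\<^sub>v f \<theta>) $ j) \<longleftrightarrow> integrable ?M (\<lambda>\<theta>. \<Sum>i<m. A $$ (j, i) * f \<theta> $ i)"
    if "j < k" for j
    using row[OF that] by (intro Bochner_Integration.integrable_cong) (simp_all del: index_mult_mat_vec)
  ultimately show "vec_integrable c d k (\<lambda>\<theta>. A *\<^sub>v f \<theta>)"
    using A unfolding vec_integrable_def by auto
  show "vec_integral c d k (\<lambda>\<theta>. A *\<^sub>v f \<theta>) = A *\<^sub>v vec_integral c d m f"
  proof (rule eq_vecI)
    fix j assume "j < dim_vec (A *\<^sub>v vec_integral c d m f)"
    hence j: "j < k" using A by simp
    have "(LINT \<theta>|?M. (A *\<^sub>v f \<theta>) $ j) = (LINT \<theta>|?M. (\<Sum>i<m. A $$ (j, i) * f \<theta> $ i))"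
      using row[OF j] by (intro Bochner_Integration.integral_cong) (simp_all del: index_mult_mat_vec)
    also have "\<dots> = (\<Sum>i<m. A $$ (j, i) * (LINT \<theta>|?M. f \<theta> $ i))"
      using f by (simp add: vec_integrable_def)
    also have "\<dots> = (A *\<^sub>v vec_integral c d m f) $ j"
      using A j by (simp add: vec_integral_def scalar_prod_def lessThan_atLeast0)
    finally show "vec_integral c d k (\<lambda>\<theta>. A *\<^sub>v f \<theta>) $ j = (A *\<^sub>v vec_integral c d m f) $ j"
      using j by (simp add: vec_integral_def del: index_mult_mat_vec)
  qed (use A in simp)
qed

lemma
  assumes f: "vec_integrable c d m f" and g: "vec_integrable c d k g"
  shows vec_integrable_append: "vec_integrable c d (m + k) (\<lambda>\<theta>. f \<theta> @\<^sub>v g \<theta>)"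
    and vec_integral_append: "vec_integral c d (m + k) (\<lambda>\<theta>. f \<theta> @\<^sub>v g \<theta>) =
      vec_integral c d m f @\<^sub>v vec_integral c d k g"
proof -
  let ?M = "lebesgue_on {c..d}"
  have ix: "(f \<theta> @\<^sub>v g \<theta>) $ i = (if i < m then f \<theta> $ i else g \<theta> $ (i - m))"
    if "i < m + k" "\<theta> \<in> {c..d}" for i \<theta>
    using f g that by (simp add: vec_integrable_def)
  have "integrable ?M (\<lambda>\<theta>. (f \<theta> @\<^sub>v g \<theta>) $ i) \<longleftrightarrow>
    integrable ?M (\<lambda>\<theta>. if i < m then f \<theta> $ i else g \<theta> $ (i - m))" if "i < m + k" for i
    using ix[OF that] by (intro Bochner_Integration.integrable_cong) (simp_all del: index_append_vec)
  moreover have "integrable ?M (\<lambda>\<theta>. if i < m then f \<theta> $ i else g \<theta> $ (i - m))" if "i < m + k" for i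
    using f g that by (cases "i < m") (simp_all add: vec_integrable_def)
  ultimately show "vec_integrable c d (m + k) (\<lambda>\<theta>. f \<theta> @\<^sub>v g \<theta>)"
    using f g unfolding vec_integrable_def by auto
  have "(LINT \<theta>|?M. (f \<theta> @\<^sub>v g \<theta>) $ i) = (LINT \<theta>|?M. (if i < m then f \<theta> $ i else g \<theta> $ (i - m)))"
    if "i < m + k" for i
    using ix[OF that] by (intro Bochner_Integration.integral_cong) (simp_all del: index_append_vec)
  thus "vec_integral c d (m + k) (\<lambda>\<theta>. f \<theta> @\<^sub>v g \<theta>) = vec_integral c d m f @\<^sub>v vec_integral c d k g"
    by (intro eq_vecI) (simp_all add: vec_integral_def)
qed

lemma vec_integrable_zero: "vec_integrable c d m (\<lambda>\<theta>. 0\<^sub>v m)"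
  by (simp add: vec_integrable_def)

lemma vec_integral_zero: "vec_integral c d m (\<lambda>\<theta>. 0\<^sub>v m) = 0\<^sub>v m"
  by (auto simp: vec_integral_def)

lemma vec_integral_combine:
  assumes f: "vec_integrable a b m f" and s: "s \<in> {a..b}"
  shows "vec_integral a s m f + vec_integral s b m f = vec_integral a b m f"
proof (rule eq_vecI)
  fix i assume "i < dim_vec (vec_integral a b m f)"
  hence "i < m" by simp
  hence "integrable (lebesgue_on {a..b}) (\<lambda>\<theta>. f \<theta> $ i)" using f by (simp add: vec_integrable_def)
  from integral_eq_primitive_diff[OF this, of s b] \<open>i < m\<close> s
  show "(vec_integral a s m f + vec_integral s b m f) $ i = vec_integral a b m f $ i"
    by (simp add: vec_integral_def primitive_def)
qed simp

lemma vec_integrable_subinterval: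
  "vec_integrable a b m f \<Longrightarrow> {c..d} \<subseteq> {a..b} \<Longrightarrow> vec_integrable c d m f"
  unfolding vec_integrable_def by (blast intro: integrable_subinterval)

lemma vec_integrable_slice:
  assumes "y \<in> L2 a b n" "k + m \<le> n"
  shows "vec_integrable a b m (\<lambda>\<theta>. slice k m (y \<theta>))"
  using L2_D(3)[OF assms(1)] assms(2) by (auto simp: vec_integrable_def intro: sq_int_integrable)

lemma vec_integrable_smult_slice:
  assumes "y \<in> L2 a b n" "k + m \<le> n"
  shows "vec_integrable a b m (\<lambda>\<theta>. (s - \<theta>) \<cdot>\<^sub>v slice k m (y \<theta>))"
proof -
  have "integrable (lebesgue_on {a..b}) (\<lambda>\<theta>. (s - \<theta>) * (y \<theta> $ (k + i)))" if "i < m" for i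
    using L2_D(3)[OF assms(1), of "k + i"] assms(2) that
    by (intro integrable_continuous_mult continuous_intros sq_int_integrable) auto
  thus ?thesis by (simp add: vec_integrable_def)
qed

text \<open>The definite description in \<open>mat_inv\<close> denotes an inverse because two-sided
  inverses are unique: M = M (A N) = (M A) N = N.\<close>

lemma mat_inv_inverse:
  assumes A: "A \<in> carrier_mat n n" and "invertible_mat A"
  shows "mat_inv A \<in> carrier_mat n n" "A * mat_inv A = 1\<^sub>m n" "mat_inv A * A = 1\<^sub>m n"
proof -
  let ?P = "\<lambda>N. inverts_mat A N \<and> inverts_mat N A"
  have P: "?P N \<longleftrightarrow> N \<in> carrier_mat n n \<and> A * N = 1\<^sub>m n \<and> N * A = 1\<^sub>m n" for N
  proof
    assume N: "?P N"
    \<comment> \<open>\<open>inverts_mat\<close> does not fix the shape of N; its dimensions are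
      read off from the fact that both products are identity matrices.\<close>
    hence "dim_col (A * N) = n" "dim_col (N * A) = dim_row N"
      using A unfolding inverts_mat_def by (metis carrier_matD(1) index_one_mat(3))+
    hence "N \<in> carrier_mat n n" using A by (intro carrier_matI) auto
    thus "N \<in> carrier_mat n n \<and> A * N = 1\<^sub>m n \<and> N * A = 1\<^sub>m n"
      using N A by (auto simp: inverts_mat_def)
  qed (use A in \<open>auto simp: inverts_mat_def\<close>)
  obtain N where N: "?P N" using assms(2) unfolding invertible_mat_def by blast
  have unique: "M = N" if "?P M" for M
  proof -
    have M: "M \<in> carrier_mat n n" "M * A = 1\<^sub>m n" using that unfolding P by auto
    have N': "N \<in> carrier_mat n n" "A * N = 1\<^sub>m n" using N unfolding P by auto
    have "M = M * (A * N)" unfolding N'(2) using M(1) by simp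
    also have "\<dots> = (M * A) * N" by (rule assoc_mult_mat[OF M(1) A N'(1), symmetric])
    also have "\<dots> = N" unfolding M(2) using N'(1) by simp
    finally show ?thesis .
  qed
  have "?P (mat_inv A)" unfolding mat_inv_def by (rule theI[of ?P, OF N unique])
  thus "mat_inv A \<in> carrier_mat n n" "A * mat_inv A = 1\<^sub>m n" "mat_inv A * A = 1\<^sub>m n"
    unfolding P by auto
qed

lemma mult_uminus_vec:
  fixes A :: "real mat"
  assumes "A \<in> carrier_mat nr nc" "v \<in> carrier_vec nc"
  shows "A *\<^sub>v (- v) = - (A *\<^sub>v v)"
  using assms by (intro eq_vecI) auto

section \<open>Reconstruction of the state\<close>

locale boundary_problem =
  fixes a b :: real and n0 n1 n2 :: nat and B :: "real mat"
  assumes ab: "a < b"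
    and B_carrier: "B \<in> carrier_mat (n1 + 2 * n2) (2 * n1 + 4 * n2)"
    and BT_invertible: "invertible_mat (B * T_mat a b n1 n2)"
begin

abbreviation n :: nat where "n \<equiv> n0 + n1 + n2"

abbreviation W :: "real mat" where "W \<equiv> mat_inv (B * T_mat a b n1 n2)"

lemma W_inverse:
  "W \<in> carrier_mat (n1 + 2 * n2) (n1 + 2 * n2)"
  "(B * T_mat a b n1 n2) * W = 1\<^sub>m (n1 + 2 * n2)" "W * (B * T_mat a b n1 n2) = 1\<^sub>m (n1 + 2 * n2)"
proof -
  have BT: "B * T_mat a b n1 n2 \<in> carrier_mat (n1 + 2 * n2) (n1 + 2 * n2)"
    using B_carrier T_mat_carrier by (rule mult_carrier_mat)
  show "W \<in> carrier_mat (n1 + 2 * n2) (n1 + 2 * n2)"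
    "(B * T_mat a b n1 n2) * W = 1\<^sub>m (n1 + 2 * n2)" "W * (B * T_mat a b n1 n2) = 1\<^sub>m (n1 + 2 * n2)"
    using mat_inv_inverse[OF BT BT_invertible] .
qed

text \<open>
  \<open>bnd_integral y\<close> is the integral of Q y over [a,b], and \<open>bnd_coeff y\<close> is the vector
  (x1(a), x2(a), x2_s(a)) that the boundary condition forces on the state x with
  (x0, x1_s, x2_ss) = y.
\<close>

definition bnd_integral :: "(real \<Rightarrow> real vec) \<Rightarrow> real vec" where
  "bnd_integral y = 0\<^sub>v n1 @\<^sub>v vec n1 (\<lambda>i. primitive a (\<lambda>\<theta>. y \<theta> $ (n0 + i)) b) @\<^sub>v
     0\<^sub>v n2 @\<^sub>v vec n2 (\<lambda>i. primitive a (primitive a (\<lambda>\<theta>. y \<theta> $ (n0 + n1 + i))) b) @\<^sub>v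
     0\<^sub>v n2 @\<^sub>v vec n2 (\<lambda>i. primitive a (\<lambda>\<theta>. y \<theta> $ (n0 + n1 + i)) b)"

definition bnd_coeff :: "(real \<Rightarrow> real vec) \<Rightarrow> real vec" where
  "bnd_coeff y = - (W *\<^sub>v (B *\<^sub>v bnd_integral y))"

lemma bnd_integral_carrier: "bnd_integral y \<in> carrier_vec (2 * n1 + 4 * n2)"
  by (intro carrier_vecI) (simp add: bnd_integral_def)

lemma bnd_coeff_carrier: "bnd_coeff y \<in> carrier_vec (n1 + 2 * n2)"
  using W_inverse(1) unfolding bnd_coeff_def carrier_vec_def by auto

lemma bnd_coeff_slices:
  "bnd_coeff y = slice 0 n1 (bnd_coeff y) @\<^sub>v slice n1 n2 (bnd_coeff y) @\<^sub>v slice (n1 + n2) n2 (bnd_coeff y)"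
  using bnd_coeff_carrier[of y] by (intro append_slices[symmetric]) simp

text \<open>With q = B \<open>bnd_integral y\<close>, the condition reads (B T) c = -q and is solved
  by the inverse of B T. From right to left this puts reconstructed states into X; from left to
  right it identifies the integration constants of a given state of X.\<close>

lemma bnd_coeff_iff:
  assumes c: "c \<in> carrier_vec (n1 + 2 * n2)"
  shows "B *\<^sub>v (T_mat a b n1 n2 *\<^sub>v c + bnd_integral y) = 0\<^sub>v (n1 + 2 * n2) \<longleftrightarrow> c = bnd_coeff y"
proof -
  let ?N = "n1 + 2 * n2" and ?T = "T_mat a b n1 n2"
  define q where "q = B *\<^sub>v bnd_integral y"
  have q: "q \<in> carrier_vec ?N" unfolding q_def using B_carrier bnd_integral_carrier by (rule mult_mat_vec_carrier)
  have BT: "B * ?T \<in> carrier_mat ?N ?N" using B_carrier T_mat_carrier by (rule mult_carrier_mat)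
  define u where "u = (B * ?T) *\<^sub>v c"
  have u: "u \<in> carrier_vec ?N" unfolding u_def using BT c by (rule mult_mat_vec_carrier)
  have "B *\<^sub>v (?T *\<^sub>v c + bnd_integral y) = u + q"
    using mult_add_distrib_mat_vec[OF B_carrier mult_mat_vec_carrier[OF T_mat_carrier c] bnd_integral_carrier]
      assoc_mult_mat_vec[OF B_carrier T_mat_carrier c] by (simp add: q_def u_def)
  moreover have "u + q = 0\<^sub>v ?N \<longleftrightarrow> c = - (W *\<^sub>v q)"
  proof
    assume 0: "u + q = 0\<^sub>v ?N"
    have "u = - q"
    proof (rule eq_vecI)
      fix i assume "i < dim_vec (- q)"
      hence i: "i < ?N" using q by simp
      have "(u + q) $ i = 0" using 0 i by simp
      thus "u $ i = (- q) $ i" using i u q by simp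
    qed (use u q in simp)
    moreover have "c = W *\<^sub>v u"
      using assoc_mult_mat_vec[OF W_inverse(1) BT c] W_inverse(3) c by (simp add: u_def)
    moreover have "W *\<^sub>v (- q) = - (W *\<^sub>v q)"
      using W_inverse(1) q by (rule mult_uminus_vec)
    ultimately show "c = - (W *\<^sub>v q)" by simp
  next
    assume c': "c = - (W *\<^sub>v q)"
    have Wq: "W *\<^sub>v q \<in> carrier_vec ?N" using W_inverse(1) q by (rule mult_mat_vec_carrier)
    have "(B * ?T) *\<^sub>v (- (W *\<^sub>v q)) = - ((B * ?T) *\<^sub>v (W *\<^sub>v q))"
      using BT Wq by (rule mult_uminus_vec)
    also have "(B * ?T) *\<^sub>v (W *\<^sub>v q) = q"
      using assoc_mult_mat_vec[OF BT W_inverse(1) q] W_inverse(2) q by simp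
    finally have "u = - q" unfolding u_def c' .
    thus "u + q = 0\<^sub>v ?N" using q by simp
  qed
  ultimately show ?thesis unfolding bnd_coeff_def q_def[symmetric] by simp
qed

text \<open>
  \<open>rec1\<close>, \<open>rec2\<close> and \<open>rec2s\<close> recover x1, x2 and x2_s from y.
\<close>

definition rec1 :: "(real \<Rightarrow> real vec) \<Rightarrow> real \<Rightarrow> real vec" where
  "rec1 y s = vec n1 (\<lambda>i. bnd_coeff y $ i + primitive a (\<lambda>\<theta>. y \<theta> $ (n0 + i)) s)"

definition rec2 :: "(real \<Rightarrow> real vec) \<Rightarrow> real \<Rightarrow> real vec" where
  "rec2 y s = vec n2 (\<lambda>i. bnd_coeff y $ (n1 + i) + (s - a) * bnd_coeff y $ (n1 + n2 + i) +
     primitive a (primitive a (\<lambda>\<theta>. y \<theta> $ (n0 + n1 + i))) s)"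

definition rec2s :: "(real \<Rightarrow> real vec) \<Rightarrow> real \<Rightarrow> real vec" where
  "rec2s y s = vec n2 (\<lambda>i. bnd_coeff y $ (n1 + n2 + i) + primitive a (\<lambda>\<theta>. y \<theta> $ (n0 + n1 + i)) s)"

definition rec_state :: "(real \<Rightarrow> real vec) \<Rightarrow> state" where
  "rec_state y = ((\<lambda>s. slice 0 n0 (y s)), rec1 y, rec2 y)"

section \<open>The integral operators expressed through the reconstruction\<close>

lemma y_slices:
  assumes "y \<in> L2 a b n" "\<theta> \<in> {a..b}"
  shows "y \<theta> = slice 0 n0 (y \<theta>) @\<^sub>v slice n0 n1 (y \<theta>) @\<^sub>v slice (n0 + n1) n2 (y \<theta>)"
  using L2_D(2)[OF assms] by (intro append_slices[symmetric]) simp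

lemma comp_integrable:
  assumes "y \<in> L2 a b n" "j < n"
  shows "integrable (lebesgue_on {a..b}) (\<lambda>\<theta>. y \<theta> $ j)"
  using L2_D(3)[OF assms] by (rule sq_int_integrable)

text \<open>The weight b - \<theta> in \<open>Q_mat\<close> becomes the repeated primitive at b, the
  form in which \<open>bnd_integral\<close> is defined and in which \<open>rec2\<close> contains
  it.\<close>

lemma Q_integral:
  assumes y: "y \<in> L2 a b n"
  shows "vec_integrable a b (2 * n1 + 4 * n2) (\<lambda>\<theta>. Q_mat b n0 n1 n2 \<theta> *\<^sub>v y \<theta>)"
    "vec_integral a b (2 * n1 + 4 * n2) (\<lambda>\<theta>. Q_mat b n0 n1 n2 \<theta> *\<^sub>v y \<theta>) = bnd_integral y"
proof -
  let ?y1 = "\<lambda>\<theta>. slice n0 n1 (y \<theta>)" and ?y2 = "\<lambda>\<theta>. slice (n0 + n1) n2 (y \<theta>)"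
  let ?f = "\<lambda>\<theta>. 0\<^sub>v n1 @\<^sub>v ?y1 \<theta> @\<^sub>v 0\<^sub>v n2 @\<^sub>v (b - \<theta>) \<cdot>\<^sub>v ?y2 \<theta> @\<^sub>v 0\<^sub>v n2 @\<^sub>v ?y2 \<theta>"
  have eq: "Q_mat b n0 n1 n2 \<theta> *\<^sub>v y \<theta> = ?f \<theta>" if "\<theta> \<in> {a..b}" for \<theta>
    by (subst y_slices[OF y that], rule Q_mat_mult) simp_all
  note i = vec_integrable_slice[OF y, of n0 n1, simplified] vec_integrable_slice[OF y, of "n0 + n1" n2, simplified]
    vec_integrable_smult_slice[OF y, of "n0 + n1" n2 b, simplified] vec_integrable_zero[of a b]
  have dim: "2 * n1 + 4 * n2 = n1 + (n1 + (n2 + (n2 + (n2 + n2))))" by simp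
  have "vec_integrable a b (2 * n1 + 4 * n2) ?f"
    unfolding dim by (intro vec_integrable_append i)
  thus "vec_integrable a b (2 * n1 + 4 * n2) (\<lambda>\<theta>. Q_mat b n0 n1 n2 \<theta> *\<^sub>v y \<theta>)"
    by (rule vec_integrable_cong) (simp add: eq)
  have "vec_integral a b (2 * n1 + 4 * n2) (\<lambda>\<theta>. Q_mat b n0 n1 n2 \<theta> *\<^sub>v y \<theta>) =
      vec_integral a b (2 * n1 + 4 * n2) ?f"
    by (rule vec_integral_cong) (rule eq)
  also have "\<dots> = vec_integral a b n1 (\<lambda>\<theta>. 0\<^sub>v n1) @\<^sub>v vec_integral a b n1 ?y1 @\<^sub>v
      vec_integral a b n2 (\<lambda>\<theta>. 0\<^sub>v n2) @\<^sub>v vec_integral a b n2 (\<lambda>\<theta>. (b - \<theta>) \<cdot>\<^sub>v ?y2 \<theta>) @\<^sub>v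
      vec_integral a b n2 (\<lambda>\<theta>. 0\<^sub>v n2) @\<^sub>v vec_integral a b n2 ?y2"
    unfolding dim by (subst vec_integral_append, (intro vec_integrable_append i)+)+ (rule refl)
  also have "vec_integral a b n2 (\<lambda>\<theta>. (b - \<theta>) \<cdot>\<^sub>v ?y2 \<theta>) =
      vec n2 (\<lambda>i. primitive a (primitive a (\<lambda>\<theta>. y \<theta> $ (n0 + n1 + i))) b)"
    unfolding vec_integral_def using primitive_primitive[OF comp_integrable[OF y], of "n0 + n1 + _" b] ab
    by (intro eq_vecI) auto
  also have "vec_integral a b n1 ?y1 = vec n1 (\<lambda>i. primitive a (\<lambda>\<theta>. y \<theta> $ (n0 + i)) b)"
    by (auto simp: vec_integral_def primitive_def)
  also have "vec_integral a b n2 ?y2 = vec n2 (\<lambda>i. primitive a (\<lambda>\<theta>. y \<theta> $ (n0 + n1 + i)) b)"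
    by (auto simp: vec_integral_def primitive_def)
  finally show "vec_integral a b (2 * n1 + 4 * n2) (\<lambda>\<theta>. Q_mat b n0 n1 n2 \<theta> *\<^sub>v y \<theta>) = bnd_integral y"
    by (simp add: bnd_integral_def vec_integral_zero)
qed

text \<open>The kernel is a matrix independent of \<theta> times Q(\<theta>), so the integral over
  [a, b] reduces to \<open>bnd_integral y\<close>. The left factor P is kept general because it is
  \<open>K_mat\<close> for \<open>G2\<close> and \<open>V_mat\<close> for \<open>G5\<close>.\<close>

lemma kernel_integral:
  assumes y: "y \<in> L2 a b n" and P: "P \<in> carrier_mat r (n1 + 2 * n2)"
  shows "vec_integrable a b r (\<lambda>\<theta>. - (P * W * B * Q_mat b n0 n1 n2 \<theta>) *\<^sub>v y \<theta>)"
    "vec_integral a b r (\<lambda>\<theta>. - (P * W * B * Q_mat b n0 n1 n2 \<theta>) *\<^sub>v y \<theta>) = P *\<^sub>v bnd_coeff y"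
proof -
  let ?Q = "Q_mat b n0 n1 n2"
  have PW: "P * W \<in> carrier_mat r (n1 + 2 * n2)" using P W_inverse(1) by (rule mult_carrier_mat)
  have PWB: "P * W * B \<in> carrier_mat r (2 * n1 + 4 * n2)" using PW B_carrier by (rule mult_carrier_mat)
  hence uPWB: "- (P * W * B) \<in> carrier_mat r (2 * n1 + 4 * n2)" by simp
  have eq: "- (P * W * B * ?Q \<theta>) *\<^sub>v y \<theta> = - (P * W * B) *\<^sub>v (?Q \<theta> *\<^sub>v y \<theta>)" if "\<theta> \<in> {a..b}" for \<theta>
  proof -
    have yc: "y \<theta> \<in> carrier_vec n" using L2_D(1)[OF y that] .
    have "- (P * W * B * ?Q \<theta>) *\<^sub>v y \<theta> = - ((P * W * B * ?Q \<theta>) *\<^sub>v y \<theta>)"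
      using yc Q_mat_carrier[of b n0 n1 n2 \<theta>] by (intro uminus_mult_mat_vec) auto
    also have "(P * W * B * ?Q \<theta>) *\<^sub>v y \<theta> = (P * W * B) *\<^sub>v (?Q \<theta> *\<^sub>v y \<theta>)"
      by (rule assoc_mult_mat_vec[OF PWB Q_mat_carrier yc])
    also have "- \<dots> = - (P * W * B) *\<^sub>v (?Q \<theta> *\<^sub>v y \<theta>)"
      using PWB Q_mat_carrier[of b n0 n1 n2 \<theta>] by (intro uminus_mult_mat_vec[symmetric]) auto
    finally show ?thesis .
  qed
  show "vec_integrable a b r (\<lambda>\<theta>. - (P * W * B * ?Q \<theta>) *\<^sub>v y \<theta>)"
    using vec_integrable_mult[OF Q_integral(1)[OF y] uPWB] by (rule vec_integrable_cong) (simp only: eq)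
  have "vec_integral a b r (\<lambda>\<theta>. - (P * W * B * ?Q \<theta>) *\<^sub>v y \<theta>) =
    vec_integral a b r (\<lambda>\<theta>. - (P * W * B) *\<^sub>v (?Q \<theta> *\<^sub>v y \<theta>))"
    by (rule vec_integral_cong) (simp only: eq)
  also have "\<dots> = - (P * W * B) *\<^sub>v bnd_integral y"
    using vec_integral_mult[OF Q_integral(1)[OF y] uPWB] Q_integral(2)[OF y] by simp
  also have "\<dots> = - ((P * W * B) *\<^sub>v bnd_integral y)"
    using B_carrier bnd_integral_carrier[of y] by (intro uminus_mult_mat_vec) auto
  also have "(P * W * B) *\<^sub>v bnd_integral y = (P * W) *\<^sub>v (B *\<^sub>v bnd_integral y)"
    using PW B_carrier bnd_integral_carrier by (rule assoc_mult_mat_vec)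
  also have "\<dots> = P *\<^sub>v (W *\<^sub>v (B *\<^sub>v bnd_integral y))"
    using P W_inverse(1) mult_mat_vec_carrier[OF B_carrier bnd_integral_carrier] by (rule assoc_mult_mat_vec)
  also have "- \<dots> = P *\<^sub>v bnd_coeff y"
    unfolding bnd_coeff_def using P W_inverse(1) by (intro eq_vecI) auto
  finally show "vec_integral a b r (\<lambda>\<theta>. - (P * W * B * ?Q \<theta>) *\<^sub>v y \<theta>) = P *\<^sub>v bnd_coeff y" .
qed

text \<open>The kernels below and above the diagonal share the summand \<open>N2\<close>. Its
  integrals over [a, s] and [s, b] join to one over [a, b], and only the part \<open>E\<close>
  remains of Volterra type.\<close>

lemma PI_kernel_integral:
  assumes y: "y \<in> L2 a b n" and P: "P \<in> carrier_mat r (n1 + 2 * n2)" and s: "s \<in> {a..b}"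
    and E: "\<And>\<theta>. \<theta> \<in> {a..s} \<Longrightarrow> E \<theta> \<in> carrier_mat r n"
    and Ei: "vec_integrable a s r (\<lambda>\<theta>. E \<theta> *\<^sub>v y \<theta>)"
  defines "N2 \<equiv> \<lambda>\<theta>. - (P * W * B * Q_mat b n0 n1 n2 \<theta>)"
  shows "vec_integrable a s r (\<lambda>\<theta>. (E \<theta> +
      N2 \<theta>) *\<^sub>v y \<theta>)" "vec_integrable s b r (\<lambda>\<theta>. N2 \<theta> *\<^sub>v y \<theta>)"
    "vec_integral a s r (\<lambda>\<theta>. (E \<theta> + N2 \<theta>) *\<^sub>v y \<theta>) +
        vec_integral s b r (\<lambda>\<theta>. N2 \<theta> *\<^sub>v y \<theta>) =
       vec_integral a s r (\<lambda>\<theta>. E \<theta> *\<^sub>v y \<theta>) + P *\<^sub>v bnd_coeff y"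
proof -
  have k: "vec_integrable a b r (\<lambda>\<theta>. N2 \<theta> *\<^sub>v y \<theta>)"
    "vec_integral a b r (\<lambda>\<theta>. N2 \<theta> *\<^sub>v y \<theta>) = P *\<^sub>v bnd_coeff y"
    unfolding N2_def by (rule kernel_integral[OF y P])+
  have i: "vec_integrable a s r (\<lambda>\<theta>. N2 \<theta> *\<^sub>v y \<theta>)" "vec_integrable s b r (\<lambda>\<theta>. N2 \<theta> *\<^sub>v y \<theta>)"
    using s by (auto intro!: vec_integrable_subinterval[OF k(1)])
  show "vec_integrable s b r (\<lambda>\<theta>. N2 \<theta> *\<^sub>v y \<theta>)" by fact
  have eq: "(E \<theta> + N2 \<theta>) *\<^sub>v y \<theta> = E \<theta> *\<^sub>v y \<theta> +
      N2 \<theta> *\<^sub>v y \<theta>" if "\<theta> \<in> {a..s}" for \<theta>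
  proof (rule add_mult_distrib_mat_vec[OF E[OF that]])
    show "N2 \<theta> \<in> carrier_mat r n"
      unfolding N2_def using P Q_mat_carrier[of b n0 n1 n2 \<theta>] by (intro carrier_matI) auto
    show "y \<theta> \<in> carrier_vec n" using that s by (intro L2_D(1)[OF y]) auto
  qed
  show "vec_integrable a s r (\<lambda>\<theta>. (E \<theta> + N2 \<theta>) *\<^sub>v y \<theta>)"
    using vec_integrable_add[OF Ei i(1)] by (rule vec_integrable_cong) (simp only: eq)
  have "vec_integral a s r (\<lambda>\<theta>. (E \<theta> + N2 \<theta>) *\<^sub>v y \<theta>) =
    vec_integral a s r (\<lambda>\<theta>. E \<theta> *\<^sub>v y \<theta> + N2 \<theta> *\<^sub>v y \<theta>)"
    by (rule vec_integral_cong) (rule eq)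
  also have "\<dots> = vec_integral a s r (\<lambda>\<theta>. E \<theta> *\<^sub>v y \<theta>) +
      vec_integral a s r (\<lambda>\<theta>. N2 \<theta> *\<^sub>v y \<theta>)"
    using Ei i(1) by (rule vec_integral_add)
  finally show "vec_integral a s r (\<lambda>\<theta>. (E \<theta> + N2 \<theta>) *\<^sub>v y \<theta>) +
      vec_integral s b r (\<lambda>\<theta>. N2 \<theta> *\<^sub>v y \<theta>) =
       vec_integral a s r (\<lambda>\<theta>. E \<theta> *\<^sub>v y \<theta>) + P *\<^sub>v bnd_coeff y"
    using assoc_add_vec[of "vec_integral a s r (\<lambda>\<theta>. E \<theta> *\<^sub>v y \<theta>)" r "vec_integral a s r (\<lambda>\<theta>. N2 \<theta> *\<^sub>v y \<theta>)"
        "vec_integral s b r (\<lambda>\<theta>. N2 \<theta> *\<^sub>v y \<theta>)"]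
    by (simp only: vec_integral_combine[OF k(1) s] k(2) carrier_vecI[OF dim_vec_integral])
qed

text \<open>The Volterra parts of G1 and G4, that is, G1 - G2 and G4 - G5.\<close>

definition E1 :: "real \<Rightarrow> real \<Rightarrow> real mat" where
  "E1 s \<theta> = ((0\<^sub>m n0 n0 @\<^sub>c 0\<^sub>m n0 n1 @\<^sub>c 0\<^sub>m n0 n2) @\<^sub>r
      (0\<^sub>m n1 n0 @\<^sub>c 1\<^sub>m n1    @\<^sub>c 0\<^sub>m n1 n2) @\<^sub>r
      (0\<^sub>m n2 n0 @\<^sub>c 0\<^sub>m n2 n1 @\<^sub>c (s - \<theta>) \<cdot>\<^sub>m 1\<^sub>m n2))"

definition E4 :: "real \<Rightarrow> real mat" where
  "E4 \<theta> = ((0\<^sub>m n1 n0 @\<^sub>c 0\<^sub>m n1 n1 @\<^sub>c 0\<^sub>m n1 n2) @\<^sub>r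
      (0\<^sub>m n2 n0 @\<^sub>c 0\<^sub>m n2 n1 @\<^sub>c 1\<^sub>m n2))"

lemma E_carrier: "E1 s \<theta> \<in> carrier_mat n n" "E4 \<theta> \<in> carrier_mat (n1 + n2) n"
  by (intro carrier_matI; simp add: E1_def E4_def)+

lemma E1_integral:
  assumes y: "y \<in> L2 a b n" and s: "s \<in> {a..b}"
  shows "vec_integrable a s n (\<lambda>\<theta>. E1 s \<theta> *\<^sub>v y \<theta>)"
    "vec_integral a s n (\<lambda>\<theta>. E1 s \<theta> *\<^sub>v y \<theta>) = 0\<^sub>v n0 @\<^sub>v
       vec n1 (\<lambda>i. primitive a (\<lambda>\<theta>. y \<theta> $ (n0 + i)) s) @\<^sub>v
       vec n2 (\<lambda>i. primitive a (primitive a (\<lambda>\<theta>. y \<theta> $ (n0 + n1 + i))) s)"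
proof -
  let ?y1 = "\<lambda>\<theta>. slice n0 n1 (y \<theta>)" and ?y2 = "\<lambda>\<theta>. slice (n0 + n1) n2 (y \<theta>)"
  let ?f = "\<lambda>\<theta>. 0\<^sub>v n0 @\<^sub>v ?y1 \<theta> @\<^sub>v (s - \<theta>) \<cdot>\<^sub>v ?y2 \<theta>"
  have eq: "E1 s \<theta> *\<^sub>v y \<theta> = ?f \<theta>" if "\<theta> \<in> {a..s}" for \<theta>
  proof -
    have "\<theta> \<in> {a..b}" using that s by auto
    show ?thesis
      by (subst y_slices[OF y \<open>\<theta> \<in> {a..b}\<close>]) (simp add: E1_def block_mult_vec)
  qed
  have sub: "{a..s} \<subseteq> {a..b}" using s by auto
  note i = vec_integrable_subinterval[OF vec_integrable_slice[OF y, of n0 n1, simplified] sub]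
    vec_integrable_subinterval[OF vec_integrable_smult_slice[OF y, of "n0 + n1" n2 s, simplified] sub]
    vec_integrable_zero[of a s]
  have dim: "n = n0 + (n1 + n2)" by simp
  have "vec_integrable a s n ?f" unfolding dim by (intro vec_integrable_append i)
  thus "vec_integrable a s n (\<lambda>\<theta>. E1 s \<theta> *\<^sub>v y \<theta>)"
    by (rule vec_integrable_cong) (simp add: eq)
  have "vec_integral a s n (\<lambda>\<theta>. E1 s \<theta> *\<^sub>v y \<theta>) = vec_integral a s n ?f"
    by (rule vec_integral_cong) (rule eq)
  also have "\<dots> = vec_integral a s n0 (\<lambda>\<theta>. 0\<^sub>v n0) @\<^sub>v vec_integral a s n1 ?y1 @\<^sub>v
      vec_integral a s n2 (\<lambda>\<theta>. (s - \<theta>) \<cdot>\<^sub>v ?y2 \<theta>)"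
    unfolding dim by (subst vec_integral_append, (intro vec_integrable_append i)+)+ (rule refl)
  also have "vec_integral a s n2 (\<lambda>\<theta>. (s - \<theta>) \<cdot>\<^sub>v ?y2 \<theta>) =
      vec n2 (\<lambda>i. primitive a (primitive a (\<lambda>\<theta>. y \<theta> $ (n0 + n1 + i))) s)"
    unfolding vec_integral_def using primitive_primitive[OF comp_integrable[OF y] s, of "n0 + n1 + _"]
    by (intro eq_vecI) auto
  also have "vec_integral a s n1 ?y1 = vec n1 (\<lambda>i. primitive a (\<lambda>\<theta>. y \<theta> $ (n0 + i)) s)"
    by (auto simp: vec_integral_def primitive_def)
  finally show "vec_integral a s n (\<lambda>\<theta>. E1 s \<theta> *\<^sub>v y \<theta>) = 0\<^sub>v n0 @\<^sub>v
       vec n1 (\<lambda>i. primitive a (\<lambda>\<theta>. y \<theta> $ (n0 + i)) s) @\<^sub>v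
       vec n2 (\<lambda>i. primitive a (primitive a (\<lambda>\<theta>. y \<theta> $ (n0 + n1 + i))) s)"
    by (simp add: vec_integral_zero)
qed

lemma E4_integral:
  assumes y: "y \<in> L2 a b n" and s: "s \<in> {a..b}"
  shows "vec_integrable a s (n1 + n2) (\<lambda>\<theta>. E4 \<theta> *\<^sub>v y \<theta>)"
    "vec_integral a s (n1 + n2) (\<lambda>\<theta>. E4 \<theta> *\<^sub>v y \<theta>) = 0\<^sub>v n1 @\<^sub>v
       vec n2 (\<lambda>i. primitive a (\<lambda>\<theta>. y \<theta> $ (n0 + n1 + i)) s)"
proof -
  let ?y2 = "\<lambda>\<theta>. slice (n0 + n1) n2 (y \<theta>)"
  let ?f = "\<lambda>\<theta>. 0\<^sub>v n1 @\<^sub>v ?y2 \<theta>"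
  have eq: "E4 \<theta> *\<^sub>v y \<theta> = ?f \<theta>" if "\<theta> \<in> {a..s}" for \<theta>
  proof -
    have "\<theta> \<in> {a..b}" using that s by auto
    show ?thesis
      by (subst y_slices[OF y \<open>\<theta> \<in> {a..b}\<close>]) (simp add: E4_def block_mult_vec)
  qed
  have sub: "{a..s} \<subseteq> {a..b}" using s by auto
  note i = vec_integrable_subinterval[OF vec_integrable_slice[OF y, of "n0 + n1" n2, simplified] sub]
    vec_integrable_zero[of a s]
  have "vec_integrable a s (n1 + n2) ?f" by (intro vec_integrable_append i)
  thus "vec_integrable a s (n1 + n2) (\<lambda>\<theta>. E4 \<theta> *\<^sub>v y \<theta>)"
    by (rule vec_integrable_cong) (simp add: eq)
  have "vec_integral a s (n1 + n2) (\<lambda>\<theta>. E4 \<theta> *\<^sub>v y \<theta>) = vec_integral a s (n1 + n2) ?f"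
    by (rule vec_integral_cong) (rule eq)
  also have "\<dots> = vec_integral a s n1 (\<lambda>\<theta>. 0\<^sub>v n1) @\<^sub>v vec_integral a s n2 ?y2"
    by (rule vec_integral_append; intro i)
  also have "vec_integral a s n2 ?y2 = vec n2 (\<lambda>i. primitive a (\<lambda>\<theta>. y \<theta> $ (n0 + n1 + i)) s)"
    by (auto simp: vec_integral_def primitive_def)
  finally show "vec_integral a s (n1 + n2) (\<lambda>\<theta>. E4 \<theta> *\<^sub>v y \<theta>) = 0\<^sub>v n1 @\<^sub>v
       vec n2 (\<lambda>i. primitive a (\<lambda>\<theta>. y \<theta> $ (n0 + n1 + i)) s)"
    by (simp add: vec_integral_zero)
qed

lemma G_kernels:
  "G2 a b n0 n1 n2 B s \<theta> = - (K_mat a n0 n1 n2 s * W * B * Q_mat b n0 n1 n2 \<theta>)"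
  "G1 a b n0 n1 n2 B s \<theta> = E1 s \<theta> + - (K_mat a n0 n1 n2 s * W * B * Q_mat b n0 n1 n2 \<theta>)"
  "G5 a b n0 n1 n2 B s \<theta> = - (V_mat n1 n2 * W * B * Q_mat b n0 n1 n2 \<theta>)"
  "G4 a b n0 n1 n2 B s \<theta> = E4 \<theta> + - (V_mat n1 n2 * W * B * Q_mat b n0 n1 n2 \<theta>)"
  by (simp_all add: G1_def G2_def G4_def G5_def E1_def E4_def)

text \<open>The operator that sends y to (x1_s, x2_s).\<close>

definition R_op :: "(real \<Rightarrow> real vec) \<Rightarrow> real \<Rightarrow> real vec" where
  "R_op = PI_op a b (n1 + n2) (G3 n0 n1 n2) (G4 a b n0 n1 n2 B) (G5 a b n0 n1 n2 B)"

lemma G0_mult: "dim_vec v = n \<Longrightarrow> G0 n0 n1 n2 s *\<^sub>v v = slice 0 n0 v @\<^sub>v 0\<^sub>v n1 @\<^sub>v 0\<^sub>v n2"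
  by (subst append_slices[of v n0 n1 n2, symmetric]) (simp_all add: G0_def block_mult_vec slice_append3)

lemma G3_mult: "dim_vec v = n \<Longrightarrow> G3 n0 n1 n2 s *\<^sub>v v = slice n0 n1 v @\<^sub>v 0\<^sub>v n2"
  by (subst append_slices[of v n0 n1 n2, symmetric]) (simp_all add: G3_def block_mult_vec slice_append3)

lemma add_append3:
  fixes u :: "real vec"
  assumes "dim_vec u = dim_vec u'" "dim_vec v = dim_vec v'" "dim_vec w = dim_vec w'"
  shows "(u @\<^sub>v v @\<^sub>v w) + (u' @\<^sub>v v' @\<^sub>v w') = (u + u') @\<^sub>v (v + v') @\<^sub>v (w + w')"
  using assms by (intro eq_vecI) auto

text \<open>Taylor's formula: the multiplier \<open>G0\<close> supplies x0, the Volterra part the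
  integral terms, and \<open>K_mat\<close> applied to \<open>bnd_coeff y\<close> the contribution of
  the values at a.\<close>

lemma T_op_eq:
  assumes y: "y \<in> L2 a b n" and s: "s \<in> {a..b}"
  shows "T_op a b n0 n1 n2 B y s = slice 0 n0 (y s) @\<^sub>v rec1 y s @\<^sub>v rec2 y s"
proof -
  note PK = PI_kernel_integral[OF y K_mat_carrier s E_carrier(1) E1_integral(1)[OF y s]]
  let ?u = "vec_integral a s n (\<lambda>\<theta>. G1 a b n0 n1 n2 B s \<theta> *\<^sub>v y \<theta>)"
  let ?v = "vec_integral s b n (\<lambda>\<theta>. G2 a b n0 n1 n2 B s \<theta> *\<^sub>v y \<theta>)"
  have "T_op a b n0 n1 n2 B y s = G0 n0 n1 n2 s *\<^sub>v y s + ?u + ?v"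
    by (simp add: T_op_def PI_op_eq)
  also have "\<dots> = G0 n0 n1 n2 s *\<^sub>v y s + (?u + ?v)"
    by (rule assoc_add_vec[of _ n]) (auto simp: G0_def intro!: carrier_vecI)
  also have "?u + ?v = vec_integral a s n (\<lambda>\<theta>. E1 s \<theta> *\<^sub>v y \<theta>) + K_mat a n0 n1 n2 s *\<^sub>v bnd_coeff y"
    unfolding G_kernels by (rule PK(3))
  also have "K_mat a n0 n1 n2 s *\<^sub>v bnd_coeff y = 0\<^sub>v n0 @\<^sub>v slice 0 n1 (bnd_coeff y) @\<^sub>v
     (slice n1 n2 (bnd_coeff y) + (s - a) \<cdot>\<^sub>v slice (n1 + n2) n2 (bnd_coeff y))"
    by (subst bnd_coeff_slices, rule K_mat_mult) simp_all
  finally show ?thesis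
    unfolding E1_integral(2)[OF y s] G0_mult[OF L2_D(2)[OF y s]]
    by (simp add: add_append3) (auto intro!: append_vec_cong3 simp: rec1_def rec2_def)
qed

text \<open>The block x1_s is itself a component of y and carries no constant; \<open>V_mat\<close>
  picks the constant x2_s(a) for the other block.\<close>

lemma R_op_eq:
  assumes y: "y \<in> L2 a b n" and s: "s \<in> {a..b}"
  shows "R_op y s = slice n0 n1 (y s) @\<^sub>v rec2s y s"
proof -
  note PK = PI_kernel_integral[OF y V_mat_carrier s E_carrier(2) E4_integral(1)[OF y s]]
  let ?u = "vec_integral a s (n1 + n2) (\<lambda>\<theta>. G4 a b n0 n1 n2 B s \<theta> *\<^sub>v y \<theta>)"
  let ?v = "vec_integral s b (n1 + n2) (\<lambda>\<theta>. G5 a b n0 n1 n2 B s \<theta> *\<^sub>v y \<theta>)"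
  have "R_op y s = G3 n0 n1 n2 s *\<^sub>v y s + ?u + ?v"
    by (simp add: R_op_def PI_op_eq)
  also have "\<dots> = G3 n0 n1 n2 s *\<^sub>v y s + (?u + ?v)"
    by (rule assoc_add_vec[of _ "n1 + n2"]) (auto simp: G3_def intro!: carrier_vecI)
  also have "?u + ?v = vec_integral a s (n1 + n2) (\<lambda>\<theta>. E4 \<theta> *\<^sub>v y \<theta>) + V_mat n1 n2 *\<^sub>v bnd_coeff y"
    unfolding G_kernels by (rule PK(3))
  also have "V_mat n1 n2 *\<^sub>v bnd_coeff y = 0\<^sub>v n1 @\<^sub>v slice (n1 + n2) n2 (bnd_coeff y)"
    by (subst bnd_coeff_slices, rule V_mat_mult) simp_all
  finally show ?thesis
    unfolding E4_integral(2)[OF y s] G3_mult[OF L2_D(2)[OF y s]]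
    by (intro eq_vecI) (auto simp: rec2s_def)
qed

text \<open>Each of \<open>H0\<close>, \<open>H1\<close>, \<open>H2\<close> combines the kernels of
  \<open>T_op\<close> and \<open>R_op\<close> with the left factors A0(s) and A1(s), while A2(s)
  enters only through the multiplier. As s is fixed during the integration over \<theta>, these
  factors come out of the integrals.\<close>

lemma A_op_eq:
  assumes y: "y \<in> L2 a b n" and s: "s \<in> {a..b}"
    and A0: "A0 s \<in> carrier_mat n n" and A1: "A1 s \<in> carrier_mat n (n1 + n2)" and A2: "A2 s \<in> carrier_mat n n2"
  shows "A_op a b n0 n1 n2 B A0 A1 A2 y s = A0 s *\<^sub>v T_op a b n0 n1 n2 B y s + A1 s *\<^sub>v R_op y s
    + A2 s *\<^sub>v slice (n0 + n1) n2 (y s)"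
proof -
  let ?G1 = "G1 a b n0 n1 n2 B s" and ?G2 = "G2 a b n0 n1 n2 B s"
  let ?G4 = "G4 a b n0 n1 n2 B s" and ?G5 = "G5 a b n0 n1 n2 B s"
  have PT: "vec_integrable a s n (\<lambda>\<theta>. ?G1 \<theta> *\<^sub>v y \<theta>)" "vec_integrable s b n (\<lambda>\<theta>. ?G2 \<theta> *\<^sub>v y \<theta>)"
    unfolding G_kernels
    by (rule PI_kernel_integral(1,2)[OF y K_mat_carrier s E_carrier(1) E1_integral(1)[OF y s]])+
  have PR: "vec_integrable a s (n1 + n2) (\<lambda>\<theta>. ?G4 \<theta> *\<^sub>v y \<theta>)" "vec_integrable s b (n1 +
      n2) (\<lambda>\<theta>. ?G5 \<theta> *\<^sub>v y \<theta>)"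
    unfolding G_kernels
    by (rule PI_kernel_integral(1,2)[OF y V_mat_carrier s E_carrier(2) E4_integral(1)[OF y s]])+
  have split: "(A0 s * F + A1 s * F') *\<^sub>v v = A0 s *\<^sub>v (F *\<^sub>v v) + A1 s *\<^sub>v (F' *\<^sub>v v)"
    if "F \<in> carrier_mat n n" "F' \<in> carrier_mat (n1 + n2) n" "v \<in> carrier_vec n" for F F' v
    using add_mult_distrib_mat_vec[OF mult_carrier_mat[OF A0 that(1)] mult_carrier_mat[OF A1 that(2)] that(3)]
      assoc_mult_mat_vec[OF A0 that(1,3)] assoc_mult_mat_vec[OF A1 that(2,3)] by simp
  have carrier: "?G1 \<theta> \<in> carrier_mat n n" "?G2 \<theta> \<in> carrier_mat n n" "?G4 \<theta> \<in> carrier_mat (n1 + n2) n"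
    "?G5 \<theta> \<in> carrier_mat (n1 + n2) n" for \<theta>
    using Q_mat_carrier[of b n0 n1 n2 \<theta>] V_mat_carrier[of n1 n2] K_mat_carrier[of a n0 n1 n2 s] E_carrier
    unfolding G_kernels by (auto intro!: carrier_matI)
  have integral_split: "vec_integral c d n (\<lambda>\<theta>. (A0 s * F \<theta> + A1 s * F' \<theta>) *\<^sub>v y \<theta>) =
      A0 s *\<^sub>v vec_integral c d n (\<lambda>\<theta>. F \<theta> *\<^sub>v y \<theta>) +
          A1 s *\<^sub>v vec_integral c d (n1 + n2) (\<lambda>\<theta>. F' \<theta> *\<^sub>v y \<theta>)"
    if "vec_integrable c d n (\<lambda>\<theta>. F \<theta> *\<^sub>v y \<theta>)" "vec_integrable c d (n1 +
        n2) (\<lambda>\<theta>. F' \<theta> *\<^sub>v y \<theta>)"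
      "\<And>\<theta>. F \<theta> \<in> carrier_mat n n" "\<And>\<theta>. F' \<theta> \<in> carrier_mat (n1 +
          n2) n" "{c..d} \<subseteq> {a..b}" for c d F F'
  proof -
    have "vec_integral c d n (\<lambda>\<theta>. (A0 s * F \<theta> + A1 s * F' \<theta>) *\<^sub>v y \<theta>) =
      vec_integral c d n (\<lambda>\<theta>. A0 s *\<^sub>v (F \<theta> *\<^sub>v y \<theta>) + A1 s *\<^sub>v (F' \<theta> *\<^sub>v y \<theta>))"
      using that(5) by (intro vec_integral_cong split that(3,4) L2_D(1)[OF y]) auto
    also have "\<dots> = vec_integral c d n (\<lambda>\<theta>. A0 s *\<^sub>v (F \<theta> *\<^sub>v y \<theta>)) +
        vec_integral c d n (\<lambda>\<theta>. A1 s *\<^sub>v (F' \<theta> *\<^sub>v y \<theta>))"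
      by (intro vec_integral_add vec_integrable_mult[OF that(1) A0] vec_integrable_mult[OF that(2) A1])
    finally show ?thesis
      unfolding vec_integral_mult[OF that(1) A0] vec_integral_mult[OF that(2) A1] .
  qed
  let ?t0 = "G0 n0 n1 n2 s *\<^sub>v y s" and ?r0 = "G3 n0 n1 n2 s *\<^sub>v y s"
  let ?t1 = "vec_integral a s n (\<lambda>\<theta>. ?G1 \<theta> *\<^sub>v y \<theta>)" and ?t2 =
      "vec_integral s b n (\<lambda>\<theta>. ?G2 \<theta> *\<^sub>v y \<theta>)"
  let ?r1 = "vec_integral a s (n1 + n2) (\<lambda>\<theta>. ?G4 \<theta> *\<^sub>v y \<theta>)" and ?r2 = "vec_integral s b (n1 +
      n2) (\<lambda>\<theta>. ?G5 \<theta> *\<^sub>v y \<theta>)"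
  have yc: "y s \<in> carrier_vec n" using L2_D(1)[OF y s] .
  have G0c: "G0 n0 n1 n2 s \<in> carrier_mat n n" and G3c: "G3 n0 n1 n2 s \<in> carrier_mat (n1 + n2) n"
    by (intro carrier_matI; simp add: G0_def G3_def)+
  let ?A2 = "0\<^sub>m n n0 @\<^sub>c 0\<^sub>m n n1 @\<^sub>c A2 s"
  have A2c: "?A2 \<in> carrier_mat n n" using A2 by (intro carrier_matI) auto
  have A2y: "?A2 *\<^sub>v y s = A2 s *\<^sub>v slice (n0 + n1) n2 (y s)"
    using A2 by (subst y_slices[OF y s]) (simp add: block_mult_vec slice_append3)
  have H0: "H0 n0 n1 n2 A0 A1 A2 s *\<^sub>v y s = A0 s *\<^sub>v ?t0 + A1 s *\<^sub>v ?r0 + A2 s *\<^sub>v slice (n0 + n1) n2 (y s)"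
    unfolding H0_def A2y[symmetric] split[OF G0c G3c yc, symmetric]
    by (rule add_mult_distrib_mat_vec[OF _ A2c yc])
       (intro add_carrier_mat mult_carrier_mat[OF A0 G0c] mult_carrier_mat[OF A1 G3c])
  have I1: "vec_integral a s n (\<lambda>\<theta>. H1 a b n0 n1 n2 B A0 A1 s \<theta> *\<^sub>v y \<theta>) = A0 s *\<^sub>v ?t1 + A1 s *\<^sub>v ?r1"
    unfolding H1_def using s by (intro integral_split PT(1) PR(1) carrier) auto
  have I2: "vec_integral s b n (\<lambda>\<theta>. H2 a b n0 n1 n2 B A0 A1 s \<theta> *\<^sub>v y \<theta>) = A0 s *\<^sub>v ?t2 + A1 s *\<^sub>v ?r2"
    unfolding H2_def using s by (intro integral_split PT(2) PR(2) carrier) auto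
  have c: "?t0 \<in> carrier_vec n" "?t1 \<in> carrier_vec n" "?t2 \<in> carrier_vec n"
    "?r0 \<in> carrier_vec (n1 + n2)" "?r1 \<in> carrier_vec (n1 + n2)" "?r2 \<in> carrier_vec (n1 + n2)"
    using G0c G3c by (auto intro!: carrier_vecI)
  have T: "A0 s *\<^sub>v T_op a b n0 n1 n2 B y s = A0 s *\<^sub>v ?t0 + A0 s *\<^sub>v ?t1 + A0 s *\<^sub>v ?t2"
    unfolding T_op_def PI_op_eq
    using mult_add_distrib_mat_vec[OF A0 c(1,2)] mult_add_distrib_mat_vec[OF A0 add_carrier_vec[OF c(1,2)] c(3)] by simp
  have R: "A1 s *\<^sub>v R_op y s = A1 s *\<^sub>v ?r0 + A1 s *\<^sub>v ?r1 + A1 s *\<^sub>v ?r2"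
    unfolding R_op_def PI_op_eq
    using mult_add_distrib_mat_vec[OF A1 c(4,5)] mult_add_distrib_mat_vec[OF A1 add_carrier_vec[OF c(4,5)] c(6)] by simp
  have "A_op a b n0 n1 n2 B A0 A1 A2 y s = (A0 s *\<^sub>v ?t0 + A1 s *\<^sub>v ?r0 + A2 s *\<^sub>v slice (n0 + n1) n2 (y s))
     + (A0 s *\<^sub>v ?t1 + A1 s *\<^sub>v ?r1) + (A0 s *\<^sub>v ?t2 + A1 s *\<^sub>v ?r2)"
    unfolding A_op_def PI_op_eq H0 I1 I2 ..
  also have "\<dots> = (A0 s *\<^sub>v ?t0 + A0 s *\<^sub>v ?t1 + A0 s *\<^sub>v ?t2) + (A1 s *\<^sub>v ?r0 + A1 s *\<^sub>v ?r1 + A1 s *\<^sub>v ?r2)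
     + A2 s *\<^sub>v slice (n0 + n1) n2 (y s)"
    using A0 A1 A2 by (intro eq_vecI) (simp_all del: index_mult_mat_vec)
  finally show ?thesis unfolding T R .
qed

end

section \<open>Bounds for primitives and matrix products; norms of equivalent states\<close>

lemma primitive_const:
  assumes "a \<le> s" shows "primitive a (\<lambda>_. c) s = c * (s - a)"
  using assms by (simp add: primitive_def measure_restrict_space lebesgue_integral_const)

lemma primitive_cong:
  "s \<in> {a..b} \<Longrightarrow> (\<And>\<theta>. \<theta> \<in> {a..b} \<Longrightarrow> f \<theta> = g \<theta>) \<Longrightarrow>
      primitive a f s = primitive a g s"
  unfolding primitive_def by (intro Bochner_Integration.integral_cong) auto

lemma primitive_add:
  assumes "integrable (lebesgue_on {a..b}) f" "integrable (lebesgue_on {a..b}) g" "s \<in> {a..b}"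
  shows "primitive a (\<lambda>\<theta>. f \<theta> + g \<theta>) s = primitive a f s + primitive a g s"
proof -
  have "integrable (lebesgue_on {a..s}) f" "integrable (lebesgue_on {a..s}) g"
    using assms(3) by (intro integrable_subinterval[OF assms(1)] integrable_subinterval[OF assms(2)]; auto)+
  thus ?thesis by (simp add: primitive_def)
qed

lemma primitive_bounded:
  assumes f: "continuous_on {a..b} f" and D: "\<And>r. r \<in> {a..b} \<Longrightarrow> \<bar>f r\<bar> \<le> D" and s: "s \<in> {a..b}"
  shows "\<bar>primitive a f s\<bar> \<le> D * (b - a)"
proof -
  have "D \<ge> 0" using D[OF s] by simp
  have sub: "{a..s} \<subseteq> {a..b}" using s by auto
  have i: "integrable (lebesgue_on {a..s}) f"
    by (rule integrable_continuous_interval[OF continuous_on_subset[OF f sub]])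
  have "\<bar>primitive a f s\<bar> \<le> (LINT r|lebesgue_on {a..s}. \<bar>f r\<bar>)"
    unfolding primitive_def by (rule integral_abs_bound)
  also have "\<dots> \<le> (LINT r|lebesgue_on {a..s}. D)"
    using D sub
    by (intro integral_mono[OF integrable_abs[OF i] integrable_continuous_interval[OF continuous_on_const]]) auto
  also have "\<dots> = D * (s - a)" using primitive_const[of a s D] s by (simp add: primitive_def)
  also have "\<dots> \<le> D * (b - a)" using s \<open>D \<ge> 0\<close> by (intro mult_left_mono) auto
  finally show ?thesis .
qed

lemma mult_vec_bounded:
  fixes A :: "real mat"
  assumes A: "A \<in> carrier_mat nr nc"
  shows "\<exists>C\<ge>0. \<forall>v M j. v \<in> carrier_vec nc \<longrightarrow> (\<forall>i<nc. \<bar>v $ i\<bar> \<le> M) \<longrightarrow> 0 \<le> M \<longrightarrow> j < nr \<longrightarrow>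
    \<bar>(A *\<^sub>v v) $ j\<bar> \<le> C * M"
proof -
  \<comment> \<open>Summing the absolute values of all entries gives one constant that serves every
    row j.\<close>
  define C where "C = (\<Sum>j<nr. \<Sum>i<nc. \<bar>A $$ (j, i)\<bar>)"
  have C: "C \<ge> 0" unfolding C_def by (intro sum_nonneg) auto
  have bound: "\<bar>(A *\<^sub>v v) $ j\<bar> \<le> C * M"
    if v: "v \<in> carrier_vec nc" and M: "\<forall>i<nc. \<bar>v $ i\<bar> \<le> M" "0 \<le> M" and j: "j < nr" for v M j
  proof -
    have "(A *\<^sub>v v) $ j = (\<Sum>i<nc. A $$ (j, i) * v $ i)"
      using A v j by (simp add: scalar_prod_def lessThan_atLeast0)
    also have "\<bar>\<dots>\<bar> \<le> (\<Sum>i<nc. \<bar>A $$ (j, i) * v $ i\<bar>)" by (rule sum_abs)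
    also have "\<dots> \<le> (\<Sum>i<nc. \<bar>A $$ (j, i)\<bar> * M)"
      using M by (intro sum_mono) (auto simp: abs_mult intro: mult_left_mono)
    also have "\<dots> = (\<Sum>i<nc. \<bar>A $$ (j, i)\<bar>) * M" by (simp add: sum_distrib_right)
    also have "\<dots> \<le> C * M"
      unfolding C_def using j M(2)
      by (intro mult_right_mono member_le_sum[of j "{..<nr}" "\<lambda>j. \<Sum>i<nc. \<bar>A $$ (j, i)\<bar>"]) (auto intro: sum_nonneg)
    finally show ?thesis .
  qed
  with C show ?thesis by blast
qed

lemma state_eq_ae_iff:
  "state_eq_ae a b x y \<longleftrightarrow> eq_ae a b (fst x) (fst y) \<and> eq_ae a b (fst (snd x)) (fst (snd y)) \<and>
     eq_ae a b (snd (snd x)) (snd (snd y))"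
  by (cases x; cases y) auto

lemma state_vec_eq_ae:
  assumes "state_eq_ae a b x y" shows "eq_ae a b (state_vec x) (state_vec y)"
proof -
  obtain x0 x1 x2 y0 y1 y2 where xy: "x = (x0, x1, x2)" "y = (y0, y1, y2)"
    by (metis surj_pair)
  have "AE s in lebesgue_on {a..b}. x0 s = y0 s" "AE s in lebesgue_on {a..b}. x1 s = y1 s"
    "AE s in lebesgue_on {a..b}. x2 s = y2 s"
    using assms by (auto simp: xy eq_ae_def)
  thus ?thesis unfolding eq_ae_def xy by eventually_elim simp
qed

lemma state_norm_cong:
  assumes "fst x \<in> L2 a b n0" "fst (snd x) \<in> L2 a b n1" "snd (snd x) \<in> L2 a b n2"
    "fst y \<in> L2 a b n0" "fst (snd y) \<in> L2 a b n1" "snd (snd y) \<in> L2 a b n2"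
    and "state_eq_ae a b x y"
  shows "state_norm a b n0 n1 n2 x = state_norm a b n0 n1 n2 y"
proof -
  obtain x0 x1 x2 y0 y1 y2 where xy: "x = (x0, x1, x2)" "y = (y0, y1, y2)"
    by (metis surj_pair)
  show ?thesis
    using assms L2_norm_cong[of x0 a b n0 y0] sobolev_norm_cong[of x1 a b n1 y1]
      sobolev_norm_cong[of x2 a b n2 y2] by (simp add: xy)
qed

lemma sobolev_norm_nonneg [simp]: "0 \<le> sobolev_norm a b k m f"
  unfolding sobolev_norm_def by (intro real_sqrt_ge_zero sum_nonneg) auto

lemma L2_norm_le_sobolev:
  assumes "i \<le> k"
  shows "L2_norm a b ((wderiv a b m ^^ i) f) \<le> sobolev_norm a b k m f"
proof -
  have "(L2_norm a b ((wderiv a b m ^^ i) f))\<^sup>2 \<le> (\<Sum>i\<le>k. (L2_norm a b ((wderiv a b m ^^ i) f))\<^sup>2)"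
    using assms by (intro member_le_sum) auto
  thus ?thesis unfolding sobolev_norm_def by (rule real_le_rsqrt)
qed

lemma sobolev_norm_le_sum:
  assumes "\<And>i. i \<le> k \<Longrightarrow> 0 \<le> L2_norm a b ((wderiv a b m ^^ i) f)"
  shows "sobolev_norm a b k m f \<le> (\<Sum>i\<le>k. L2_norm a b ((wderiv a b m ^^ i) f))"
  using L2_set_le_sum[of "{..k}" "\<lambda>i. L2_norm a b ((wderiv a b m ^^ i) f)"] assms
  by (simp add: sobolev_norm_def L2_set_def)

section \<open>Regularity and boundary values of reconstructed states\<close>

context boundary_problem
begin

lemma rec_L2:
  assumes y: "y \<in> L2 a b n"
  shows "(\<lambda>s. slice 0 n0 (y s)) \<in> L2 a b n0" "(\<lambda>s. slice n0 n1 (y s)) \<in> L2 a b n1"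
    "(\<lambda>s. slice (n0 + n1) n2 (y s)) \<in> L2 a b n2"
    "rec1 y \<in> L2 a b n1" "rec2s y \<in> L2 a b n2" "rec2 y \<in> L2 a b n2"
proof -
  show "(\<lambda>s. slice 0 n0 (y s)) \<in> L2 a b n0" "(\<lambda>s. slice n0 n1 (y s)) \<in> L2 a b n1"
    "(\<lambda>s. slice (n0 + n1) n2 (y s)) \<in> L2 a b n2"
    using L2_D(3)[OF y] unfolding slice_def by (auto intro!: L2_vecI)
  show "rec1 y \<in> L2 a b n1" "rec2s y \<in> L2 a b n2" "rec2 y \<in> L2 a b n2"
    unfolding rec1_def rec2s_def rec2_def
    by (intro L2_vecI sq_int_continuous continuous_intros primitive_continuous
        integrable_continuous_interval comp_integrable[OF y]; simp)+
qed

lemma rec_continuous: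
  assumes y: "y \<in> L2 a b n"
  shows "i < n1 \<Longrightarrow> continuous_on {a..b} (\<lambda>s. rec1 y s $ i)"
    "i < n2 \<Longrightarrow> continuous_on {a..b} (\<lambda>s. rec2 y s $ i)"
    "i < n2 \<Longrightarrow> continuous_on {a..b} (\<lambda>s. rec2s y s $ i)"
  unfolding rec1_def rec2s_def rec2_def
  by (simp, intro continuous_intros primitive_continuous
        integrable_continuous_interval comp_integrable[OF y]; simp)+

text \<open>The affine term is the primitive of the constant x2_s(a). In this form
  \<open>weak_deriv_primitive\<close> applies to \<open>rec2\<close> with derivative
  \<open>rec2s\<close>.\<close>

lemma rec2_eq_primitive:
  assumes y: "y \<in> L2 a b n" and s: "s \<in> {a..b}" and i: "i < n2"
  shows "rec2 y s $ i = bnd_coeff y $ (n1 + i) + primitive a (\<lambda>r. rec2s y r $ i) s"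
proof -
  have c: "continuous_on {a..b} (primitive a (\<lambda>\<theta>. y \<theta> $ (n0 + n1 + i)))"
    using i by (intro primitive_continuous comp_integrable[OF y]) simp
  have "primitive a (\<lambda>r. rec2s y r $ i) s = primitive a (\<lambda>r. bnd_coeff y $ (n1 + n2 + i)) s
      + primitive a (primitive a (\<lambda>\<theta>. y \<theta> $ (n0 + n1 + i))) s"
    unfolding rec2s_def using i
    by (simp, intro primitive_add[OF _ _ s] integrable_continuous_interval continuous_intros c)
  thus ?thesis using i s by (simp add: rec2_def primitive_const mult.commute)
qed

lemma rec_weak_deriv:
  assumes y: "y \<in> L2 a b n"
  shows "is_weak_deriv a b n1 (rec1 y) (\<lambda>s. slice n0 n1 (y s))"
    "is_weak_deriv a b n2 (rec2 y) (rec2s y)"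
    "is_weak_deriv a b n2 (rec2s y) (\<lambda>s. slice (n0 + n1) n2 (y s))"
proof -
  note m = rec_continuous[OF y, THEN continuous_measurable_interval]
  show "is_weak_deriv a b n1 (rec1 y) (\<lambda>s. slice n0 n1 (y s))"
    unfolding is_weak_deriv_iff
  proof (intro allI impI)
    fix i assume i: "i < n1"
    show "weak_deriv a b (\<lambda>s. rec1 y s $ i) (\<lambda>s. slice n0 n1 (y s) $ i)"
      using i m(1)[OF i] comp_integrable[OF y, of "n0 + i"] ab
      by (intro weak_deriv_primitive[where c = "bnd_coeff y $ i"]) (auto simp: rec1_def)
  qed
  show "is_weak_deriv a b n2 (rec2s y) (\<lambda>s. slice (n0 + n1) n2 (y s))"
    unfolding is_weak_deriv_iff
  proof (intro allI impI)
    fix i assume i: "i < n2"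
    show "weak_deriv a b (\<lambda>s. rec2s y s $ i) (\<lambda>s. slice (n0 + n1) n2 (y s) $ i)"
      using i m(3)[OF i] comp_integrable[OF y, of "n0 + n1 + i"] ab
      by (intro weak_deriv_primitive[where c = "bnd_coeff y $ (n1 + n2 + i)"]) (auto simp: rec2s_def)
  qed
  show "is_weak_deriv a b n2 (rec2 y) (rec2s y)"
    unfolding is_weak_deriv_iff
  proof (intro allI impI)
    fix i assume i: "i < n2"
    show "weak_deriv a b (\<lambda>s. rec2 y s $ i) (\<lambda>s. rec2s y s $ i)"
    proof (rule weak_deriv_primitive[where c = "bnd_coeff y $ (n1 + i)"])
      show "AE s in lebesgue_on {a..b}. rec2 y s $ i = bnd_coeff y $ (n1 + i) + primitive a (\<lambda>r. rec2s y r $ i) s"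
        by (intro AE_I2 rec2_eq_primitive[OF y _ i]) simp
    qed (use m(2)[OF i] rec_continuous(3)[OF y i] ab in \<open>auto intro: integrable_continuous_interval\<close>)
  qed
qed

lemma rec_wderiv:
  assumes y: "y \<in> L2 a b n"
  shows "wderiv a b n1 (rec1 y) \<in> L2 a b n1" "eq_ae a b (wderiv a b n1 (rec1 y)) (\<lambda>s. slice n0 n1 (y s))"
    "wderiv a b n2 (rec2 y) \<in> L2 a b n2" "eq_ae a b (wderiv a b n2 (rec2 y)) (rec2s y)"
    "wderiv a b n2 (wderiv a b n2 (rec2 y)) \<in> L2 a b n2"
    "eq_ae a b (wderiv a b n2 (wderiv a b n2 (rec2 y))) (\<lambda>s. slice (n0 + n1) n2 (y s))"
proof -
  note L = rec_L2[OF y] and W = rec_weak_deriv[OF y]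
  show "wderiv a b n1 (rec1 y) \<in> L2 a b n1" "eq_ae a b (wderiv a b n1 (rec1 y)) (\<lambda>s. slice n0 n1 (y s))"
    using wderiv_eq[OF L(4,2) W(1) ab] .
  show "wderiv a b n2 (rec2 y) \<in> L2 a b n2" "eq_ae a b (wderiv a b n2 (rec2 y)) (rec2s y)"
    using wderiv_eq[OF L(6,5) W(2) ab] .
  show "wderiv a b n2 (wderiv a b n2 (rec2 y)) \<in> L2 a b n2"
    "eq_ae a b (wderiv a b n2 (wderiv a b n2 (rec2 y))) (\<lambda>s. slice (n0 + n1) n2 (y s))"
    using wderiv_wderiv_eq(1,2)[OF L(6,5,3) W(2,3) ab] .
qed

text \<open>Stated for an arbitrary constant vector c because it has two uses: for a reconstructed
  state, where c is \<open>bnd_coeff y\<close>, and for a given state of X, where c is still to be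
  identified. The function \<open>x2s\<close> is separate so that any representative of the
  derivative of x2 is allowed.\<close>

lemma bnd_values:
  assumes "dim_vec c = n1 + 2 * n2"
    and "\<And>i. i < n1 \<Longrightarrow> AE s in lebesgue_on {a..b}. x1 s $ i = c $ i + primitive a (\<lambda>\<theta>. y \<theta> $ (n0 + i)) s"
    and "\<And>i. i < n2 \<Longrightarrow> AE s in lebesgue_on {a..b}. x2 s $ i = c $ (n1 + i) + (s - a) * c $ (n1 + n2 + i) +
       primitive a (primitive a (\<lambda>\<theta>. y \<theta> $ (n0 + n1 + i))) s"
    and "\<And>i. i < n2 \<Longrightarrow> AE s in lebesgue_on {a..b}. x2s s $ i = c $ (n1 + n2 + i) +
        primitive a (\<lambda>\<theta>. y \<theta> $ (n0 + n1 + i)) s"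
    and y: "y \<in> L2 a b n"
  shows "point_val a b n1 x1 a @\<^sub>v point_val a b n1 x1 b @\<^sub>v point_val a b n2 x2 a @\<^sub>v point_val a b n2 x2 b @\<^sub>v
     point_val a b n2 x2s a @\<^sub>v point_val a b n2 x2s b = T_mat a b n1 n2 *\<^sub>v c + bnd_integral y"
proof -
  have p1: "point_val a b n1 x1 p = vec n1 (\<lambda>i. c $ i + primitive a (\<lambda>\<theta>. y \<theta> $ (n0 + i)) p)"
    if "p \<in> {a..b}" for p
    using ab that by (intro point_val_eq assms(2) continuous_intros primitive_continuous comp_integrable[OF y]) auto
  have p2: "point_val a b n2 x2 p = vec n2 (\<lambda>i. c $ (n1 + i) + (p - a) * c $ (n1 + n2 + i) +
       primitive a (primitive a (\<lambda>\<theta>. y \<theta> $ (n0 + n1 + i))) p)"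
    if "p \<in> {a..b}" for p
    using ab that by (intro point_val_eq assms(3) continuous_intros primitive_continuous
        integrable_continuous_interval comp_integrable[OF y]) auto
  have p3: "point_val a b n2 x2s p = vec n2 (\<lambda>i. c $ (n1 + n2 + i) + primitive a (\<lambda>\<theta>. y \<theta> $ (n0 + n1 + i)) p)"
    if "p \<in> {a..b}" for p
    using ab that by (intro point_val_eq assms(4) continuous_intros primitive_continuous comp_integrable[OF y]) auto
  have c: "c = slice 0 n1 c @\<^sub>v slice n1 n2 c @\<^sub>v slice (n1 + n2) n2 c"
    using assms(1) by (intro append_slices[symmetric]) simp
  have "T_mat a b n1 n2 *\<^sub>v c = slice 0 n1 c @\<^sub>v slice 0 n1 c @\<^sub>v slice n1 n2 c @\<^sub>v
      (slice n1 n2 c + (b - a) \<cdot>\<^sub>v slice (n1 + n2) n2 c) @\<^sub>v slice (n1 + n2) n2 c @\<^sub>v slice (n1 + n2) n2 c"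
    by (subst c, rule T_mat_mult) simp_all
  hence "T_mat a b n1 n2 *\<^sub>v c + bnd_integral y =
      slice 0 n1 c @\<^sub>v (slice 0 n1 c + vec n1 (\<lambda>i. primitive a (\<lambda>\<theta>. y \<theta> $ (n0 +
          i)) b)) @\<^sub>v slice n1 n2 c @\<^sub>v
      (slice n1 n2 c + (b - a) \<cdot>\<^sub>v slice (n1 + n2) n2 c +
          vec n2 (\<lambda>i. primitive a (primitive a (\<lambda>\<theta>. y \<theta> $ (n0 + n1 + i))) b)) @\<^sub>v
      slice (n1 + n2) n2 c @\<^sub>v (slice (n1 + n2) n2 c + vec n2 (\<lambda>i. primitive a (\<lambda>\<theta>. y \<theta> $ (n0 + n1 + i)) b))"
    unfolding bnd_integral_def by (simp add: append_vec_add[OF carrier_vecI carrier_vecI carrier_vecI carrier_vecI] zero_add_vec)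
  thus ?thesis using ab
    by (simp add: p1 p2 p3) (intro arg_cong2[where f = append_vec] eq_vecI; simp)
qed

lemma rec_state_in_X:
  assumes y: "y \<in> L2 a b n"
  shows "rec_state y \<in> X_space a b n0 n1 n2 B"
proof -
  note L = rec_L2[OF y] and W = rec_weak_deriv[OF y]
  have "point_val a b n1 (rec1 y) a @\<^sub>v point_val a b n1 (rec1 y) b @\<^sub>v
     point_val a b n2 (rec2 y) a @\<^sub>v point_val a b n2 (rec2 y) b @\<^sub>v
     point_val a b n2 (wderiv a b n2 (rec2 y)) a @\<^sub>v point_val a b n2 (wderiv a b n2 (rec2 y)) b =
     T_mat a b n1 n2 *\<^sub>v bnd_coeff y + bnd_integral y"
  proof (rule bnd_values)
    fix i assume i: "i < n2"
    \<comment> \<open>The boundary condition refers to the chosen derivative of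
      \<open>rec2 y\<close>, which equals \<open>rec2s y\<close> only almost everywhere.\<close>
    show "AE s in lebesgue_on {a..b}. wderiv a b n2 (rec2 y) s $ i =
        bnd_coeff y $ (n1 + n2 + i) + primitive a (\<lambda>\<theta>. y \<theta> $ (n0 + n1 + i)) s"
      using eq_ae_component[OF rec_wderiv(4)[OF y], of i] i by (simp add: rec2s_def)
  qed (use bnd_coeff_carrier[of y] y in \<open>auto simp: rec1_def rec2_def\<close>)
  moreover have "rec1 y \<in> sobolev a b 1 n1" using sobolev_1I[OF L(4,2) W(1)] .
  moreover have "rec2 y \<in> sobolev a b 2 n2" using sobolev_2I[OF L(6,5,3) W(2,3)] .
  ultimately show ?thesis
    using bnd_coeff_iff[OF bnd_coeff_carrier, of y y] L(1)
    by (simp add: X_space_def state_space_def rec_state_def del: sobolev.simps One_nat_def)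
qed

section \<open>Reconstruction and differentiation as mutual inverses\<close>

definition der_state :: "state \<Rightarrow> real \<Rightarrow> real vec" where
  "der_state x = (case x of (x0, x1, x2) \<Rightarrow> \<lambda>s. x0 s @\<^sub>v wderiv a b n1 x1 s @\<^sub>v wderiv a b n2 (wderiv a b n2 x2) s)"

lemma state_space_D:
  assumes "(x0, x1, x2) \<in> state_space a b n0 n1 n2"
  shows "x0 \<in> L2 a b n0" "x1 \<in> L2 a b n1" "x2 \<in> L2 a b n2" "x1 \<in> sobolev a b 1 n1" "x2 \<in> sobolev a b 2 n2"
  using assms subsetD[OF sobolev_subset_L2, of x1 a b 1 n1] subsetD[OF sobolev_subset_L2, of x2 a b 2 n2]
  unfolding state_space_def by (auto simp del: sobolev.simps)

lemma X_subset_state_space: "X_space a b n0 n1 n2 B \<subseteq> state_space a b n0 n1 n2"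
  by (auto simp: X_space_def)

lemma der_state_L2:
  assumes "x \<in> state_space a b n0 n1 n2"
  shows "der_state x \<in> L2 a b n"
proof -
  obtain x0 x1 x2 where x: "x = (x0, x1, x2)" by (cases x)
  note S = state_space_D[OF assms[unfolded x]]
  have "(\<lambda>s. x0 s @\<^sub>v wderiv a b n1 x1 s @\<^sub>v wderiv a b n2 (wderiv a b n2 x2) s) \<in> L2 a b (n0 + (n1 + n2))"
    by (intro L2_appendI S(1) sobolev_1D(2)[OF S(4)] sobolev_2D(3)[OF S(5) ab])
  thus ?thesis by (simp add: x der_state_def add.assoc)
qed

lemma der_state_slices:
  assumes "(x0, x1, x2) \<in> state_space a b n0 n1 n2" "s \<in> {a..b}"
  shows "slice 0 n0 (der_state (x0, x1, x2) s) = x0 s"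
    "slice n0 n1 (der_state (x0, x1, x2) s) = wderiv a b n1 x1 s"
    "slice (n0 + n1) n2 (der_state (x0, x1, x2) s) = wderiv a b n2 (wderiv a b n2 x2) s"
proof -
  note S = state_space_D[OF assms(1)]
  note d = L2_D(2)[OF S(1) assms(2)] L2_D(2)[OF sobolev_1D(2)[OF S(4)] assms(2)]
    L2_D(2)[OF sobolev_2D(3)[OF S(5) ab] assms(2)]
  show "slice 0 n0 (der_state (x0, x1, x2) s) = x0 s"
    "slice n0 n1 (der_state (x0, x1, x2) s) = wderiv a b n1 x1 s"
    "slice (n0 + n1) n2 (der_state (x0, x1, x2) s) = wderiv a b n2 (wderiv a b n2 x2) s"
    using slice_append3[OF d] by (simp_all add: der_state_def)
qed

lemma der_rec_state:
  assumes y: "y \<in> L2 a b n"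
  shows "eq_ae a b (der_state (rec_state y)) y"
proof -
  have "AE s in lebesgue_on {a..b}. wderiv a b n1 (rec1 y) s = slice n0 n1 (y s)"
    "AE s in lebesgue_on {a..b}. wderiv a b n2 (wderiv a b n2 (rec2 y)) s = slice (n0 + n1) n2 (y s)"
    using rec_wderiv(2,6)[OF y] by (simp_all add: eq_ae_def)
  moreover have "AE s in lebesgue_on {a..b}. s \<in> {a..b}" by (rule AE_I2) simp
  ultimately show ?thesis unfolding eq_ae_def
  proof eventually_elim
    case (elim s)
    thus ?case using y_slices[OF y elim(3)] by (simp add: der_state_def rec_state_def)
  qed
qed

text \<open>Integrating the weak derivatives recovers the components of x up to constants, and the
  boundary condition forces these constants to be the entries of \<open>bnd_coeff\<close>.\<close>

lemma rec_der_state: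
  assumes X: "x \<in> X_space a b n0 n1 n2 B"
  shows "state_eq_ae a b (rec_state (der_state x)) x"
proof -
  obtain x0 x1 x2 where x: "x = (x0, x1, x2)" by (cases x)
  have Sx: "(x0, x1, x2) \<in> state_space a b n0 n1 n2" using X X_subset_state_space x by blast
  note S = state_space_D[OF Sx]
  note S1 = sobolev_1D[OF S(4)] and S2 = sobolev_2D[OF S(5) ab]
  define y where "y = der_state x"
  have y: "y \<in> L2 a b n" unfolding y_def x by (rule der_state_L2[OF Sx])
  have yc: "y s $ j = (if j < n0 then x0 s $ j else if j < n0 + n1 then wderiv a b n1 x1 s $ (j - n0)
      else wderiv a b n2 (wderiv a b n2 x2) s $ (j - (n0 + n1)))" if "s \<in> {a..b}" "j < n" for s j
    using that L2_D(2)[OF S(1) that(1)] L2_D(2)[OF S1(2) that(1)] L2_D(2)[OF S2(3) that(1)]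
    by (auto simp: y_def x der_state_def diff_diff_add)
  have pc1: "primitive a (\<lambda>\<theta>. y \<theta> $ (n0 + i)) s = primitive a (\<lambda>\<theta>. wderiv a b n1 x1 \<theta> $ i) s"
    if "s \<in> {a..b}" "i < n1" for s i
    using that by (intro primitive_cong) (auto simp: yc)
  have pc2: "primitive a (\<lambda>\<theta>. y \<theta> $ (n0 + n1 +
      i)) s = primitive a (\<lambda>\<theta>. wderiv a b n2 (wderiv a b n2 x2) \<theta> $ i) s"
    if "s \<in> {a..b}" "i < n2" for s i
    using that by (intro primitive_cong) (auto simp: yc)
  have on: "AE s in lebesgue_on {a..b}. s \<in> {a..b}" by (rule AE_I2) simp
  have "\<exists>c. AE s in lebesgue_on {a..b}. x1 s $ i = c + primitive a (\<lambda>\<theta>. y \<theta> $ (n0 + i)) s" if i: "i < n1" for i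
  proof -
    have "\<exists>c. AE s in lebesgue_on {a..b}. x1 s $ i = c + primitive a (\<lambda>\<theta>. wderiv a b n1 x1 \<theta> $ i) s"
      using S1(3) i ab unfolding is_weak_deriv_iff
      by (intro weak_deriv_imp_primitive sq_int_integrable L2_D(3)[OF S1(1)] L2_D(3)[OF S1(2)]) auto
    then obtain c where "AE s in lebesgue_on {a..b}. x1 s $ i = c + primitive a (\<lambda>\<theta>. wderiv a b n1 x1 \<theta> $ i) s" ..
    hence "AE s in lebesgue_on {a..b}. x1 s $ i = c + primitive a (\<lambda>\<theta>. y \<theta> $ (n0 + i)) s"
      using on by eventually_elim (simp add: pc1 i)
    thus ?thesis ..
  qed
  then obtain c1 where c1: "\<And>i. i < n1 \<Longrightarrow> AE s in lebesgue_on {a..b}. x1 s $ i = c1 i +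
      primitive a (\<lambda>\<theta>. y \<theta> $ (n0 + i)) s"
    by metis
  \<comment> \<open>The constants of x2_s are found before those of x2, whose formula contains them
    in its affine term.\<close>
  have "\<exists>c. AE s in lebesgue_on {a..b}. wderiv a b n2 x2 s $ i = c + primitive a (\<lambda>\<theta>. y \<theta> $ (n0 +
      n1 + i)) s" if i: "i < n2" for i
  proof -
    have "\<exists>c. AE s in lebesgue_on {a..b}. wderiv a b n2 x2 s $ i = c +
        primitive a (\<lambda>\<theta>. wderiv a b n2 (wderiv a b n2 x2) \<theta> $ i) s"
      using S2(5) i ab unfolding is_weak_deriv_iff
      by (intro weak_deriv_imp_primitive sq_int_integrable L2_D(3)[OF S2(2)] L2_D(3)[OF S2(3)]) auto
    then obtain c where "AE s in lebesgue_on {a..b}. wderiv a b n2 x2 s $ i = c +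
        primitive a (\<lambda>\<theta>. wderiv a b n2 (wderiv a b n2 x2) \<theta> $ i) s" ..
    hence "AE s in lebesgue_on {a..b}. wderiv a b n2 x2 s $ i = c + primitive a (\<lambda>\<theta>. y \<theta> $ (n0 + n1 + i)) s"
      using on by eventually_elim (simp add: pc2 i)
    thus ?thesis ..
  qed
  then obtain c3 where c3: "\<And>i. i < n2 \<Longrightarrow> AE s in lebesgue_on {a..b}. wderiv a b n2 x2 s $ i = c3 i +
      primitive a (\<lambda>\<theta>. y \<theta> $ (n0 + n1 + i)) s"
    by metis
  have "\<exists>c. AE s in lebesgue_on {a..b}. x2 s $ i = c + (s - a) * c3 i +
      primitive a (primitive a (\<lambda>\<theta>. y \<theta> $ (n0 + n1 + i))) s"
    if i: "i < n2" for i
  proof -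
    let ?g = "\<lambda>s. c3 i + primitive a (\<lambda>\<theta>. y \<theta> $ (n0 + n1 + i)) s"
    have pc: "continuous_on {a..b} (primitive a (\<lambda>\<theta>. y \<theta> $ (n0 + n1 + i)))"
      using i by (intro primitive_continuous comp_integrable[OF y]) simp
    hence gc: "continuous_on {a..b} ?g" by (intro continuous_intros)
    have wd: "weak_deriv a b (\<lambda>s. x2 s $ i) (\<lambda>s. wderiv a b n2 x2 s $ i)"
      using S2(4) i unfolding is_weak_deriv_iff by simp
    \<comment> \<open>Replacing the chosen derivative by its continuous representative makes the
      second integration explicit.\<close>
    have "weak_deriv a b (\<lambda>s. x2 s $ i) ?g"
      by (rule weak_deriv_cong_AE[OF wd AE_I2[OF refl] c3[OF i] sq_int_measurable[OF L2_D(3)[OF S2(1) i]]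
            sq_int_measurable[OF L2_D(3)[OF S2(1) i]] sq_int_measurable[OF L2_D(3)[OF S2(2) i]]
            continuous_measurable_interval[OF gc]])
    hence "\<exists>c. AE s in lebesgue_on {a..b}. x2 s $ i = c + primitive a ?g s"
      using i ab by (intro weak_deriv_imp_primitive sq_int_integrable L2_D(3)[OF S2(1)] sq_int_continuous gc) auto
    then obtain c where c: "AE s in lebesgue_on {a..b}. x2 s $ i = c + primitive a ?g s" ..
    have pg: "primitive a ?g s = (s - a) * c3 i + primitive a (primitive a (\<lambda>\<theta>. y \<theta> $ (n0 + n1 + i))) s"
      if "s \<in> {a..b}" for s
    proof -
      have "primitive a ?g s = primitive a (\<lambda>_. c3 i) s + primitive a (primitive a (\<lambda>\<theta>. y \<theta> $ (n0 + n1 + i))) s"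
        by (intro primitive_add[OF _ _ that] integrable_continuous_interval continuous_on_const pc)
      thus ?thesis using that by (simp add: primitive_const)
    qed
    have "AE s in lebesgue_on {a..b}. x2 s $ i = c + (s - a) * c3 i + primitive a (primitive a (\<lambda>\<theta>. y \<theta> $ (n0 + n1 + i))) s"
      using on c by eventually_elim (simp add: pg)
    thus ?thesis ..
  qed
  note c2_ex = this
  define c2 where "c2 i = (SOME c. AE s in lebesgue_on {a..b}. x2 s $ i = c + (s - a) * c3 i +
      primitive a (primitive a (\<lambda>\<theta>. y \<theta> $ (n0 + n1 + i))) s)" for i
  have c2: "AE s in lebesgue_on {a..b}. x2 s $ i = c2 i + (s - a) * c3 i +
      primitive a (primitive a (\<lambda>\<theta>. y \<theta> $ (n0 + n1 + i))) s" if "i < n2" for i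
    unfolding c2_def by (rule someI_ex[OF c2_ex[OF that]])
  define c where "c = vec n1 c1 @\<^sub>v vec n2 c2 @\<^sub>v vec n2 c3"
  have c: "c \<in> carrier_vec (n1 + 2 * n2)" by (intro carrier_vecI) (simp add: c_def)
  have ci: "i < n1 \<Longrightarrow> c $ i = c1 i" "i < n2 \<Longrightarrow> c $ (n1 + i) = c2 i" "i < n2 \<Longrightarrow>
      c $ (n1 + n2 + i) = c3 i" for i
    by (simp_all add: c_def)
  have "point_val a b n1 x1 a @\<^sub>v point_val a b n1 x1 b @\<^sub>v point_val a b n2 x2 a @\<^sub>v point_val a b n2 x2 b @\<^sub>v
     point_val a b n2 (wderiv a b n2 x2) a @\<^sub>v point_val a b n2 (wderiv a b n2 x2) b = T_mat a b n1 n2 *\<^sub>v c + bnd_integral y"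
    by (rule bnd_values) (use c in \<open>simp_all add: ci c1 c2 c3 y\<close>)
  \<comment> \<open>All boundary values are now expressed by c and y, so membership in X is exactly
    the linear equation solved by \<open>bnd_coeff y\<close> alone.\<close>
  hence "c = bnd_coeff y" using X bnd_coeff_iff[OF c, of y] by (simp add: x X_space_def)
  hence ci: "i < n1 \<Longrightarrow> c1 i = bnd_coeff y $ i" "i < n2 \<Longrightarrow> c2 i = bnd_coeff y $ (n1 + i)"
    "i < n2 \<Longrightarrow> c3 i = bnd_coeff y $ (n1 + n2 + i)" for i
    using ci by auto
  have "eq_ae a b (rec1 y) x1"
  proof (rule eq_ae_componentsI)
    fix i assume i: "i < n1"
    show "AE s in lebesgue_on {a..b}. rec1 y s $ i = x1 s $ i"
      using c1[OF i] by eventually_elim (simp add: rec1_def i ci)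
  qed (use L2_D(2)[OF S(2)] in \<open>simp_all add: rec1_def\<close>)
  moreover have "eq_ae a b (rec2 y) x2"
  proof (rule eq_ae_componentsI)
    fix i assume i: "i < n2"
    show "AE s in lebesgue_on {a..b}. rec2 y s $ i = x2 s $ i"
      using c2[OF i] by eventually_elim (simp add: rec2_def i ci)
  qed (use L2_D(2)[OF S(3)] in \<open>simp_all add: rec2_def\<close>)
  moreover have "eq_ae a b (\<lambda>s. slice 0 n0 (y s)) x0"
    by (rule eq_aeI) (simp add: y_def x der_state_slices(1)[OF Sx])
  ultimately show ?thesis by (simp add: rec_state_def y_def x)
qed

end

section \<open>Remainders of differentiable curves\<close>

lemma l2_cong: "(\<And>s. s \<in> {a..b} \<Longrightarrow> f s = g s) \<Longrightarrow> l2 a b f = l2 a b g"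
  unfolding l2_def by (intro arg_cong[where f = sqrt] Bochner_Integration.integral_cong) auto

lemma primitive_remainder:
  assumes "integrable (lebesgue_on {a..b}) f" "integrable (lebesgue_on {a..b}) g"
    "integrable (lebesgue_on {a..b}) h" "\<And>\<theta>. \<theta> \<in> {a..b} \<Longrightarrow>
        z \<theta> = f \<theta> - g \<theta> - k * h \<theta>" "s \<in> {a..b}"
  shows "primitive a z s = primitive a f s - primitive a g s - k * primitive a h s"
proof -
  have "primitive a z s = primitive a (\<lambda>\<theta>. f \<theta> - g \<theta> - k * h \<theta>) s"
    using assms(5,4) by (rule primitive_cong)
  moreover have "{a..s} \<subseteq> {a..b}" using assms(5) by auto
  ultimately show ?thesis
    using assms(1-3)[THEN integrable_subinterval] by (simp add: primitive_def)
qed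

lemma append_vec_remainder:
  fixes u v :: "real vec"
  assumes "dim_vec u = dim_vec u'" "dim_vec u = dim_vec u''" "dim_vec v = dim_vec v'" "dim_vec v = dim_vec v''"
  shows "(u @\<^sub>v v) - (u' @\<^sub>v v') - k \<cdot>\<^sub>v (u'' @\<^sub>v v'') =
      (u - u' - k \<cdot>\<^sub>v u'') @\<^sub>v (v - v' - k \<cdot>\<^sub>v v'')"
  using assms by (intro eq_vecI) auto

lemma mult_vec_remainder:
  fixes A :: "real mat"
  assumes "A \<in> carrier_mat nr nc" "u \<in> carrier_vec nc" "v \<in> carrier_vec nc" "w \<in> carrier_vec nc"
  shows "A *\<^sub>v (u - v - k \<cdot>\<^sub>v w) = A *\<^sub>v u - A *\<^sub>v v - k \<cdot>\<^sub>v (A *\<^sub>v w)"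
  using assms by (intro eq_vecI)
    (simp_all add: scalar_prod_def sum_subtractf sum_distrib_left right_diff_distrib mult.left_commute)

lemma remainder_index:
  assumes "x \<tau> \<in> L2 a b m" "x t \<in> L2 a b m" "d \<in> L2 a b m" "s \<in> {a..b}" "i < m"
  shows "remainder x d t \<tau> s $ i = x \<tau> s $ i - x t s $ i - (\<tau> - t) * d s $ i"
  using assms by (simp add: remainder_def L2_D(2))

lemma remainder_L2:
  assumes "x \<tau> \<in> L2 a b m" "x t \<in> L2 a b m" "d \<in> L2 a b m"
  shows "remainder x d t \<tau> \<in> L2 a b m"
  unfolding L2_iff
proof (intro conjI ballI allI impI)
  fix s assume s: "s \<in> {a..b}"
  show "remainder x d t \<tau> s \<in> carrier_vec m"
    using assms[THEN L2_D(2)[OF _ s]] by (intro carrier_vecI) (simp add: remainder_def)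
next
  fix i assume i: "i < m"
  have "(\<lambda>s. x \<tau> s $ i - x t s $ i - (\<tau> - t) * d s $ i) \<in> sq_int a b"
    by (intro sq_int_diff sq_int_cmult L2_D(3)[OF assms(1) i] L2_D(3)[OF assms(2) i] L2_D(3)[OF assms(3) i])
  thus "(\<lambda>s. remainder x d t \<tau> s $ i) \<in> sq_int a b"
    by (rule sq_int_cong) (simp add: remainder_index[OF assms _ i])
qed

lemma remainder_cong:
  assumes "eq_ae a b (x \<tau>) (y \<tau>)" "eq_ae a b (x t) (y t)" "eq_ae a b d e"
  shows "eq_ae a b (remainder x d t \<tau>) (remainder y e t \<tau>)"
  using assms unfolding eq_ae_def by eventually_elim (simp add: remainder_def)

lemma is_weak_deriv_remainder:
  assumes L: "x \<tau> \<in> L2 a b m" "x t \<in> L2 a b m" "d \<in> L2 a b m" "g \<tau> \<in> L2 a b m" "g t \<in> L2 a b m" "e \<in> L2 a b m"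
    and W: "is_weak_deriv a b m (x \<tau>) (g \<tau>)" "is_weak_deriv a b m (x t) (g t)" "is_weak_deriv a b m d e"
  shows "is_weak_deriv a b m (remainder x d t \<tau>) (remainder g e t \<tau>)"
  unfolding is_weak_deriv_iff
proof (intro allI impI)
  fix i assume i: "i < m"
  note l = L[THEN L2_D(3)[OF _ i]]
  have w: "weak_deriv a b (\<lambda>s. x \<tau> s $ i) (\<lambda>s. g \<tau> s $ i)" "weak_deriv a b (\<lambda>s. x t s $ i) (\<lambda>s. g t s $ i)"
    "weak_deriv a b (\<lambda>s. d s $ i) (\<lambda>s. e s $ i)"
    using W i by (simp_all add: is_weak_deriv_iff)
  let ?k = "\<tau> - t"
  note w1 = weak_deriv_lincomb[OF l(1,4,2,5) w(1,2), of 1 "-1"]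
  \<comment> \<open>The remainder as two nested binary combinations, with the factors 1 and -1 kept
    so that \<open>weak_deriv_lincomb\<close> matches literally.\<close>
  have "weak_deriv a b (\<lambda>s. 1 * (1 * x \<tau> s $ i + -1 * x t s $ i) + (- ?k) * d s $ i)
     (\<lambda>s. 1 * (1 * g \<tau> s $ i + -1 * g t s $ i) + (- ?k) * e s $ i)"
    by (intro weak_deriv_lincomb w1 w(3) l sq_int_add sq_int_cmult)
  moreover have "AE s in lebesgue_on {a..b}. 1 * (1 * x \<tau> s $ i + -1 * x t s $ i) + (- ?k) * d s $ i = remainder x d t \<tau> s $ i"
    by (rule AE_I2) (simp add: remainder_index[OF L(1-3) _ i] algebra_simps)
  moreover have "AE s in lebesgue_on {a..b}. 1 * (1 * g \<tau> s $ i + -1 * g t s $ i) + (- ?k) * e s $ i = remainder g e t \<tau> s $ i"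
    by (rule AE_I2) (simp add: remainder_index[OF L(4-6) _ i] algebra_simps)
  ultimately show "weak_deriv a b (\<lambda>s. remainder x d t \<tau> s $ i) (\<lambda>s. remainder g e t \<tau> s $ i)"
    by (rule weak_deriv_cong_AE)
      (intro sq_int_measurable sq_int_add sq_int_cmult l L2_D(3)[OF remainder_L2[OF L(1-3)] i]
        L2_D(3)[OF remainder_L2[OF L(4-6)] i])+
qed

section \<open>Transfer of solutions\<close>

text \<open>Even at t = 0 the half-line leaves room to approach t from the right. Limits along this
  filter can therefore bound constants.\<close>

lemma at_within_nonneg_not_bot:
  assumes "0 \<le> t"
  shows "at t within {0..} \<noteq> (bot :: real filter)"
proof
  assume "at t within {0..} = bot"
  moreover have "at_right t \<le> at t within {0..}" using assms by (intro at_le) auto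
  ultimately have "at_right t = bot" by (simp add: bot_unique)
  thus False by simp
qed

lemma eventually_at_within_nonneg:
  "(\<And>\<tau>. 0 \<le> \<tau> \<Longrightarrow> \<tau> \<noteq> t \<Longrightarrow> P \<tau>) \<Longrightarrow>
      eventually P (at (t::real) within {0..})"
  by (auto simp: eventually_at_filter)

text \<open>The common mechanism for transferring differentiability: once the norm of one remainder
  is bounded by a constant times the norm of another, the o(|\<tau> - t|) property passes from the
  second to the first.\<close>

lemma quotient_tendsto_zero:
  fixes f g :: "real \<Rightarrow> real"
  assumes "\<And>\<tau>. 0 \<le> \<tau> \<Longrightarrow> 0 \<le> f \<tau> \<and> f \<tau> \<le> C * g \<tau>"
    and "((\<lambda>\<tau>. g \<tau> / \<bar>\<tau> - t\<bar>) \<longlongrightarrow> 0) (at t within {0..})"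
  shows "((\<lambda>\<tau>. f \<tau> / \<bar>\<tau> - t\<bar>) \<longlongrightarrow> 0) (at t within {0..})"
proof (rule real_tendsto_sandwich[of "\<lambda>_. 0" _ _ "\<lambda>\<tau>. C * (g \<tau> / \<bar>\<tau> - t\<bar>)"])
  show "\<forall>\<^sub>F \<tau> in at t within {0..}. 0 \<le> f \<tau> / \<bar>\<tau> - t\<bar>"
    using assms(1) by (intro eventually_at_within_nonneg) simp
  show "\<forall>\<^sub>F \<tau> in at t within {0..}. f \<tau> / \<bar>\<tau> - t\<bar> \<le> C * (g \<tau> / \<bar>\<tau> - t\<bar>)"
    using assms(1) by (intro eventually_at_within_nonneg) (simp add: divide_right_mono)
  show "((\<lambda>\<tau>. C * (g \<tau> / \<bar>\<tau> - t\<bar>)) \<longlongrightarrow> 0) (at t within {0..})"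
    using tendsto_mult_right_zero[OF assms(2), of C] .
qed simp

text \<open>(\<tau> - t)(d - e) is a difference of two remainders. After division by |\<tau> - t|,
  the norm of each component of d - e is bounded by a quantity that tends to 0.\<close>

lemma L2_has_deriv_unique:
  assumes x: "\<And>r. 0 \<le> r \<Longrightarrow> x r \<in> L2 a b m" and "0 \<le> t"
    and d: "L2_has_deriv a b m x d t" and e: "L2_has_deriv a b m x e t"
  shows "eq_ae a b d e"
proof (rule eq_ae_componentsI[where m = m])
  have dL: "d \<in> L2 a b m" "e \<in> L2 a b m" using d e by (simp_all add: L2_has_deriv_def)
  show "dim_vec (d s) = m" "dim_vec (e s) = m" if "s \<in> {a..b}" for s
    using L2_D(2)[OF dL(1) that] L2_D(2)[OF dL(2) that] .
  fix i assume i: "i < m"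
  let ?h = "\<lambda>s. d s $ i - e s $ i"
  let ?q = "\<lambda>\<tau>. 2 * (L2_norm a b (remainder x e t \<tau>) / \<bar>\<tau> - t\<bar> +
      L2_norm a b (remainder x d t \<tau>) / \<bar>\<tau> - t\<bar>)"
  have hq: "?h \<in> sq_int a b" by (intro sq_int_diff L2_D(3)[OF dL(1) i] L2_D(3)[OF dL(2) i])
  have "l2 a b ?h \<le> ?q \<tau>" if \<tau>: "0 \<le> \<tau>" "\<tau> \<noteq> t" for \<tau>
  proof -
    note R = remainder_L2[of x \<tau> a b m t, OF x[OF \<tau>(1)] x[OF \<open>0 \<le> t\<close>]]
    have "\<bar>\<tau> - t\<bar> * l2 a b ?h = l2 a b (\<lambda>s. (\<tau> - t) * ?h s)" by (simp add: l2_cmult)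
    also have "\<dots> = l2 a b (\<lambda>s. remainder x e t \<tau> s $ i - remainder x d t \<tau> s $ i)"
      by (rule l2_cong)
        (simp add: remainder_index[of x \<tau> a b m t, OF x[OF \<tau>(1)] x[OF \<open>0 \<le> t\<close>] _ _ i] dL
          left_diff_distrib right_diff_distrib)
    also have "\<dots> \<le> 2 * (l2 a b (\<lambda>s. remainder x e t \<tau> s $ i) + l2 a b (\<lambda>s. remainder x d t \<tau> s $ i))"
      by (intro l2_diff_le L2_D(3)[OF R[OF dL(1)] i] L2_D(3)[OF R[OF dL(2)] i])
    also have "\<dots> \<le> 2 * (L2_norm a b (remainder x e t \<tau>) + L2_norm a b (remainder x d t \<tau>))"
      using component_le_L2_norm[OF R[OF dL(1)] i] component_le_L2_norm[OF R[OF dL(2)] i] by simp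
    finally show ?thesis using \<tau> by (simp add: field_simps)
  qed
  hence "\<forall>\<^sub>F \<tau> in at t within {0..}. l2 a b ?h \<le> ?q \<tau>" by (rule eventually_at_within_nonneg)
  moreover have "(?q \<longlongrightarrow> 2 * (0 + 0)) (at t within {0..})"
    using d e by (intro tendsto_intros) (simp_all add: L2_has_deriv_def)
  ultimately have "l2 a b ?h \<le> 2 * (0 + 0)"
    using tendsto_lowerbound at_within_nonneg_not_bot[OF \<open>0 \<le> t\<close>] by blast
  hence "AE s in lebesgue_on {a..b}. ?h s = 0"
    by (intro l2_eq_0_AE hq antisym) simp_all
  thus "AE s in lebesgue_on {a..b}. d s $ i = e s $ i" by eventually_elim simp
qed

lemma L2_has_deriv_cong:
  assumes x: "\<And>r. 0 \<le> r \<Longrightarrow> x r \<in> L2 a b m" "\<And>r. 0 \<le> r \<Longrightarrow> y r \<in> L2 a b m"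
    "\<And>r. 0 \<le> r \<Longrightarrow> eq_ae a b (x r) (y r)" and "0 \<le> t" and d: "L2_has_deriv a b m x d t"
  shows "L2_has_deriv a b m y d t"
proof -
  have dL: "d \<in> L2 a b m" using d by (simp add: L2_has_deriv_def)
  have "L2_norm a b (remainder y d t \<tau>) = L2_norm a b (remainder x d t \<tau>)" if "0 \<le> \<tau>" for \<tau>
    by (rule L2_norm_cong[OF remainder_L2[of y, OF x(2)[OF that] x(2)[OF \<open>0 \<le> t\<close>] dL]
          remainder_L2[of x, OF x(1)[OF that] x(1)[OF \<open>0 \<le> t\<close>] dL]
          remainder_cong[of _ _ y _ x, OF eq_ae_sym[OF x(3)[OF that]] eq_ae_sym[OF x(3)[OF \<open>0 \<le> t\<close>]] eq_ae_refl]])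
  moreover have "0 \<le> L2_norm a b (remainder x d t \<tau>)" if "0 \<le> \<tau>" for \<tau>
    using remainder_L2[OF x(1)[OF that] x(1)[OF \<open>0 \<le> t\<close>] dL] by (rule L2_norm_nonneg)
  ultimately show ?thesis
    using d quotient_tendsto_zero[of "\<lambda>\<tau>. L2_norm a b (remainder y d t \<tau>)" 1 "\<lambda>\<tau>. L2_norm a b (remainder x d t \<tau>)" t]
    by (simp add: L2_has_deriv_def)
qed

section \<open>Remainders under the two maps\<close>

context boundary_problem
begin

text \<open>Linearity of the reconstruction, stated only for the combination that occurs in a
  remainder. It is inherited from primitives and, for the constants, from multiplication by B and
  W.\<close>

lemma rec_remainder:
  assumes u: "y \<tau> \<in> L2 a b n" and v: "y t \<in> L2 a b n" and w: "d \<in> L2 a b n" and s: "s \<in> {a..b}"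
  shows "rec1 (remainder y d t \<tau>) s = remainder (\<lambda>r. rec1 (y r)) (rec1 d) t \<tau> s"
    "rec2 (remainder y d t \<tau>) s = remainder (\<lambda>r. rec2 (y r)) (rec2 d) t \<tau> s"
proof -
  let ?z = "remainder y d t \<tau>" and ?k = "\<tau> - t"
  have p: "primitive a (\<lambda>\<theta>. ?z \<theta> $ j) r = primitive a (\<lambda>\<theta>. y \<tau> \<theta> $ j) r -
      primitive a (\<lambda>\<theta>. y t \<theta> $ j) r - ?k * primitive a (\<lambda>\<theta>. d \<theta> $ j) r" if "j < n" "r \<in> {a..b}" for j r
    by (intro primitive_remainder[of a b] comp_integrable that u v w remainder_index[of y \<tau> a b n t d])
  have pp: "primitive a (primitive a (\<lambda>\<theta>. ?z \<theta> $ j)) r =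
      primitive a (primitive a (\<lambda>\<theta>. y \<tau> \<theta> $ j)) r -
      primitive a (primitive a (\<lambda>\<theta>. y t \<theta> $ j)) r - ?k * primitive a (primitive a (\<lambda>\<theta>. d \<theta> $ j)) r"
    if "j < n" "r \<in> {a..b}" for j r
    by (intro primitive_remainder[of a b] integrable_continuous_interval primitive_continuous comp_integrable
        that u v w p)
  have b: "b \<in> {a..b}" using ab by simp
  have "bnd_integral ?z = bnd_integral (y \<tau>) - bnd_integral (y t) - ?k \<cdot>\<^sub>v bnd_integral d"
    unfolding bnd_integral_def
    by (simp add: append_vec_remainder) (intro arg_cong2[where f = append_vec] eq_vecI; simp add: p[OF _ b] pp[OF _ b])
  hence "bnd_coeff ?z = bnd_coeff (y \<tau>) - bnd_coeff (y t) - ?k \<cdot>\<^sub>v bnd_coeff d"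
    unfolding bnd_coeff_def
    using mult_vec_remainder[OF B_carrier bnd_integral_carrier bnd_integral_carrier bnd_integral_carrier, of "y \<tau>" "y t" ?k d]
      mult_vec_remainder[OF W_inverse(1) mult_mat_vec_carrier[OF B_carrier bnd_integral_carrier]
        mult_mat_vec_carrier[OF B_carrier bnd_integral_carrier] mult_mat_vec_carrier[OF B_carrier bnd_integral_carrier],
        of "y \<tau>" "y t" ?k d] W_inverse(1)
    by (intro eq_vecI) (simp_all del: index_mult_mat_vec)
  hence c: "bnd_coeff ?z $ j = bnd_coeff (y \<tau>) $ j - bnd_coeff (y t) $ j - ?k * bnd_coeff d $ j"
    if "j < n1 + 2 * n2" for j
    using that carrier_vecD[OF bnd_coeff_carrier] by simp
  show "rec1 ?z s = remainder (\<lambda>r. rec1 (y r)) (rec1 d) t \<tau> s"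
    by (intro eq_vecI) (simp_all add: remainder_def[of "\<lambda>r. rec1 (y r)"] rec1_def c p[OF _ s] algebra_simps)
  show "rec2 ?z s = remainder (\<lambda>r. rec2 (y r)) (rec2 d) t \<tau> s"
    by (intro eq_vecI) (simp_all add: remainder_def[of "\<lambda>r. rec2 (y r)"] rec2_def c pp[OF _ s] algebra_simps)
qed

lemma rec_state_remainder:
  assumes u: "y \<tau> \<in> L2 a b n" and v: "y t \<in> L2 a b n" and w: "d \<in> L2 a b n"
  shows "state_eq_ae a b (rec_state (remainder y d t \<tau>)) (state_remainder (\<lambda>r. rec_state (y r)) (rec_state d) t \<tau>)"
proof -
  have "slice 0 n0 (remainder y d t \<tau> s) = remainder (\<lambda>r s. slice 0 n0 (y r s)) (\<lambda>s. slice 0 n0 (d s)) t \<tau> s"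
    if s: "s \<in> {a..b}" for s
    by (intro eq_vecI) (simp_all add: remainder_index[of y \<tau> a b n t d, OF u v w s] remainder_def[of "\<lambda>r s. slice 0 n0 (y r s)"])
  thus ?thesis
    using rec_remainder[of y \<tau> t d, OF u v w] by (auto simp: rec_state_def intro!: eq_aeI)
qed

lemma rec_state_remainder_norm:
  assumes u: "y \<tau> \<in> L2 a b n" and v: "y t \<in> L2 a b n" and w: "d \<in> L2 a b n"
  shows "state_norm a b n0 n1 n2 (state_remainder (\<lambda>r. rec_state (y r)) (rec_state d) t \<tau>) =
    state_norm a b n0 n1 n2 (rec_state (remainder y d t \<tau>))"
  using rec_L2(1,4,6)[OF u] rec_L2(1,4,6)[OF v] rec_L2(1,4,6)[OF w]
    rec_L2(1,4,6)[OF remainder_L2[of y \<tau> a b n t d, OF u v w]] rec_state_remainder[of y \<tau> t d, OF u v w]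
  by (intro state_norm_cong[symmetric]) (auto simp: rec_state_def intro: remainder_L2)

text \<open>The remainder of the derivatives is a weak derivative of the remainder, but the
  representative selected by \<open>wderiv\<close> may be another one; hence the second claim holds
  only almost everywhere.\<close>

lemma state_remainder_in_state_space:
  assumes "x \<tau> \<in> state_space a b n0 n1 n2" "x t \<in> state_space a b n0 n1 n2" "d \<in> state_space a b n0 n1 n2"
  shows "state_remainder x d t \<tau> \<in> state_space a b n0 n1 n2"
    "eq_ae a b (der_state (state_remainder x d t \<tau>)) (remainder (\<lambda>r. der_state (x r)) (der_state d) t \<tau>)"
proof -
  obtain u0 u1 u2 where u: "x \<tau> = (u0, u1, u2)" by (cases "x \<tau>")
  obtain v0 v1 v2 where v: "x t = (v0, v1, v2)" by (cases "x t")
  obtain d0 d1 d2 where d: "d = (d0, d1, d2)" by (cases d)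
  note Su = state_space_D[OF assms(1)[unfolded u]] and Sv = state_space_D[OF assms(2)[unfolded v]]
    and Sd = state_space_D[OF assms(3)[unfolded d]]
  note D1 = sobolev_1D[OF Su(4)] sobolev_1D[OF Sv(4)] sobolev_1D[OF Sd(4)]
  note D2 = sobolev_2D[OF Su(5) ab] sobolev_2D[OF Sv(5) ab] sobolev_2D[OF Sd(5) ab]
  define x0 where "x0 = (\<lambda>r. fst (x r))"
  define x1 where "x1 = (\<lambda>r. fst (snd (x r)))"
  define x2 where "x2 = (\<lambda>r. snd (snd (x r)))"
  let ?w1 = "\<lambda>r. wderiv a b n1 (x1 r)" and ?w2 = "\<lambda>r. wderiv a b n2 (x2 r)"
  let ?w22 = "\<lambda>r. wderiv a b n2 (wderiv a b n2 (x2 r))"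
  have xs: "x0 \<tau> = u0" "x1 \<tau> = u1" "x2 \<tau> = u2" "x0 t = v0" "x1 t = v1" "x2 t = v2"
    by (simp_all add: x0_def x1_def x2_def u v)
  have sr: "state_remainder x d t \<tau> = (remainder x0 d0 t \<tau>, remainder x1 d1 t \<tau>, remainder x2 d2 t \<tau>)"
    by (simp add: d x0_def x1_def x2_def)
  have L0: "remainder x0 d0 t \<tau> \<in> L2 a b n0"
    by (rule remainder_L2) (simp_all add: xs Su Sv Sd)
  have L1: "remainder x1 d1 t \<tau> \<in> L2 a b n1" "remainder ?w1 (wderiv a b n1 d1) t \<tau> \<in> L2 a b n1"
    by (rule remainder_L2; simp only: xs Su Sv Sd D1)+
  have L2: "remainder x2 d2 t \<tau> \<in> L2 a b n2" "remainder ?w2 (wderiv a b n2 d2) t \<tau> \<in> L2 a b n2"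
    "remainder ?w22 (wderiv a b n2 (wderiv a b n2 d2)) t \<tau> \<in> L2 a b n2"
    by (rule remainder_L2; simp only: xs Su Sv Sd D2)+
  have W1: "is_weak_deriv a b n1 (remainder x1 d1 t \<tau>) (remainder ?w1 (wderiv a b n1 d1) t \<tau>)"
    by (rule is_weak_deriv_remainder; simp only: xs D1)
  have W2: "is_weak_deriv a b n2 (remainder x2 d2 t \<tau>) (remainder ?w2 (wderiv a b n2 d2) t \<tau>)"
    "is_weak_deriv a b n2 (remainder ?w2 (wderiv a b n2 d2) t \<tau>) (remainder ?w22 (wderiv a b n2 (wderiv a b n2 d2)) t \<tau>)"
    by (rule is_weak_deriv_remainder; simp only: xs D2)+
  show "state_remainder x d t \<tau> \<in> state_space a b n0 n1 n2"
    unfolding sr state_space_def using L0 sobolev_1I[OF L1 W1] sobolev_2I[OF L2 W2] by blast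
  have e: "eq_ae a b (wderiv a b n1 (remainder x1 d1 t \<tau>)) (remainder ?w1 (wderiv a b n1 d1) t \<tau>)"
    "eq_ae a b (wderiv a b n2 (wderiv a b n2 (remainder x2 d2 t \<tau>))) (remainder ?w22 (wderiv a b n2 (wderiv a b n2 d2)) t \<tau>)"
    using wderiv_eq(2)[OF L1 W1 ab] wderiv_wderiv_eq(2)[OF L2 W2 ab] .
  have "AE s in lebesgue_on {a..b}. s \<in> {a..b}" by (rule AE_I2) simp
  with e have "AE s in lebesgue_on {a..b}. der_state (state_remainder x d t \<tau>) s =
      remainder (\<lambda>r. der_state (x r)) (der_state d) t \<tau> s"
    unfolding eq_ae_def
  proof eventually_elim
    case (elim s)
    have dims: "dim_vec (u0 s) = n0" "dim_vec (v0 s) = n0" "dim_vec (d0 s) = n0"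
      "dim_vec (wderiv a b n1 u1 s) = n1" "dim_vec (wderiv a b n1 v1 s) = n1" "dim_vec (wderiv a b n1 d1 s) = n1"
      "dim_vec (wderiv a b n2 (wderiv a b n2 u2) s) = n2" "dim_vec (wderiv a b n2 (wderiv a b n2 v2) s) = n2"
      "dim_vec (wderiv a b n2 (wderiv a b n2 d2) s) = n2"
      using elim(3) by (auto intro!: L2_D(2) Su Sv Sd D1 D2)
    have "der_state (state_remainder x d t \<tau>) s = remainder x0 d0 t \<tau> s @\<^sub>v
        remainder ?w1 (wderiv a b n1 d1) t \<tau> s @\<^sub>v remainder ?w22 (wderiv a b n2 (wderiv a b n2 d2)) t \<tau> s"
      unfolding sr der_state_def prod.case elim(1,2) ..
    also have "\<dots> = remainder (\<lambda>r. der_state (x r)) (der_state d) t \<tau> s"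
      by (simp add: remainder_def xs der_state_def u v d append_vec_remainder dims)
    finally show ?case .
  qed
  thus "eq_ae a b (der_state (state_remainder x d t \<tau>)) (remainder (\<lambda>r. der_state (x r)) (der_state d) t \<tau>)"
    unfolding eq_ae_def .
qed

section \<open>Boundedness of the two maps\<close>

lemma L2_norm_le_state_norm:
  assumes x: "(x0, x1, x2) \<in> state_space a b n0 n1 n2"
  shows "L2_norm a b x0 \<le> state_norm a b n0 n1 n2 (x0, x1, x2)"
    "L2_norm a b x1 \<le> state_norm a b n0 n1 n2 (x0, x1, x2)"
    "L2_norm a b x2 \<le> state_norm a b n0 n1 n2 (x0, x1, x2)"
    "L2_norm a b (wderiv a b n1 x1) \<le> state_norm a b n0 n1 n2 (x0, x1, x2)"
    "L2_norm a b (wderiv a b n2 (wderiv a b n2 x2)) \<le> state_norm a b n0 n1 n2 (x0, x1, x2)"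
proof -
  have "0 \<le> L2_norm a b x0" using state_space_D(1)[OF x] by simp
  thus "L2_norm a b x0 \<le> state_norm a b n0 n1 n2 (x0, x1, x2)"
    "L2_norm a b x1 \<le> state_norm a b n0 n1 n2 (x0, x1, x2)"
    "L2_norm a b x2 \<le> state_norm a b n0 n1 n2 (x0, x1, x2)"
    "L2_norm a b (wderiv a b n1 x1) \<le> state_norm a b n0 n1 n2 (x0, x1, x2)"
    "L2_norm a b (wderiv a b n2 (wderiv a b n2 x2)) \<le> state_norm a b n0 n1 n2 (x0, x1, x2)"
    using L2_norm_le_sobolev[of 0 1 a b n1 x1] L2_norm_le_sobolev[of 1 1 a b n1 x1]
      L2_norm_le_sobolev[of 0 2 a b n2 x2] L2_norm_le_sobolev[of 2 2 a b n2 x2]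
      sobolev_norm_nonneg[of a b 1 n1 x1] sobolev_norm_nonneg[of a b 2 n2 x2]
    by (simp_all add: numeral_2_eq_2 del: sobolev_norm_nonneg)
qed

lemma state_norm_nonneg: "x \<in> state_space a b n0 n1 n2 \<Longrightarrow> 0 \<le> state_norm a b n0 n1 n2 x"
  by (cases x) (auto dest: state_space_D(1))

text \<open>Each component belongs to x0, x1_s or x2_ss, whose norms are all dominated by the state
  norm. The factor n counts the components.\<close>

lemma der_state_bounded:
  assumes x: "x \<in> state_space a b n0 n1 n2"
  shows "L2_norm a b (der_state x) \<le> real n * state_norm a b n0 n1 n2 x"
proof (rule L2_norm_bound[OF der_state_L2[OF x]])
  obtain x0 x1 x2 where x': "x = (x0, x1, x2)" by (cases x)
  note S = state_space_D[OF x[unfolded x']] and N = L2_norm_le_state_norm[OF x[unfolded x']]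
    and sl = der_state_slices[OF x[unfolded x']]
  fix j assume j: "j < n"
  consider "j < n0" | i where "j = n0 + i" "i < n1" | i where "j = n0 + n1 + i" "i < n2"
    using j by (metis add.assoc less_diff_conv2 linorder_not_less le_add_diff_inverse nat_add_left_cancel_less)
  thus "l2 a b (\<lambda>s. der_state x s $ j) \<le> state_norm a b n0 n1 n2 x"
  proof cases
    case 1
    have "l2 a b (\<lambda>s. der_state x s $ j) = l2 a b (\<lambda>s. x0 s $ j)"
    proof (rule l2_cong)
      fix s assume "s \<in> {a..b}"
      hence "slice 0 n0 (der_state x s) $ j = x0 s $ j" unfolding x' by (simp only: sl(1))
      thus "der_state x s $ j = x0 s $ j" using 1 by simp
    qed
    thus ?thesis using component_le_L2_norm[OF S(1) 1] N(1) by (simp add: x' del: state_norm.simps)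
  next
    case 2
    have "l2 a b (\<lambda>s. der_state x s $ j) = l2 a b (\<lambda>s. wderiv a b n1 x1 s $ i)"
      by (rule l2_cong) (use 2 sl(2) in \<open>simp add: x' index_slice[of i n1 n0, symmetric] del: index_slice\<close>)
    thus ?thesis using component_le_L2_norm[OF sobolev_1D(2)[OF S(4)] 2(2)] N(4) by (simp add: x' del: state_norm.simps)
  next
    case 3
    have "l2 a b (\<lambda>s. der_state x s $ j) = l2 a b (\<lambda>s. wderiv a b n2 (wderiv a b n2 x2) s $ i)"
      by (rule l2_cong) (use 3 sl(3) in \<open>simp add: x' index_slice[of i n2 "n0 + n1", symmetric] del: index_slice\<close>)
    thus ?thesis using component_le_L2_norm[OF sobolev_2D(3)[OF S(5) ab] 3(2)] N(5) by (simp add: x' del: state_norm.simps)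
  qed
qed

text \<open>One integration costs sqrt(b - a) by Cauchy-Schwarz and a second one a further factor b
  - a. The sum of the two costs is \<kappa>, which covers both cases at once.\<close>

lemma primitive_component_bounded:
  assumes y: "y \<in> L2 a b n" and j: "j < n" and s: "s \<in> {a..b}"
  defines "\<kappa> \<equiv> sqrt (b - a) * (1 + (b - a))"
  shows "\<bar>primitive a (\<lambda>\<theta>. y \<theta> $ j) s\<bar> \<le> \<kappa> * L2_norm a b y"
    "\<bar>primitive a (primitive a (\<lambda>\<theta>. y \<theta> $ j)) s\<bar> \<le> \<kappa> * L2_norm a b y"
proof -
  let ?M = "sqrt (b - a) * L2_norm a b y"
  have M: "0 \<le> ?M" using ab y by simp
  have p: "\<bar>primitive a (\<lambda>\<theta>. y \<theta> $ j) r\<bar> \<le> ?M" if "r \<in> {a..b}" for r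
  proof -
    have "\<bar>primitive a (\<lambda>\<theta>. y \<theta> $ j) r\<bar> \<le> sqrt (b - a) * l2 a b (\<lambda>\<theta>. y \<theta> $ j)"
      by (rule primitive_le_l2[OF L2_D(3)[OF y j] ab that])
    also have "\<dots> \<le> ?M" using component_le_L2_norm[OF y j] ab by (intro mult_left_mono) auto
    finally show ?thesis .
  qed
  have k: "\<kappa> * L2_norm a b y = ?M + ?M * (b - a)" by (simp add: \<kappa>_def algebra_simps)
  have "0 \<le> ?M * (b - a)" using M ab by (intro mult_nonneg_nonneg[of ?M]) auto
  thus "\<bar>primitive a (\<lambda>\<theta>. y \<theta> $ j) s\<bar> \<le> \<kappa> * L2_norm a b y" using p[OF s] k by linarith
  have "\<bar>primitive a (primitive a (\<lambda>\<theta>. y \<theta> $ j)) s\<bar> \<le> ?M * (b - a)"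
    by (rule primitive_bounded[OF primitive_continuous[OF comp_integrable[OF y j]] p s])
  thus "\<bar>primitive a (primitive a (\<lambda>\<theta>. y \<theta> $ j)) s\<bar> \<le> \<kappa> * L2_norm a b y" using M k by linarith
qed

text \<open>\<open>bnd_coeff\<close> applies two fixed matrices to a vector whose entries are
  primitives at b; the constant is the product of the bounds for W, for B and for these
  primitives.\<close>

lemma bnd_coeff_bounded:
  obtains C where "0 \<le> C" "\<And>y j. y \<in> L2 a b n \<Longrightarrow> j < n1 + 2 * n2 \<Longrightarrow>
      \<bar>bnd_coeff y $ j\<bar> \<le> C * L2_norm a b y"
proof -
  obtain C1 where C1: "C1 \<ge> 0" "\<forall>v M j. v \<in> carrier_vec (2 * n1 + 4 * n2) \<longrightarrow>
      (\<forall>i<2 * n1 + 4 * n2. \<bar>v $ i\<bar> \<le> M) \<longrightarrow> 0 \<le> M \<longrightarrow> j < n1 +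
          2 * n2 \<longrightarrow> \<bar>(B *\<^sub>v v) $ j\<bar> \<le> C1 * M"
    using mult_vec_bounded[OF B_carrier] by blast
  obtain C2 where C2: "C2 \<ge> 0" "\<forall>v M j. v \<in> carrier_vec (n1 + 2 * n2) \<longrightarrow>
      (\<forall>i<n1 + 2 * n2. \<bar>v $ i\<bar> \<le> M) \<longrightarrow> 0 \<le> M \<longrightarrow> j < n1 +
          2 * n2 \<longrightarrow> \<bar>(W *\<^sub>v v) $ j\<bar> \<le> C2 * M"
    using mult_vec_bounded[OF W_inverse(1)] by blast
  define \<kappa> where "\<kappa> = sqrt (b - a) * (1 + (b - a))"
  have \<kappa>: "\<kappa> \<ge> 0" using ab by (simp add: \<kappa>_def)
  have "\<bar>bnd_coeff y $ j\<bar> \<le> (C2 * C1 * \<kappa>) * L2_norm a b y" if y: "y \<in> L2 a b n" and j: "j < n1 + 2 * n2" for y j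
  proof -
    have b: "b \<in> {a..b}" using ab by simp
    let ?M = "\<kappa> * L2_norm a b y"
    have M: "0 \<le> ?M" using \<kappa> y by simp
    have app: "(\<forall>i<dim_vec (u @\<^sub>v v). \<bar>(u @\<^sub>v v) $ i\<bar> \<le> ?M)"
      if "\<forall>i<dim_vec u. \<bar>u $ i\<bar> \<le> ?M" "\<forall>i<dim_vec v. \<bar>v $ i\<bar> \<le> ?M" for u v :: "real vec"
      using that by auto
    note P = primitive_component_bounded[OF y _ b, folded \<kappa>_def]
    have "\<forall>i<dim_vec (bnd_integral y). \<bar>bnd_integral y $ i\<bar> \<le> ?M"
      unfolding bnd_integral_def by (intro app) (use P M in simp_all)
    hence q: "\<bar>bnd_integral y $ i\<bar> \<le> ?M" if "i < 2 * n1 + 4 * n2" for i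
      using that carrier_vecD[OF bnd_integral_carrier[of y]] by simp
    have "\<bar>(W *\<^sub>v (B *\<^sub>v bnd_integral y)) $ j\<bar> \<le> C2 * (C1 * ?M)"
      using C1(1) M j \<kappa> L2_norm_nonneg[OF y]
      by (intro C2(2)[rule_format] C1(2)[rule_format] bnd_integral_carrier q mult_mat_vec_carrier[OF B_carrier] mult_nonneg_nonneg) auto
    thus ?thesis using W_inverse(1) j by (simp add: bnd_coeff_def mult.assoc del: index_mult_mat_vec)
  qed
  moreover have "0 \<le> C2 * C1 * \<kappa>" using C1(1) C2(1) \<kappa> by simp
  ultimately show thesis using that by blast
qed

lemma rec_state_bounded:
  obtains C where "0 < C"
    "\<And>y. y \<in> L2 a b n \<Longrightarrow> state_norm a b n0 n1 n2 (rec_state y) \<le> C * L2_norm a b y"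
proof -
  obtain C0 where C0: "0 \<le> C0" "\<And>y j. y \<in> L2 a b n \<Longrightarrow> j < n1 + 2 * n2 \<Longrightarrow>
      \<bar>bnd_coeff y $ j\<bar> \<le> C0 * L2_norm a b y"
    by (rule bnd_coeff_bounded) (rule that)
  define \<kappa> where "\<kappa> = sqrt (b - a) * (1 + (b - a))"
  \<comment> \<open>The bracket bounds the values of x1, x2 and x2_s pointwise: 1 + (b - a) accounts
    for the affine term and \<kappa> for the primitives. The factor sqrt(b - a) turns a pointwise
    bound into an L2 bound.\<close>
  define C1 where "C1 = (C0 * (1 + (b - a)) + \<kappa>) * sqrt (b - a)"
  have \<kappa>: "\<kappa> \<ge> 0" using ab by (simp add: \<kappa>_def)
  have C1: "0 \<le> C1" using C0(1) \<kappa> ab by (simp add: C1_def)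
  \<comment> \<open>The groups count the components of x0, of x1 and x1_s, and of x2, x2_s and
    x2_ss. The final 1 keeps C positive when all dimensions are 0.\<close>
  define C where "C = real n0 + (real n1 * C1 + real n1) + (real n2 * C1 + real n2 * C1 + real n2) + 1"
  have "state_norm a b n0 n1 n2 (rec_state y) \<le> C * L2_norm a b y" if y: "y \<in> L2 a b n" for y
  proof -
    let ?L = "L2_norm a b y"
    have L: "0 \<le> ?L" using y by simp
    note R = rec_L2[OF y] and D = rec_wderiv[OF y]
    note c = C0(2)[OF y] and P = primitive_component_bounded[OF y, folded \<kappa>_def]
    let ?D = "(C0 * (1 + (b - a)) + \<kappa>) * ?L"
    have D0: "C0 * ?L \<le> C0 * (1 + (b - a)) * ?L"
      using C0(1) L ab by (intro mult_right_mono mult_left_mono[of 1 "1 + (b - a)" C0, simplified]) auto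
    have b1: "\<bar>rec1 y s $ i\<bar> \<le> ?D" if "i < n1" "s \<in> {a..b}" for i s
      using c[of i] P(1)[of "n0 + i" s] that D0 by (simp add: rec1_def distrib_right)
    have b2s: "\<bar>rec2s y s $ i\<bar> \<le> ?D" if "i < n2" "s \<in> {a..b}" for i s
      using c[of "n1 + n2 + i"] P(1)[of "n0 + n1 + i" s] that D0 by (simp add: rec2s_def distrib_right)
    have b2: "\<bar>rec2 y s $ i\<bar> \<le> ?D" if "i < n2" "s \<in> {a..b}" for i s
    proof -
      have "\<bar>(s - a) * bnd_coeff y $ (n1 + n2 + i)\<bar> \<le> (b - a) * (C0 * ?L)"
        using c[of "n1 + n2 + i"] that C0(1) L unfolding abs_mult by (intro mult_mono) auto
      thus ?thesis
        using c[of "n1 + i"] P(2)[of "n0 + n1 + i" s] that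
        by (simp add: rec2_def distrib_right distrib_left mult_ac)
    qed
    have l2b: "l2 a b (\<lambda>s. f s $ i) \<le> C1 * ?L"
      if "f \<in> L2 a b m" "i < m" "\<And>s. s \<in> {a..b} \<Longrightarrow> \<bar>f s $ i\<bar> \<le> ?D" for f m i
      using l2_bounded[OF sq_int_measurable[OF L2_D(3)[OF that(1,2)]] ab that(3)]
      by (simp add: C1_def mult_ac)
    have n1: "L2_norm a b (rec1 y) \<le> real n1 * (C1 * ?L)"
      by (intro L2_norm_bound R(4) l2b[OF R(4)] b1)
    have n2: "L2_norm a b (rec2 y) \<le> real n2 * (C1 * ?L)"
      by (intro L2_norm_bound R(6) l2b[OF R(6)] b2)
    have n2s: "L2_norm a b (wderiv a b n2 (rec2 y)) \<le> real n2 * (C1 * ?L)"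
      unfolding L2_norm_cong[OF D(3) R(5) D(4)] by (intro L2_norm_bound R(5) l2b[OF R(5)] b2s)
    have n0: "L2_norm a b (\<lambda>s. slice 0 n0 (y s)) \<le> real n0 * ?L"
      using component_le_L2_norm[OF y] by (intro L2_norm_bound R(1)) simp
    have n1s: "L2_norm a b (wderiv a b n1 (rec1 y)) \<le> real n1 * ?L"
      unfolding L2_norm_cong[OF D(1) R(2) D(2)]
      using component_le_L2_norm[OF y] by (intro L2_norm_bound R(2)) simp
    have n2ss: "L2_norm a b (wderiv a b n2 (wderiv a b n2 (rec2 y))) \<le> real n2 * ?L"
      unfolding L2_norm_cong[OF D(5) R(3) D(6)]
      using component_le_L2_norm[OF y] by (intro L2_norm_bound R(3)) simp
    have "sobolev_norm a b 1 n1 (rec1 y) \<le> (\<Sum>i\<le>1. L2_norm a b ((wderiv a b n1 ^^ i) (rec1 y)))"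
      using R(4) D(1) by (intro sobolev_norm_le_sum) (auto simp: le_Suc_eq)
    hence "sobolev_norm a b 1 n1 (rec1 y) \<le> L2_norm a b (rec1 y) + L2_norm a b (wderiv a b n1 (rec1 y))"
      by simp
    moreover have "sobolev_norm a b 2 n2 (rec2 y) \<le> (\<Sum>i\<le>2. L2_norm a b ((wderiv a b n2 ^^ i) (rec2 y)))"
      using R(6) D(3,5) by (intro sobolev_norm_le_sum) (auto simp: le_Suc_eq numeral_2_eq_2)
    hence "sobolev_norm a b 2 n2 (rec2 y) \<le> L2_norm a b (rec2 y) + L2_norm a b (wderiv a b n2 (rec2 y))
        + L2_norm a b (wderiv a b n2 (wderiv a b n2 (rec2 y)))"
      by (simp add: numeral_2_eq_2)
    ultimately have "state_norm a b n0 n1 n2 (rec_state y) \<le> real n0 * ?L + (real n1 * (C1 * ?L) + real n1 * ?L)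
        + (real n2 * (C1 * ?L) + real n2 * (C1 * ?L) + real n2 * ?L)"
      using n0 n1 n1s n2 n2s n2ss unfolding rec_state_def state_norm.simps by linarith
    also have "\<dots> \<le> C * ?L" using L by (simp add: C_def algebra_simps)
    finally show ?thesis .
  qed
  moreover have "0 < C" unfolding C_def using C1 by (intro add_nonneg_pos add_nonneg_nonneg) auto
  ultimately show thesis using that by blast
qed

text \<open>The state norm dominates the L2 norm of every component. Differentiability in the weaker
  norm is enough to compare derivatives, because they are unique there.\<close>

lemma state_has_deriv_components:
  assumes x: "\<And>r. 0 \<le> r \<Longrightarrow> x r \<in> state_space a b n0 n1 n2" and "0 \<le> t"
    and d: "state_has_deriv a b n0 n1 n2 x (d0, d1, d2) t"
  shows "L2_has_deriv a b n0 (\<lambda>r. fst (x r)) d0 t" "L2_has_deriv a b n1 (\<lambda>r. fst (snd (x r))) d1 t"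
    "L2_has_deriv a b n2 (\<lambda>r. snd (snd (x r))) d2 t"
proof -
  let ?R = "state_remainder x (d0, d1, d2) t"
  have dS: "(d0, d1, d2) \<in> state_space a b n0 n1 n2"
    and lim: "((\<lambda>\<tau>. state_norm a b n0 n1 n2 (?R \<tau>) / \<bar>\<tau> - t\<bar>) \<longlongrightarrow> 0) (at t within {0..})"
    using d by (simp_all only: state_has_deriv_def)
  note S = state_space_D[OF dS]
  have R: "(remainder (\<lambda>r. fst (x r)) d0 t \<tau>, remainder (\<lambda>r. fst (snd (x r))) d1 t \<tau>,
      remainder (\<lambda>r. snd (snd (x r))) d2 t \<tau>) \<in> state_space a b n0 n1 n2" if "0 \<le> \<tau>" for \<tau>
    using state_remainder_in_state_space(1)[OF x[OF that] x[OF \<open>0 \<le> t\<close>] dS] by simp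
  have "0 \<le> L2_norm a b (remainder (\<lambda>r. fst (x r)) d0 t \<tau>) \<and>
      L2_norm a b (remainder (\<lambda>r. fst (x r)) d0 t \<tau>) \<le> 1 * state_norm a b n0 n1 n2 (?R \<tau>)"
    "0 \<le> L2_norm a b (remainder (\<lambda>r. fst (snd (x r))) d1 t \<tau>) \<and>
      L2_norm a b (remainder (\<lambda>r. fst (snd (x r))) d1 t \<tau>) \<le> 1 * state_norm a b n0 n1 n2 (?R \<tau>)"
    "0 \<le> L2_norm a b (remainder (\<lambda>r. snd (snd (x r))) d2 t \<tau>) \<and>
      L2_norm a b (remainder (\<lambda>r. snd (snd (x r))) d2 t \<tau>) \<le> 1 * state_norm a b n0 n1 n2 (?R \<tau>)"
    if "0 \<le> \<tau>" for \<tau>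
    using L2_norm_le_state_norm(1-3)[OF R[OF that]] state_space_D(1-3)[OF R[OF that], THEN L2_norm_nonneg]
    by (simp_all del: state_norm.simps)
  from this[THEN quotient_tendsto_zero[OF _ lim]] S
  show "L2_has_deriv a b n0 (\<lambda>r. fst (x r)) d0 t" "L2_has_deriv a b n1 (\<lambda>r. fst (snd (x r))) d1 t"
    "L2_has_deriv a b n2 (\<lambda>r. snd (snd (x r))) d2 t"
    by (simp_all add: L2_has_deriv_def)
qed

text \<open>By linearity the remainder of the reconstructed curve has the norm of the reconstructed
  remainder, which boundedness controls.\<close>

lemma rec_state_has_deriv:
  assumes y: "\<And>r. 0 \<le> r \<Longrightarrow> y r \<in> L2 a b n" and "0 \<le> t" and d: "L2_has_deriv a b n y d t"
  shows "state_has_deriv a b n0 n1 n2 (\<lambda>r. rec_state (y r)) (rec_state d) t"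
proof -
  obtain C where C: "0 < C" "\<And>y. y \<in> L2 a b n \<Longrightarrow> state_norm a b n0 n1 n2 (rec_state y) \<le> C * L2_norm a b y"
    by (rule rec_state_bounded) (rule that)
  have dL: "d \<in> L2 a b n" using d by (simp add: L2_has_deriv_def)
  have "0 \<le> state_norm a b n0 n1 n2 (state_remainder (\<lambda>r. rec_state (y r)) (rec_state d) t \<tau>) \<and>
     state_norm a b n0 n1 n2 (state_remainder (\<lambda>r. rec_state (y r)) (rec_state d) t \<tau>) \<le>
      C * L2_norm a b (remainder y d t \<tau>)" if "0 \<le> \<tau>" for \<tau>
  proof -
    have z: "remainder y d t \<tau> \<in> L2 a b n" by (rule remainder_L2[of y, OF y[OF that] y[OF \<open>0 \<le> t\<close>] dL])
    thus ?thesis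
      unfolding rec_state_remainder_norm[of y, OF y[OF that] y[OF \<open>0 \<le> t\<close>] dL]
      using C(2) state_norm_nonneg[OF subsetD[OF X_subset_state_space rec_state_in_X[OF z]]] by simp
  qed
  from quotient_tendsto_zero[OF this] d subsetD[OF X_subset_state_space rec_state_in_X[OF dL]]
  show ?thesis by (simp add: state_has_deriv_def L2_has_deriv_def)
qed

lemma der_state_has_deriv:
  assumes x: "\<And>r. 0 \<le> r \<Longrightarrow> x r \<in> state_space a b n0 n1 n2" and "0 \<le> t"
    and d: "state_has_deriv a b n0 n1 n2 x d t"
  shows "L2_has_deriv a b n (\<lambda>r. der_state (x r)) (der_state d) t"
proof -
  have dS: "d \<in> state_space a b n0 n1 n2" using d by (simp add: state_has_deriv_def)
  have "0 \<le> L2_norm a b (remainder (\<lambda>r. der_state (x r)) (der_state d) t \<tau>) \<and>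
     L2_norm a b (remainder (\<lambda>r. der_state (x r)) (der_state d) t \<tau>) \<le>
      real n * state_norm a b n0 n1 n2 (state_remainder x d t \<tau>)" if "0 \<le> \<tau>" for \<tau>
  proof -
    note z = state_remainder_in_state_space[OF x[OF that] x[OF \<open>0 \<le> t\<close>] dS]
    have r: "remainder (\<lambda>r. der_state (x r)) (der_state d) t \<tau> \<in> L2 a b n"
      by (intro remainder_L2 der_state_L2 x that \<open>0 \<le> t\<close> dS)
    show ?thesis
      using L2_norm_nonneg[OF r] der_state_bounded[OF z(1)] L2_norm_cong[OF der_state_L2[OF z(1)] r z(2)] by simp
  qed
  from quotient_tendsto_zero[OF this] d der_state_L2[OF dS]
  show ?thesis by (simp add: state_has_deriv_def L2_has_deriv_def)
qed

text \<open>Since \<open>rec_state\<close> is continuous on L2, the derivative \<open>d\<close> of a curve in X and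
  \<open>rec_state (der_state d)\<close> are L2-derivatives of the same curve; hence they agree, although
  \<open>d\<close> is only known to lie in the ambient Sobolev space.\<close>

lemma rec_der_state_deriv:
  assumes x: "\<And>r. 0 \<le> r \<Longrightarrow> x r \<in> X_space a b n0 n1 n2 B" and "0 \<le> t"
    and d: "state_has_deriv a b n0 n1 n2 x d t"
  shows "state_eq_ae a b (rec_state (der_state d)) d"
proof -
  have xS: "x r \<in> state_space a b n0 n1 n2" if "0 \<le> r" for r
    using x[OF that] X_subset_state_space by blast
  let ?x' = "\<lambda>r. rec_state (der_state (x r))"
  have x'S: "?x' r \<in> state_space a b n0 n1 n2" if "0 \<le> r" for r
    by (intro subsetD[OF X_subset_state_space] rec_state_in_X der_state_L2 xS that)
  obtain d0 d1 d2 where d': "d = (d0, d1, d2)" by (cases d)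
  obtain e0 e1 e2 where e: "rec_state (der_state d) = (e0, e1, e2)" by (cases "rec_state (der_state d)")
  have de: "state_has_deriv a b n0 n1 n2 ?x' (e0, e1, e2) t"
    unfolding e[symmetric]
    by (intro rec_state_has_deriv der_state_L2 xS der_state_has_deriv d \<open>0 \<le> t\<close>)
  \<comment> \<open>The two derivatives are compared componentwise in L2; agreement almost
    everywhere asks for no control of the derivatives in s.\<close>
  note D = state_has_deriv_components[of x, OF xS \<open>0 \<le> t\<close> d[unfolded d']]
  note E = state_has_deriv_components[of ?x', OF x'S \<open>0 \<le> t\<close> de]
  have mem: "fst (x r) \<in> L2 a b n0" "fst (snd (x r)) \<in> L2 a b n1" "snd (snd (x r)) \<in> L2 a b n2"
    if "0 \<le> r" for r
    using state_space_D(1-3)[of "fst (x r)" "fst (snd (x r))" "snd (snd (x r))"] xS[OF that] by simp_all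
  have mem': "fst (?x' r) \<in> L2 a b n0" "fst (snd (?x' r)) \<in> L2 a b n1" "snd (snd (?x' r)) \<in> L2 a b n2"
    if "0 \<le> r" for r
    using state_space_D(1-3)[of "fst (?x' r)" "fst (snd (?x' r))" "snd (snd (?x' r))"] x'S[OF that] by simp_all
  have eq: "eq_ae a b (fst (?x' r)) (fst (x r))" "eq_ae a b (fst (snd (?x' r))) (fst (snd (x r)))"
    "eq_ae a b (snd (snd (?x' r))) (snd (snd (x r)))" if "0 \<le> r" for r
    using rec_der_state[OF x[OF that]] unfolding state_eq_ae_iff by simp_all
  have "eq_ae a b e0 d0"
    by (rule L2_has_deriv_unique[OF mem(1) \<open>0 \<le> t\<close> L2_has_deriv_cong[OF mem'(1) mem(1) eq(1) \<open>0 \<le> t\<close> E(1)] D(1)])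
  moreover have "eq_ae a b e1 d1"
    by (rule L2_has_deriv_unique[OF mem(2) \<open>0 \<le> t\<close> L2_has_deriv_cong[OF mem'(2) mem(2) eq(2) \<open>0 \<le> t\<close> E(2)] D(2)])
  moreover have "eq_ae a b e2 d2"
    by (rule L2_has_deriv_unique[OF mem(3) \<open>0 \<le> t\<close> L2_has_deriv_cong[OF mem'(3) mem(3) eq(3) \<open>0 \<le> t\<close> E(3)] D(3)])
  ultimately show ?thesis unfolding e unfolding d' by simp
qed

section \<open>Transfer of the equations and of the exponential bounds\<close>

lemma T_op_state_vec:
  "y \<in> L2 a b n \<Longrightarrow> eq_ae a b (T_op a b n0 n1 n2 B y) (state_vec (rec_state y))"
  by (rule eq_aeI) (simp add: T_op_eq rec_state_def)

text \<open>Equivalent states have identical chosen derivatives by \<open>wderiv_cong\<close>, so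
  only the terms without derivatives need an exceptional null set.\<close>

lemma pde_rhs_cong:
  assumes x: "x \<in> state_space a b n0 n1 n2" and x': "x' \<in> state_space a b n0 n1 n2" and eq: "state_eq_ae a b x x'"
  shows "eq_ae a b (pde_rhs a b n1 n2 A0 A1 A2 x) (pde_rhs a b n1 n2 A0 A1 A2 x')"
proof -
  obtain x0 x1 x2 where u: "x = (x0, x1, x2)" by (cases x)
  obtain v0 v1 v2 where v: "x' = (v0, v1, v2)" by (cases x')
  note Su = state_space_D[OF x[unfolded u]] and Sv = state_space_D[OF x'[unfolded v]]
  have e: "eq_ae a b x0 v0" "eq_ae a b x1 v1" "eq_ae a b x2 v2" using eq by (simp_all add: u v)
  have w: "wderiv a b n1 x1 = wderiv a b n1 v1" "wderiv a b n2 x2 = wderiv a b n2 v2"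
    using wderiv_cong[OF Su(2) Sv(2) e(2)] wderiv_cong[OF Su(3) Sv(3) e(3)] .
  show ?thesis
    using e unfolding eq_ae_def by eventually_elim (simp add: u v w)
qed

text \<open>\<open>A_op_eq\<close> holds at every point of [a, b]; the null set arises from the
  chosen weak derivatives in the right-hand side of the PDE.\<close>

lemma A_op_pde_rhs:
  assumes y: "y \<in> L2 a b n"
    and A0: "\<forall>s\<in>{a..b}. A0 s \<in> carrier_mat n n" and A1: "\<forall>s\<in>{a..b}. A1 s \<in> carrier_mat n (n1 + n2)"
    and A2: "\<forall>s\<in>{a..b}. A2 s \<in> carrier_mat n n2"
  shows "eq_ae a b (A_op a b n0 n1 n2 B A0 A1 A2 y) (pde_rhs a b n1 n2 A0 A1 A2 (rec_state y))"
proof -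
  have "AE s in lebesgue_on {a..b}. s \<in> {a..b}" by (rule AE_I2) simp
  with rec_wderiv(2,4,6)[OF y] show ?thesis unfolding eq_ae_def
  proof eventually_elim
    case (elim s)
    have "A_op a b n0 n1 n2 B A0 A1 A2 y s = A0 s *\<^sub>v T_op a b n0 n1 n2 B y s + A1 s *\<^sub>v R_op y s
      + A2 s *\<^sub>v slice (n0 + n1) n2 (y s)"
      using A0 A1 A2 elim(4) by (intro A_op_eq[OF y]) auto
    thus ?case using elim(1-3) by (simp add: T_op_eq[OF y elim(4)] R_op_eq[OF y elim(4)] rec_state_def)
  qed
qed

lemma pie_stable_imp_pde_stable:
  assumes A: "\<forall>s\<in>{a..b}. A0 s \<in> carrier_mat n n" "\<forall>s\<in>{a..b}. A1 s \<in> carrier_mat n (n1 + n2)"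
      "\<forall>s\<in>{a..b}. A2 s \<in> carrier_mat n n2"
    and K: "0 < K" and pie: "pie_exp_stable a b n0 n1 n2 B A0 A1 A2 K \<gamma>"
  shows "\<exists>K>0. pde_exp_stable a b n0 n1 n2 B A0 A1 A2 K \<gamma>"
proof -
  obtain C where C: "0 < C" "\<And>y. y \<in> L2 a b n \<Longrightarrow> state_norm a b n0 n1 n2 (rec_state y) \<le> C * L2_norm a b y"
    by (rule rec_state_bounded) (rule that)
  \<comment> \<open>C bounds the reconstruction at time t and n the differentiation at time 0; the
    added 1 keeps the constant positive when n = 0.\<close>
  define K' where "K' = C * K * (real n + 1)"
  have "pde_exp_stable a b n0 n1 n2 B A0 A1 A2 K' \<gamma>"
    unfolding pde_exp_stable_def
  proof (intro ballI allI impI)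
    fix x_init x and t :: real
    assume init: "x_init \<in> X_space a b n0 n1 n2 B" and sol: "pde_solution a b n0 n1 n2 B A0 A1 A2 x_init x" and "0 \<le> t"
    have x: "x r \<in> X_space a b n0 n1 n2 B" if "0 \<le> r" for r
      using sol that by (simp add: pde_solution_def)
    have xS: "x r \<in> state_space a b n0 n1 n2" if "0 \<le> r" for r
      using x[OF that] X_subset_state_space by blast
    have iS: "x_init \<in> state_space a b n0 n1 n2" using init X_subset_state_space by blast
    define y where "y r = der_state (x r)" for r
    have y: "y r \<in> L2 a b n" if "0 \<le> r" for r unfolding y_def by (rule der_state_L2[OF xS[OF that]])
    \<comment> \<open>The initial datum is \<open>y 0\<close> itself, because \<open>x 0\<close> and
      \<open>x_init\<close> agree only almost everywhere; \<open>x_init\<close> returns below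
      through equality of norms.\<close>
    have "pie_solution a b n0 n1 n2 B A0 A1 A2 (y 0) y"
      unfolding pie_solution_def
    proof (intro conjI allI impI)
      fix r :: real assume r: "0 \<le> r"
      show "y r \<in> L2 a b n" by (rule y[OF r])
      obtain d where d: "state_has_deriv a b n0 n1 n2 x d r"
        "eq_ae a b (state_vec d) (pde_rhs a b n1 n2 A0 A1 A2 (x r))"
        using sol r unfolding pde_solution_def by blast
      have dS: "d \<in> state_space a b n0 n1 n2" using d(1) by (simp add: state_has_deriv_def)
      have "eq_ae a b (T_op a b n0 n1 n2 B (der_state d)) (state_vec (rec_state (der_state d)))"
        by (intro T_op_state_vec der_state_L2 dS)
      \<comment> \<open>\<open>rec_der_state\<close> does not apply to \<open>d\<close>, which is
        not known to satisfy the boundary conditions; \<open>rec_der_state_deriv\<close> stands in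
        for it.\<close>
      also have "eq_ae a b (state_vec (rec_state (der_state d))) (state_vec d)"
        by (rule state_vec_eq_ae[OF rec_der_state_deriv[of x, OF x r d(1)]])
      also note d(2)
      also have "eq_ae a b (pde_rhs a b n1 n2 A0 A1 A2 (x r)) (pde_rhs a b n1 n2 A0 A1 A2 (rec_state (y r)))"
        using rec_state_in_X[OF y[OF r]] rec_der_state[OF x[OF r]]
        by (intro eq_ae_sym[OF pde_rhs_cong] subsetD[OF X_subset_state_space] x r) (simp_all add: y_def)
      also have "eq_ae a b (pde_rhs a b n1 n2 A0 A1 A2 (rec_state (y r))) (A_op a b n0 n1 n2 B A0 A1 A2 (y r))"
        by (rule eq_ae_sym[OF A_op_pde_rhs[OF y[OF r] A]])
      finally have "eq_ae a b (T_op a b n0 n1 n2 B (der_state d)) (A_op a b n0 n1 n2 B A0 A1 A2 (y r))" .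
      moreover have "L2_has_deriv a b n y (der_state d) r"
        unfolding y_def by (rule der_state_has_deriv[of x, OF xS r d(1)])
      ultimately show "\<exists>d. L2_has_deriv a b n y d r \<and>
          eq_ae a b (T_op a b n0 n1 n2 B d) (A_op a b n0 n1 n2 B A0 A1 A2 (y r))" by blast
    qed simp
    hence yb: "L2_norm a b (y t) \<le> K * L2_norm a b (y 0) * exp (- \<gamma> * t)"
      using pie y[of 0] \<open>0 \<le> t\<close> unfolding pie_exp_stable_def by blast
    have cong: "state_norm a b n0 n1 n2 u = state_norm a b n0 n1 n2 v"
      if "u \<in> state_space a b n0 n1 n2" "v \<in> state_space a b n0 n1 n2" "state_eq_ae a b u v" for u v
      using that state_space_D(1-3)[of "fst u" "fst (snd u)" "snd (snd u)"]
        state_space_D(1-3)[of "fst v" "fst (snd v)" "snd (snd v)"] by (intro state_norm_cong) simp_all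
    have "state_norm a b n0 n1 n2 (x t) = state_norm a b n0 n1 n2 (rec_state (y t))"
      using rec_der_state[OF x[OF \<open>0 \<le> t\<close>]]
      by (intro cong[symmetric] xS \<open>0 \<le> t\<close> subsetD[OF X_subset_state_space] rec_state_in_X y) (simp_all add: y_def)
    also have "\<dots> \<le> C * L2_norm a b (y t)" by (rule C(2)[OF y[OF \<open>0 \<le> t\<close>]])
    also have "\<dots> \<le> C * (K * L2_norm a b (y 0) * exp (- \<gamma> * t))"
      using yb C(1) by (intro mult_left_mono) auto
    also have "\<dots> \<le> C * (K * ((real n + 1) * state_norm a b n0 n1 n2 x_init) * exp (- \<gamma> * t))"
    proof -
      have "L2_norm a b (y 0) \<le> real n * state_norm a b n0 n1 n2 (x 0)"
        unfolding y_def by (intro der_state_bounded xS) simp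
      also have "state_norm a b n0 n1 n2 (x 0) = state_norm a b n0 n1 n2 x_init"
        using sol by (intro cong xS iS) (simp_all add: pde_solution_def)
      also have "real n * state_norm a b n0 n1 n2 x_init \<le> (real n + 1) * state_norm a b n0 n1 n2 x_init"
        using state_norm_nonneg[OF iS] by (intro mult_right_mono) auto
      finally show ?thesis using C(1) K by (intro mult_left_mono mult_right_mono) auto
    qed
    finally show "state_norm a b n0 n1 n2 (x t) \<le> K' * state_norm a b n0 n1 n2 x_init * exp (- \<gamma> * t)"
      by (simp add: K'_def mult_ac)
  qed
  moreover have "0 < K'" using C(1) K by (simp add: K'_def)
  ultimately show ?thesis by blast
qed

text \<open>This direction has no difficulty with the derivative: every d in L2 has its
  reconstruction in X, and \<open>T_op\<close> applied to d is a representative of that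
  state.\<close>

lemma pde_stable_imp_pie_stable:
  assumes A: "\<forall>s\<in>{a..b}. A0 s \<in> carrier_mat n n" "\<forall>s\<in>{a..b}. A1 s \<in> carrier_mat n (n1 + n2)"
      "\<forall>s\<in>{a..b}. A2 s \<in> carrier_mat n n2"
    and K: "0 < K" and pde: "pde_exp_stable a b n0 n1 n2 B A0 A1 A2 K \<gamma>"
  shows "\<exists>K>0. pie_exp_stable a b n0 n1 n2 B A0 A1 A2 K \<gamma>"
proof -
  obtain C where C: "0 < C" "\<And>y. y \<in> L2 a b n \<Longrightarrow> state_norm a b n0 n1 n2 (rec_state y) \<le> C * L2_norm a b y"
    by (rule rec_state_bounded) (rule that)
  \<comment> \<open>The roles are exchanged: C now bounds the reconstructed initial state, and n the
    recovery of \<open>y t\<close> from \<open>x t\<close>.\<close>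
  define K' where "K' = (real n + 1) * K * C"
  have "pie_exp_stable a b n0 n1 n2 B A0 A1 A2 K' \<gamma>"
    unfolding pie_exp_stable_def
  proof (intro ballI allI impI)
    fix y_init y and t :: real
    assume init: "y_init \<in> L2 a b n" and sol: "pie_solution a b n0 n1 n2 B A0 A1 A2 y_init y" and "0 \<le> t"
    have y: "y r \<in> L2 a b n" if "0 \<le> r" for r using sol that by (simp add: pie_solution_def)
    define x where "x r = rec_state (y r)" for r
    have x: "x r \<in> X_space a b n0 n1 n2 B" if "0 \<le> r" for r
      unfolding x_def by (rule rec_state_in_X[OF y[OF that]])
    have xS: "x r \<in> state_space a b n0 n1 n2" if "0 \<le> r" for r
      using x[OF that] X_subset_state_space by blast
    \<comment> \<open>Again the curve's own initial value is used; \<open>y_init\<close> comes in at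
      the end, through equality of L2 norms.\<close>
    have "pde_solution a b n0 n1 n2 B A0 A1 A2 (x 0) x"
      unfolding pde_solution_def
    proof (intro conjI allI impI)
      show "state_eq_ae a b (x 0) (x 0)" by (simp add: state_eq_ae_iff)
      fix r :: real assume r: "0 \<le> r"
      show "x r \<in> X_space a b n0 n1 n2 B" by (rule x[OF r])
      obtain d where d: "L2_has_deriv a b n y d r"
        "eq_ae a b (T_op a b n0 n1 n2 B d) (A_op a b n0 n1 n2 B A0 A1 A2 (y r))"
        using sol r unfolding pie_solution_def by blast
      have dL: "d \<in> L2 a b n" using d(1) by (simp add: L2_has_deriv_def)
      have "eq_ae a b (state_vec (rec_state d)) (T_op a b n0 n1 n2 B d)"
        by (rule eq_ae_sym[OF T_op_state_vec[OF dL]])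
      also note d(2)
      also have "eq_ae a b (A_op a b n0 n1 n2 B A0 A1 A2 (y r)) (pde_rhs a b n1 n2 A0 A1 A2 (x r))"
        unfolding x_def by (rule A_op_pde_rhs[OF y[OF r] A])
      finally have "eq_ae a b (state_vec (rec_state d)) (pde_rhs a b n1 n2 A0 A1 A2 (x r))" .
      moreover have "state_has_deriv a b n0 n1 n2 x (rec_state d) r"
        unfolding x_def by (rule rec_state_has_deriv[of y, OF y r d(1)])
      ultimately show "\<exists>d. state_has_deriv a b n0 n1 n2 x d r \<and>
          eq_ae a b (state_vec d) (pde_rhs a b n1 n2 A0 A1 A2 (x r))" by blast
    qed
    hence xb: "state_norm a b n0 n1 n2 (x t) \<le> K * state_norm a b n0 n1 n2 (x 0) * exp (- \<gamma> * t)"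
      using pde x[of 0] \<open>0 \<le> t\<close> unfolding pde_exp_stable_def by blast
    \<comment> \<open>Since \<open>der_state\<close> undoes the reconstruction almost everywhere,
      its boundedness carries the estimate of \<open>x t\<close> back to \<open>y t\<close>.\<close>
    have "L2_norm a b (y t) = L2_norm a b (der_state (x t))"
      unfolding x_def
      by (rule L2_norm_cong[OF y[OF \<open>0 \<le> t\<close>] der_state_L2 eq_ae_sym[OF der_rec_state[OF y[OF \<open>0 \<le> t\<close>]]]])
        (use xS[OF \<open>0 \<le> t\<close>] in \<open>simp add: x_def\<close>)
    also have "\<dots> \<le> real n * state_norm a b n0 n1 n2 (x t)" by (rule der_state_bounded[OF xS[OF \<open>0 \<le> t\<close>]])
    also have "\<dots> \<le> (real n + 1) * state_norm a b n0 n1 n2 (x t)"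
      using state_norm_nonneg[OF xS[OF \<open>0 \<le> t\<close>]] by (intro mult_right_mono) auto
    also have "\<dots> \<le> (real n + 1) * (K * state_norm a b n0 n1 n2 (x 0) * exp (- \<gamma> * t))"
      using xb by (intro mult_left_mono) auto
    also have "\<dots> \<le> (real n + 1) * (K * (C * L2_norm a b y_init) * exp (- \<gamma> * t))"
    proof -
      have "state_norm a b n0 n1 n2 (x 0) \<le> C * L2_norm a b (y 0)" unfolding x_def by (intro C(2) y) simp
      also have "L2_norm a b (y 0) = L2_norm a b y_init"
        using sol by (intro L2_norm_cong[OF y[OF order_refl] init]) (simp add: pie_solution_def)
      finally show ?thesis using K by (intro mult_left_mono mult_right_mono) auto
    qed
    finally show "L2_norm a b (y t) \<le> K' * L2_norm a b y_init * exp (- \<gamma> * t)"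
      by (simp add: K'_def mult_ac)
  qed
  moreover have "0 < K'" using C(1) K by (simp add: K'_def)
  ultimately show ?thesis by blast
qed

end

theorem lemma15:
  fixes a b \<gamma> :: real
    and n0 n1 n2 :: nat
    and B :: "real mat"
    and A0 A1 A2 :: "real \<Rightarrow> real mat"
  assumes "a < b"
    and "B \<in> carrier_mat (n1 + 2 * n2) (2 * n1 + 4 * n2)"
    and "invertible_mat (B * T_mat a b n1 n2)"
    and "\<forall>s\<in>{a..b}. A0 s \<in> carrier_mat (n0 + n1 + n2) (n0 + n1 + n2)"
    and "\<forall>s\<in>{a..b}. A1 s \<in> carrier_mat (n0 + n1 + n2) (n1 + n2)"
    and "\<forall>s\<in>{a..b}. A2 s \<in> carrier_mat (n0 + n1 + n2) n2"
    and "\<gamma> > 0"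
  shows "(\<exists>K>0. pde_exp_stable a b n0 n1 n2 B A0 A1 A2 K \<gamma>) \<longleftrightarrow>
         (\<exists>K>0. pie_exp_stable a b n0 n1 n2 B A0 A1 A2 K \<gamma>)"
proof -
  interpret boundary_problem a b n0 n1 n2 B
    using assms(1-3) by unfold_locales
  show ?thesis
    using pde_stable_imp_pie_stable[OF assms(4-6)] pie_stable_imp_pde_stable[OF assms(4-6)] by blast
qed

end
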